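(* Let $p\ge 1$ and let $\{X_{t,N}\}_t$ be a tvARCH$(p)$ process with parameter functions $a_0,\dots,a_p$ and innovations $\{Z_t\}$. Assume: (i) there exist $0<\rho_1\le\rho_2<\infty$ and $0<\delta_0<1$ such that $\rho_1\le a_0(u)\le\rho_2$ for all $u\in(0,1]$ and $\sup_u\sum_{j=1}^p a_j(u)\le 1-\delta_0$; (ii) there exist $\beta\in(0,1]$ and a finite constant $K_0>0$ such that $|a_j(u)-a_j(v)|\le K_0|u-v|^\beta$ for all $u,v\in(0,1]$ and each $j=0,1,\dots,p$; and, for some $0<\zeta\le 2$ and $0<\delta<1$, $$\{\mathbb{E}(|Z_t|^{2(2+\zeta)})\}^{1/(2+\zeta)}\sup_u\sum_{j=1}^p a_j(u)\le 1-\delta.$$ Then, for each fixed integer $h>0$, as $N\to\infty$, $$\mathcal{S}_N(h)\xrightarrow{\mathcal{P}}\int_0^1 c(u,h)\,du+\iint_{\{0\le u<v\le 1\}}\{\mu(u)-\mu(v)\}^2\,du\,dv,$$ where $\mathcal{S}_N(h)$ is the sample autocovariance of the squares, $\mathcal{S}_N(h)=\frac1{N-h}\sum_{t=1}^{N-h}X_{t,N}^2X_{t+h,N}^2-(\bar X_N)^2$ with $\bar X_N=\frac1{N-h}\sum_{t=1}^{N-h}X_{t,N}^2$, and $\mu(u)=\mathbb{E}(\tilde X_t^2(u))$, $c(u,h)=\operatorname{cov}\{\tilde X_t^2(u),\tilde X_{t+h}^2(u)\}$, with $\{\tilde X_t(u)\}_t$ the stationary ARCH$(p)$ process with parameters 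$a_0(u),\dots,a_p(u)$.
   Context: tvARCH$(p)$ process: $a_0,\dots,a_p:(0,1]\to[0,\infty)$ are functions and $\{Z_t\}_{t\in\mathbb{Z}}$ are independent and identically distributed real random variables with $\mathbb{E}(Z_t)=0$ and $\mathbb{E}(Z_t^2)=1$. For each $N\ge1$, the process $\{X_{t,N}\}$ satisfies, for $t=1,\dots,N$, $$X_{t,N}=\sigma_{t,N}Z_t,\qquad \sigma_{t,N}^2=a_0\Big(\frac tN\Big)+\sum_{j=1}^p a_j\Big(\frac tN\Big)X_{t-j,N}^2 .$$ Convention: the recursion is extended to $t\le 0$ with $a_j(t/N)$ replaced by $\lim_{u\downarrow0}a_j(u)$, and $X_{t,N}$ is the causal solution (a function of $Z_t,Z_{t-1},\dots$) with bounded second moments. Stationary approximation: for each fixed $u\in(0,1]$, $\{\tilde X_t(u)\}_{t\in\mathbb{Z}}$ is the stationary causal solution, driven by the same innovations $\{Z_t\}$, of $$\tilde X_t(u)=\tilde\sigma_t(u)Z_t,\qquad \tilde\sigma_t^2(u)=a_0(u)+\sum_{j=1}^p a_j(u)\tilde X_{t-j}^2(u).$$ $\xrightarrow{\mathcal{P}}$ denotes convergence in probability. *)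

theory Defs
  imports "HOL-Probability.Probability"
begin

definition iid_standardized :: "'w measure \<Rightarrow> (int \<Rightarrow> 'w \<Rightarrow> real) \<Rightarrow> bool" where
  "iid_standardized M Z \<longleftrightarrow>
     prob_space.indep_vars M (\<lambda>_. borel) Z UNIV \<and>
     (\<forall>s t. distr M borel (Z s) = distr M borel (Z t)) \<and>
     (\<forall>t. integrable M (Z t) \<and> (\<integral>\<omega>. Z t \<omega> \<partial>M) = 0) \<and>
     (\<forall>t. integrable M (\<lambda>\<omega>. (Z t \<omega>)\<^sup>2) \<and> (\<integral>\<omega>. (Z t \<omega>)\<^sup>2 \<partial>M) = 1)"

text \<open>\<open>Y\<^sub>t\<close> is a Borel function of \<open>Z\<^sub>t, Z\<^sub>t\<^sub>-\<^sub>1, \<dots>\<close>, up to a null set.\<close>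

definition causal_at :: "'w measure \<Rightarrow> (int \<Rightarrow> 'w \<Rightarrow> real) \<Rightarrow> (int \<Rightarrow> 'w \<Rightarrow> real) \<Rightarrow> int \<Rightarrow> bool" where
  "causal_at M Z Y t \<longleftrightarrow>
     Y t \<in> borel_measurable M \<and>
     (\<exists>g \<in> borel_measurable (\<Pi>\<^sub>M k\<in>(UNIV :: nat set). (borel :: real measure)).
        AE \<omega> in M. Y t \<omega> = g (\<lambda>k. Z (t - int k) \<omega>))"

definition strictly_stationary :: "'w measure \<Rightarrow> (int \<Rightarrow> 'w \<Rightarrow> real) \<Rightarrow> bool" where
  "strictly_stationary M Y \<longleftrightarrow>
     (\<forall>t. Y t \<in> borel_measurable M) \<and>
     (\<forall>k. distr M (\<Pi>\<^sub>M t\<in>UNIV. borel) (\<lambda>\<omega> t. Y (t + k) \<omega>) =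
          distr M (\<Pi>\<^sub>M t\<in>UNIV. borel) (\<lambda>\<omega> t. Y t \<omega>))"

text \<open>The ARCH equations at the times in \<open>T\<close>, where \<open>\<alpha> j t\<close> is the \<open>j\<close>-th coefficient at
  time \<open>t\<close>. The sign of the volatility \<open>\<sigma>\<close> is left free: only \<open>\<sigma>\<^sup>2\<close> is determined by the
  recursion, and the squares \<open>Y\<^sup>2\<close> do not depend on it.\<close>

definition arch_equations ::
  "'w measure \<Rightarrow> (int \<Rightarrow> 'w \<Rightarrow> real) \<Rightarrow> nat \<Rightarrow> (nat \<Rightarrow> int \<Rightarrow> real) \<Rightarrow> int set \<Rightarrow>
   (int \<Rightarrow> 'w \<Rightarrow> real) \<Rightarrow> bool" where
  "arch_equations M Z p \<alpha> T Y \<longleftrightarrow>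
     (\<exists>\<sigma> :: int \<Rightarrow> 'w \<Rightarrow> real. \<forall>t\<in>T. AE \<omega> in M.
        Y t \<omega> = \<sigma> t \<omega> * Z t \<omega> \<and>
        (\<sigma> t \<omega>)\<^sup>2 = \<alpha> 0 t + (\<Sum>j=1..p. \<alpha> j t * (Y (t - int j) \<omega>)\<^sup>2))"

definition extend_by_right_limit :: "(real \<Rightarrow> real) \<Rightarrow> real \<Rightarrow> real" where
  "extend_by_right_limit f u = (if u \<le> 0 then Lim (at_right 0) f else f u)"

text \<open>\<open>X N t\<close> is the process at time \<open>t\<close> of the \<open>N\<close>-th row. The values \<open>a j u\<close> are only used
  for \<open>0 < u \<le> 1\<close>, and \<open>X N t\<close> only for \<open>t \<le> N\<close>.\<close>

definition tvarch ::
  "'w measure \<Rightarrow> (int \<Rightarrow> 'w \<Rightarrow> real) \<Rightarrow> nat \<Rightarrow> (nat \<Rightarrow> real \<Rightarrow> real) \<Rightarrow>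
   (nat \<Rightarrow> int \<Rightarrow> 'w \<Rightarrow> real) \<Rightarrow> bool" where
  "tvarch M Z p a X \<longleftrightarrow>
     (\<forall>N\<ge>1.
        arch_equations M Z p
          (\<lambda>j t. extend_by_right_limit (a j) (real_of_int t / real N)) {..int N} (X N) \<and>
        (\<forall>t\<le>int N. causal_at M Z (X N) t) \<and>
        (\<exists>C. \<forall>t\<le>int N. integrable M (\<lambda>\<omega>. (X N t \<omega>)\<^sup>2) \<and> (\<integral>\<omega>. (X N t \<omega>)\<^sup>2 \<partial>M) \<le> C))"

definition stationary_arch ::
  "'w measure \<Rightarrow> (int \<Rightarrow> 'w \<Rightarrow> real) \<Rightarrow> nat \<Rightarrow> (nat \<Rightarrow> real) \<Rightarrow> (int \<Rightarrow> 'w \<Rightarrow> real) \<Rightarrow> bool" where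
  "stationary_arch M Z p \<alpha> Y \<longleftrightarrow>
     arch_equations M Z p (\<lambda>j t. \<alpha> j) UNIV Y \<and>
     (\<forall>t. causal_at M Z Y t) \<and>
     strictly_stationary M Y"

definition covariance :: "'w measure \<Rightarrow> ('w \<Rightarrow> real) \<Rightarrow> ('w \<Rightarrow> real) \<Rightarrow> real" where
  "covariance M V W =
     (\<integral>\<omega>. (V \<omega> - (\<integral>\<omega>'. V \<omega>' \<partial>M)) * (W \<omega> - (\<integral>\<omega>'. W \<omega>' \<partial>M)) \<partial>M)"

definition sample_mean_sq :: "(int \<Rightarrow> real) \<Rightarrow> nat \<Rightarrow> nat \<Rightarrow> real" where
  "sample_mean_sq x N h = (\<Sum>t=1..int N - int h. (x t)\<^sup>2) / (real N - real h)"

definition sample_autocov_sq :: "(int \<Rightarrow> real) \<Rightarrow> nat \<Rightarrow> nat \<Rightarrow> real" where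
  "sample_autocov_sq x N h =
     (\<Sum>t=1..int N - int h. (x t)\<^sup>2 * (x (t + int h))\<^sup>2) / (real N - real h)
       - (sample_mean_sq x N h)\<^sup>2"

definition converges_in_prob :: "'w measure \<Rightarrow> (nat \<Rightarrow> 'w \<Rightarrow> real) \<Rightarrow> real \<Rightarrow> bool" where
  "converges_in_prob M S L \<longleftrightarrow>
     (\<forall>\<epsilon>>0. (\<lambda>N. measure M {\<omega> \<in> space M. \<bar>S N \<omega> - L\<bar> > \<epsilon>}) \<longlonglongrightarrow> 0)"

end

theory Submission
  imports Defs
begin

text \<open>Put \<open>W\<^sub>t = Z\<^sub>t\<^sup>2\<close>, so that \<open>Y = X\<^sup>2\<close> solves the affine recursion
  \<open>Y\<^sub>t = W\<^sub>t (\<alpha>\<^sub>0 + \<Sum>\<^sub>j \<alpha>\<^sub>j Y\<^sub>t\<^sub>-\<^sub>j)\<close>, in which \<open>W\<^sub>t\<close> is independent of the past. By Lyapunov's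
  inequality the moment condition gives \<open>\<parallel>W\<parallel>\<^sub>2 \<Sum>\<^sub>j \<alpha>\<^sub>j \<le> 1 - \<delta>\<close>, so the recursion contracts in \<open>L\<^sup>2\<close>. Hence
  \<open>Y\<close> is bounded in \<open>L\<^sup>2\<close>, it is approximated in \<open>L\<^sup>2\<close>, uniformly in time and in the row, by finitely many
  iterations with truncated noise, and solutions with nearby coefficients are close in \<open>L\<^sup>2\<close>.
  The approximants are bounded and depend on finitely many innovations, so the averages of
  \<open>Y\<^sub>t\<close> and \<open>Y\<^sub>t Y\<^sub>t\<^sub>+\<^sub>h\<close> obey a weak law in \<open>L\<^sup>1\<close>. Comparison with the stationary process at \<open>u\<close> shows that
  the step functions \<open>u \<mapsto> E Y\<^sub>t\<close> and \<open>u \<mapsto> E Y\<^sub>t Y\<^sub>t\<^sub>+\<^sub>h\<close> with \<open>t = \<lceil>N u\<rceil>\<close> converge pointwise, so their integrals, which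
  are the means of the averages up to a factor tending to one, converge by dominated convergence.
  The limit of the sample autocovariance is therefore
  \<open>\<integral> (c + \<mu>\<^sup>2) - (\<integral> \<mu>)\<^sup>2\<close>, and \<open>\<integral> \<mu>\<^sup>2 - (\<integral> \<mu>)\<^sup>2\<close> is the double integral.\<close>

section \<open>Square integrable random variables\<close>

text \<open>Neither kind of solution comes with the moments that an L^2 argument uses: a row has
  bounded second moments of X, hence only first moments of Y, and a stationary solution is given
  with no moment at all. Boundedness in L^2 is therefore obtained through uniqueness. Started at
  zero, the recursion gives increasing iterates with a common L^2 bound; any causal nonnegative
  solution that is tight uniformly in time coincides with their limit. Tightness follows both from
  bounded second moments and from stationarity, so rows and stationary processes share the same
  lemmas.

  The products of two squares are only known to lie in L^1, so their averages have no variance to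
  estimate. Truncating the noise yields bounded approximants, for which a variance bound is
  available, and the L^1 error carries the law back.

  Older times are forgotten at rate (1 - \<delta>)^n, so two solutions need close coefficients only
  on a window of p n times. In rescaled time such a window shrinks to the point u, which is where
  Hoelder continuity enters.\<close>

context prob_space begin

definition sq_int :: "('a \<Rightarrow> real) \<Rightarrow> bool" where
  "sq_int f \<longleftrightarrow> f \<in> borel_measurable M \<and> integrable M (\<lambda>x. (f x)\<^sup>2)"

definition l2norm :: "('a \<Rightarrow> real) \<Rightarrow> real" where
  "l2norm f = sqrt (\<integral>x. (f x)\<^sup>2 \<partial>M)"

lemma l2norm_nonneg [simp]: "0 \<le> l2norm f"
  by (simp add: l2norm_def)

lemma l2norm_squared: "(l2norm f)\<^sup>2 = (\<integral>x. (f x)\<^sup>2 \<partial>M)"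
  by (simp add: l2norm_def)

lemma sq_int_mult_integrable:
  assumes "sq_int f" "sq_int g"
  shows "integrable M (\<lambda>x. f x * g x)"
proof (rule Bochner_Integration.integrable_bound)
  show "integrable M (\<lambda>x. (f x)\<^sup>2 + (g x)\<^sup>2)"
    using assms by (auto simp: sq_int_def)
  show "(\<lambda>x. f x * g x) \<in> borel_measurable M"
    using assms by (auto simp: sq_int_def)
  show "AE x in M. norm (f x * g x) \<le> norm ((f x)\<^sup>2 + (g x)\<^sup>2)"
  proof (intro AE_I2)
    fix x
    have "2 * (\<bar>f x\<bar> * \<bar>g x\<bar>) \<le> (f x)\<^sup>2 + (g x)\<^sup>2"
      using sum_squares_bound[of "\<bar>f x\<bar>" "\<bar>g x\<bar>"] by simp
    moreover have "0 \<le> \<bar>f x\<bar> * \<bar>g x\<bar>" by simp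
    ultimately have "\<bar>f x\<bar> * \<bar>g x\<bar> \<le> (f x)\<^sup>2 + (g x)\<^sup>2" by linarith
    then show "norm (f x * g x) \<le> norm ((f x)\<^sup>2 + (g x)\<^sup>2)"
      by (simp add: abs_mult)
  qed
qed

lemma sq_int_integrable:
  assumes "sq_int f" shows "integrable M f"
  using sq_int_mult_integrable[OF assms, of "\<lambda>_. 1"] by (simp add: sq_int_def)

lemma sq_int_abs: "sq_int f \<Longrightarrow> sq_int (\<lambda>x. \<bar>f x\<bar>)"
  by (auto simp: sq_int_def)

lemma l2norm_abs [simp]: "l2norm (\<lambda>x. \<bar>f x\<bar>) = l2norm f"
  by (simp add: l2norm_def)

text \<open>The square of \<open>b * f - a * g\<close> has nonnegative integral;
  \<open>a = l2norm f\<close> and \<open>b = l2norm g\<close> give the claim after division by the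
  product of the norms. If one norm vanishes, scaling by an arbitrary t makes the left side linear
  in t against a fixed right side, which forces the integral to be at most zero.\<close>

lemma l2_Cauchy_Schwarz:
  assumes "sq_int f" "sq_int g"
  shows "(\<integral>x. f x * g x \<partial>M) \<le> l2norm f * l2norm g"
proof -
  let ?F = "l2norm f" and ?G = "l2norm g"
  have fg: "integrable M (\<lambda>x. f x * g x)" by (rule sq_int_mult_integrable[OF assms])
  have f2: "integrable M (\<lambda>x. (f x)\<^sup>2)" and g2: "integrable M (\<lambda>x. (g x)\<^sup>2)"
    using assms by (auto simp: sq_int_def)
  have ineq: "2 * a * b * (\<integral>x. f x * g x \<partial>M) \<le> b\<^sup>2 * ?F\<^sup>2 + a\<^sup>2 * ?G\<^sup>2" for a b :: real
  proof -
    have "0 \<le> (\<integral>x. (b * f x - a * g x)\<^sup>2 \<partial>M)" by simp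
    also have "\<dots> = (\<integral>x. b\<^sup>2 * (f x)\<^sup>2 + a\<^sup>2 * (g x)\<^sup>2 - (2 * a * b) * (f x * g x) \<partial>M)"
      by (intro Bochner_Integration.integral_cong) (auto simp: power2_eq_square algebra_simps)
    also have "\<dots> = b\<^sup>2 * ?F\<^sup>2 + a\<^sup>2 * ?G\<^sup>2 - 2 * a * b * (\<integral>x. f x * g x \<partial>M)"
      using fg f2 g2 by (simp add: l2norm_squared)
    finally show ?thesis by simp
  qed
  show ?thesis
  proof (cases "?F = 0 \<or> ?G = 0")
    case False
    then have pos: "0 < ?F * ?G" by (simp add: order_less_le)
    have "2 * ?F * ?G * (\<integral>x. f x * g x \<partial>M) \<le> 2 * (?F * ?G) * (?F * ?G)"
      using ineq[of ?F ?G] by (simp add: power2_eq_square algebra_simps)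
    then have "(?F * ?G) * (\<integral>x. f x * g x \<partial>M) \<le> (?F * ?G) * (?F * ?G)" by simp
    then show ?thesis using pos by (meson mult_le_cancel_left_pos)
  next
    case True
    let ?I = "\<integral>x. f x * g x \<partial>M"
    have bound: "2 * t * ?I \<le> ?F\<^sup>2 + ?G\<^sup>2" if "0 < t" for t
    proof (cases "?G = 0")
      case True then show ?thesis using ineq[of t 1] by simp
    next
      case False then show ?thesis using \<open>?F = 0 \<or> ?G = 0\<close> ineq[of 1 t] by (simp add: algebra_simps)
    qed
    have "?I \<le> 0"
    proof (rule ccontr)
      assume "\<not> ?I \<le> 0"
      then have "0 < ?I" by simp
      then have "2 * ((?F\<^sup>2 + ?G\<^sup>2 + 1) / ?I) * ?I \<le> ?F\<^sup>2 + ?G\<^sup>2"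
        by (intro bound) (auto intro!: divide_pos_pos add_nonneg_pos)
      moreover have "0 \<le> ?F\<^sup>2" "0 \<le> ?G\<^sup>2" by auto
      ultimately show False using \<open>0 < ?I\<close> by simp
    qed
    then show ?thesis using mult_nonneg_nonneg[OF l2norm_nonneg l2norm_nonneg] by (meson order_trans)
  qed
qed

lemma l2_Cauchy_Schwarz_abs:
  assumes "sq_int f" "sq_int g"
  shows "(\<integral>x. \<bar>f x * g x\<bar> \<partial>M) \<le> l2norm f * l2norm g"
  using l2_Cauchy_Schwarz[OF sq_int_abs[OF assms(1)] sq_int_abs[OF assms(2)]] by (simp add: abs_mult)

lemma l1_le_l2norm:
  assumes "sq_int f" shows "(\<integral>x. \<bar>f x\<bar> \<partial>M) \<le> l2norm f"
proof -
  have "l2norm (\<lambda>_. 1) = 1" by (simp add: l2norm_def prob_space)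
  moreover have "sq_int (\<lambda>_. 1)" by (simp add: sq_int_def)
  ultimately show ?thesis using l2_Cauchy_Schwarz_abs[OF assms, of "\<lambda>_. 1"] by simp
qed

lemma sq_int_add:
  assumes "sq_int f" "sq_int g" shows "sq_int (\<lambda>x. f x + g x)"
proof -
  have "integrable M (\<lambda>x. (f x)\<^sup>2 + (g x)\<^sup>2 + 2 * (f x * g x))"
    using assms sq_int_mult_integrable[OF assms] by (auto simp: sq_int_def)
  then show ?thesis using assms by (auto simp: sq_int_def power2_sum algebra_simps)
qed

lemma l2norm_add:
  assumes "sq_int f" "sq_int g"
  shows "l2norm (\<lambda>x. f x + g x) \<le> l2norm f + l2norm g"
proof -
  have "(l2norm (\<lambda>x. f x + g x))\<^sup>2 = (\<integral>x. (f x)\<^sup>2 + (g x)\<^sup>2 + 2 * (f x * g x) \<partial>M)"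
    by (simp add: l2norm_squared power2_sum algebra_simps)
  also have "\<dots> = (l2norm f)\<^sup>2 + (l2norm g)\<^sup>2 + 2 * (\<integral>x. f x * g x \<partial>M)"
    using assms sq_int_mult_integrable[OF assms] by (simp add: l2norm_squared sq_int_def)
  also have "\<dots> \<le> (l2norm f + l2norm g)\<^sup>2"
    using l2_Cauchy_Schwarz[OF assms] by (simp add: power2_sum)
  finally show ?thesis by (rule power2_le_imp_le) simp
qed

lemma sq_int_cmult: "sq_int f \<Longrightarrow> sq_int (\<lambda>x. c * f x)"
  by (auto simp: sq_int_def power_mult_distrib)

lemma l2norm_cmult: "l2norm (\<lambda>x. c * f x) = \<bar>c\<bar> * l2norm f"
  by (simp add: l2norm_def power_mult_distrib real_sqrt_mult)

lemma sq_int_const [simp]: "sq_int (\<lambda>_. c)"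
  by (simp add: sq_int_def)

lemma l2norm_const [simp]: "l2norm (\<lambda>_. c) = \<bar>c\<bar>"
  by (simp add: l2norm_def prob_space)

lemma sq_int_diff:
  assumes "sq_int f" "sq_int g" shows "sq_int (\<lambda>x. f x - g x)"
  using sq_int_add[OF assms(1) sq_int_cmult[OF assms(2), of "-1"]] by simp

lemma l2norm_diff:
  assumes "sq_int f" "sq_int g"
  shows "l2norm (\<lambda>x. f x - g x) \<le> l2norm f + l2norm g"
  using l2norm_add[OF assms(1) sq_int_cmult[OF assms(2), of "-1"]] l2norm_cmult[of "-1" g]
  by simp

lemma sq_int_sum:
  assumes "\<And>i. i \<in> I \<Longrightarrow> sq_int (f i)"
  shows "sq_int (\<lambda>x. \<Sum>i\<in>I. f i x)"
  using assms by (induction I rule: infinite_finite_induct) (auto intro: sq_int_add)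

lemma l2norm_sum:
  assumes "\<And>i. i \<in> I \<Longrightarrow> sq_int (f i)"
  shows "l2norm (\<lambda>x. \<Sum>i\<in>I. f i x) \<le> (\<Sum>i\<in>I. l2norm (f i))"
  using assms
proof (induction I rule: infinite_finite_induct)
  case (insert i I)
  have "l2norm (\<lambda>x. \<Sum>i\<in>insert i I. f i x) = l2norm (\<lambda>x. f i x + (\<Sum>i\<in>I. f i x))"
    using insert.hyps by simp
  also have "\<dots> \<le> l2norm (f i) + l2norm (\<lambda>x. \<Sum>i\<in>I. f i x)"
    using insert.prems by (intro l2norm_add sq_int_sum) auto
  finally show ?case using insert by fastforce
qed auto

lemma sq_int_AE_bound:
  assumes "sq_int g" "f \<in> borel_measurable M" "AE x in M. \<bar>f x\<bar> \<le> \<bar>g x\<bar>"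
  shows "sq_int f" and "l2norm f \<le> l2norm g"
proof -
  have le: "AE x in M. (f x)\<^sup>2 \<le> (g x)\<^sup>2"
    using assms(3) by eventually_elim (simp add: abs_le_square_iff)
  have "integrable M (\<lambda>x. (f x)\<^sup>2)"
    by (rule Bochner_Integration.integrable_bound[of _ "\<lambda>x. (g x)\<^sup>2"]) (use assms le in \<open>auto simp: sq_int_def\<close>)
  then show "sq_int f" using assms by (simp add: sq_int_def)
  then show "l2norm f \<le> l2norm g"
    using assms(1) le unfolding l2norm_def
    by (intro real_sqrt_le_mono integral_mono_AE) (auto simp: sq_int_def)
qed

lemma sq_int_AE_cong:
  assumes "sq_int g" "f \<in> borel_measurable M" "AE x in M. f x = g x"
  shows "sq_int f" and "l2norm f = l2norm g"
proof -
  have le: "AE x in M. \<bar>f x\<bar> \<le> \<bar>g x\<bar>" "AE x in M. \<bar>g x\<bar> \<le> \<bar>f x\<bar>"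
    using assms(3) by (eventually_elim, simp)+
  show f: "sq_int f" using sq_int_AE_bound(1)[OF assms(1,2) le(1)] .
  show "l2norm f = l2norm g"
    using f assms le by (intro antisym sq_int_AE_bound(2)) (auto simp: sq_int_def)
qed

lemma l2norm_triangle_AE:
  assumes "sq_int f" "sq_int g" "d \<in> borel_measurable M" "AE x in M. d x = f x + g x"
  shows "sq_int d" and "l2norm d \<le> l2norm f + l2norm g"
  using sq_int_AE_cong[OF sq_int_add[OF assms(1,2)] assms(3,4)] l2norm_add[OF assms(1,2)] by auto

lemma sq_int_bounded:
  assumes "f \<in> borel_measurable M" "\<And>x. \<bar>f x\<bar> \<le> B"
  shows "sq_int f"
  by (rule sq_int_AE_bound(1)[OF sq_int_const[of B]])
     (use assms in \<open>auto intro!: AE_I2 order_trans[OF _ abs_ge_self]\<close>)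

text \<open>A product of two square integrable variables is in general only integrable. Independence
  of the squares keeps it in L^2, which is why the recursion acts on L^2 although the noise
  multiplies the past.\<close>

lemma l2norm_mult_indep:
  assumes "indep_var borel f borel g" "sq_int f" "sq_int g"
  shows "sq_int (\<lambda>x. f x * g x)" and "l2norm (\<lambda>x. f x * g x) = l2norm f * l2norm g"
proof -
  have ind: "indep_var borel (\<lambda>x. (f x)\<^sup>2) borel (\<lambda>x. (g x)\<^sup>2)"
    using indep_var_compose[OF assms(1), of "\<lambda>x. x\<^sup>2" borel "\<lambda>x. x\<^sup>2" borel] by (simp add: comp_def)
  have int: "integrable M (\<lambda>x. (f x)\<^sup>2)" "integrable M (\<lambda>x. (g x)\<^sup>2)"
    using assms by (auto simp: sq_int_def)
  show "sq_int (\<lambda>x. f x * g x)"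
    using indep_var_integrable[OF ind int] assms by (auto simp: sq_int_def power_mult_distrib)
  show "l2norm (\<lambda>x. f x * g x) = l2norm f * l2norm g"
    using indep_var_lebesgue_integral[OF ind int]
    by (simp add: l2norm_def power_mult_distrib real_sqrt_mult)
qed

text \<open>Fatou's lemma, applied to the squares. It turns a uniform bound for iterates into a
  bound for the solution to which they converge, whose square integrability is not known
  beforehand.\<close>

lemma l2norm_limit_bound:
  assumes "\<And>n. sq_int (f n)" "\<And>n. l2norm (f n) \<le> C" "g \<in> borel_measurable M"
    and "AE x in M. (\<lambda>n. f n x) \<longlonglongrightarrow> g x"
  shows "sq_int g" and "l2norm g \<le> C"
proof -
  have C: "0 \<le> C" using assms(2)[of 0] l2norm_nonneg[of "f 0"] by linarith
  have fb: "(\<integral>\<^sup>+x. ennreal ((f n x)\<^sup>2) \<partial>M) \<le> ennreal (C\<^sup>2)" for n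
  proof -
    have "(\<integral>\<^sup>+x. ennreal ((f n x)\<^sup>2) \<partial>M) = ennreal (\<integral>x. (f n x)\<^sup>2 \<partial>M)"
      using assms(1)[of n] by (intro nn_integral_eq_integral) (auto simp: sq_int_def)
    also have "\<dots> \<le> ennreal (C\<^sup>2)"
      unfolding l2norm_squared[symmetric] using assms(2)[of n] by (intro ennreal_leI power_mono) auto
    finally show ?thesis .
  qed
  have "(\<integral>\<^sup>+x. ennreal ((g x)\<^sup>2) \<partial>M) = (\<integral>\<^sup>+x. liminf (\<lambda>n. ennreal ((f n x)\<^sup>2)) \<partial>M)"
  proof (rule nn_integral_cong_AE, use assms(4) in eventually_elim)
    fix x assume "(\<lambda>n. f n x) \<longlonglongrightarrow> g x"
    then have "(\<lambda>n. ennreal ((f n x)\<^sup>2)) \<longlonglongrightarrow> ennreal ((g x)\<^sup>2)"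
      by (intro tendsto_ennrealI tendsto_power)
    then show "ennreal ((g x)\<^sup>2) = liminf (\<lambda>n. ennreal ((f n x)\<^sup>2))"
      by (intro lim_imp_Liminf[symmetric]) auto
  qed
  also have "\<dots> \<le> liminf (\<lambda>n. \<integral>\<^sup>+x. ennreal ((f n x)\<^sup>2) \<partial>M)"
    using assms(1) by (intro nn_integral_liminf) (auto simp: sq_int_def)
  also have "\<dots> \<le> liminf (\<lambda>n. ennreal (C\<^sup>2))"
    using fb by (intro Liminf_mono) auto
  also have "\<dots> = ennreal (C\<^sup>2)" by (simp add: Liminf_const)
  finally have le: "(\<integral>\<^sup>+x. ennreal ((g x)\<^sup>2) \<partial>M) \<le> ennreal (C\<^sup>2)" .
  then have int: "integrable M (\<lambda>x. (g x)\<^sup>2)"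
    using assms(3) by (intro integrableI_bounded) (auto simp: le_less_trans)
  then show "sq_int g" using assms(3) by (simp add: sq_int_def)
  have "ennreal (\<integral>x. (g x)\<^sup>2 \<partial>M) \<le> ennreal (C\<^sup>2)"
    using le int by (subst nn_integral_eq_integral[symmetric]) auto
  then have "(l2norm g)\<^sup>2 \<le> C\<^sup>2" by (simp add: l2norm_squared)
  then show "l2norm g \<le> C" using C by (rule power2_le_imp_le)
qed

text \<open>Insert \<open>f' x * g x\<close> and apply Cauchy-Schwarz to both terms. Errors of the
  factors in L^2 become an error of the product in L^1, the natural space for products of
  squares.\<close>

lemma product_l1_diff:
  assumes "sq_int f" "sq_int g" "sq_int f'" "sq_int g'"
  shows "(\<integral>x. \<bar>f x * g x - f' x * g' x\<bar> \<partial>M) \<le> l2norm (\<lambda>x. f x - f' x) * l2norm g + l2norm f' * l2norm (\<lambda>x. g x - g' x)"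
proof -
  note d = sq_int_diff[OF assms(1,3)] sq_int_diff[OF assms(2,4)]
  have "(\<integral>x. \<bar>f x * g x - f' x * g' x\<bar> \<partial>M)
      \<le> (\<integral>x. \<bar>(f x - f' x) * g x\<bar> + \<bar>f' x * (g x - g' x)\<bar> \<partial>M)"
  proof (rule integral_mono)
    show "integrable M (\<lambda>x. \<bar>f x * g x - f' x * g' x\<bar>)"
      using assms by (intro integrable_abs Bochner_Integration.integrable_diff sq_int_mult_integrable)
    show "integrable M (\<lambda>x. \<bar>(f x - f' x) * g x\<bar> + \<bar>f' x * (g x - g' x)\<bar>)"
      using assms d by (intro Bochner_Integration.integrable_add integrable_abs sq_int_mult_integrable)
    show "\<bar>f x * g x - f' x * g' x\<bar> \<le> \<bar>(f x - f' x) * g x\<bar> + \<bar>f' x * (g x - g' x)\<bar>" for x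
    proof -
      have "f x * g x - f' x * g' x = (f x - f' x) * g x + f' x * (g x - g' x)" by (simp add: algebra_simps)
      then show ?thesis by (simp only: abs_triangle_ineq)
    qed
  qed
  also have "\<dots> = (\<integral>x. \<bar>(f x - f' x) * g x\<bar> \<partial>M) + (\<integral>x. \<bar>f' x * (g x - g' x)\<bar> \<partial>M)"
    using assms d by (intro Bochner_Integration.integral_add integrable_abs sq_int_mult_integrable)
  also have "\<dots> \<le> l2norm (\<lambda>x. f x - f' x) * l2norm g + l2norm f' * l2norm (\<lambda>x. g x - g' x)"
    using assms d by (intro add_mono l2_Cauchy_Schwarz_abs)
  finally show ?thesis .
qed

text \<open>Hoelder's inequality against the constant 1, derived from Young's inequality. It serves
  for the fourth power of an innovation with q = (2 + \<zeta>)/2.\<close>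

lemma Lyapunov_square:
  fixes q :: real
  assumes "1 < q" "\<And>x. 0 \<le> f x" "f \<in> borel_measurable M" "integrable M (\<lambda>x. f x powr q)"
  shows "integrable M f" and "(\<integral>x. f x \<partial>M) \<le> (\<integral>x. f x powr q \<partial>M) powr (1 / q)"
proof -
  define q' where "q' = q / (q - 1)"
  have q': "1 < q'" "1 / q' = 1 - 1 / q" "1 / q + 1 / q' = 1"
    using assms(1) by (auto simp: q'_def field_simps)
  let ?J = "\<integral>x. f x powr q \<partial>M"
  have young: "f x * b \<le> f x powr q / q + b powr q' / q'" if "0 \<le> b" for x b
    using Youngs_inequality[OF assms(1) q'(1) q'(3) assms(2) that] by simp
  show int: "integrable M f"
  proof (rule Bochner_Integration.integrable_bound)
    show "integrable M (\<lambda>x. f x powr q / q + 1 / q')" using assms by auto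
    show "AE x in M. norm (f x) \<le> norm (f x powr q / q + 1 / q')"
      using young[of 1] assms(2) by (intro AE_I2) (auto intro: order_trans[OF _ abs_ge_self])
  qed fact
  have ineq: "(\<integral>x. f x \<partial>M) * b \<le> ?J / q + b powr q' / q'" if "0 \<le> b" for b
  proof -
    have "(\<integral>x. f x * b \<partial>M) \<le> (\<integral>x. f x powr q / q + b powr q' / q' \<partial>M)"
      using int assms(4) young[OF that] by (intro integral_mono) auto
    then show ?thesis using int assms(4) by (simp add: prob_space)
  qed
  have J0: "0 \<le> ?J" by simp
  show "(\<integral>x. f x \<partial>M) \<le> ?J powr (1 / q)"
  proof (cases "?J = 0")
    case True
    have "AE x in M. f x powr q = 0"
      using True integral_nonneg_eq_0_iff_AE[OF assms(4)] by auto
    then have "AE x in M. f x = 0" by eventually_elim (use assms(2) in auto)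
    then have "(\<integral>x. f x \<partial>M) = 0" by (simp add: integral_eq_zero_AE)
    then show ?thesis by simp
  next
    case False
    then have J: "0 < ?J" using J0 by linarith
    \<comment> \<open>With this choice the right side of \<open>ineq\<close> collapses to
      \<open>?J\<close>, which equals \<open>?J powr (1 / q) * b\<close>, so that \<open>b\<close>
      cancels. Cancelling requires \<open>?J\<close> to be positive, hence the case split.\<close>
    define b where "b = ?J powr (1 / q')"
    have b: "b powr q' = ?J" using J q'(1) by (simp add: b_def powr_powr)
    have "(\<integral>x. f x \<partial>M) * b \<le> ?J * (1 / q + 1 / q')"
      using ineq[of b] b by (simp add: b_def field_simps)
    also have "\<dots> = ?J powr (1 / q) * b"
      unfolding q'(3) b_def powr_add[symmetric] using J by simp
    finally show ?thesis using J by (simp add: b_def)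
  qed
qed

end

section \<open>Innovations and the sigma algebras they generate\<close>

locale innovations = prob_space M for M :: "'a measure" +
  fixes Z :: "int \<Rightarrow> 'a \<Rightarrow> real"
  assumes indep: "indep_vars (\<lambda>_. borel) Z UNIV"
begin

text \<open>The sigma algebra generated by the innovations with index in \<open>A\<close>. As a
  vimage algebra its sets are exactly the preimages of measurable sets of paths, the form in which
  independence of subfamilies is available.\<close>

definition sig :: "int set \<Rightarrow> 'a measure" where
  "sig A = vimage_algebra (space M) (\<lambda>\<omega>. \<lambda>i\<in>A. Z i \<omega>) (PiM A (\<lambda>_. borel))"

lemma Z_measurable [measurable]: "Z i \<in> borel_measurable M"
  using indep by (auto simp: indep_vars_def)

lemma space_sig [simp]: "space (sig A) = space M"
  by (simp add: sig_def)

lemma restrict_Z_measurable: "(\<lambda>\<omega>. \<lambda>i\<in>A. Z i \<omega>) \<in> measurable (sig A) (PiM A (\<lambda>_. borel))"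
  unfolding sig_def by (rule measurable_vimage_algebra1) (auto simp: space_PiM)

lemma sets_sig_subset:
  assumes "(\<lambda>\<omega>. \<lambda>i\<in>A. Z i \<omega>) \<in> measurable N (PiM A (\<lambda>_. borel))" "space N = space M"
  shows "sets (sig A) \<subseteq> sets N"
proof -
  have "sets (sig A) = {(\<lambda>\<omega>. \<lambda>i\<in>A. Z i \<omega>) -` B \<inter> space M | B. B \<in> sets (PiM A (\<lambda>_. borel))}"
    unfolding sig_def by (rule sets_vimage_algebra2) (auto simp: space_PiM)
  then show ?thesis using measurable_sets[OF assms(1)] assms(2) by auto
qed

lemma sets_sig_mono: "A \<subseteq> B \<Longrightarrow> sets (sig A) \<subseteq> sets (sig B)"
proof (rule sets_sig_subset)
  assume AB: "A \<subseteq> B"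
  have "(\<lambda>\<omega>. restrict (\<lambda>i\<in>B. Z i \<omega>) A) \<in> measurable (sig B) (PiM A (\<lambda>_. borel))"
    by (rule measurable_compose[OF restrict_Z_measurable measurable_restrict_subset[OF AB]])
  also have "(\<lambda>\<omega>. restrict (\<lambda>i\<in>B. Z i \<omega>) A) = (\<lambda>\<omega>. \<lambda>i\<in>A. Z i \<omega>)"
    using AB by (auto simp: fun_eq_iff restrict_def)
  finally show "(\<lambda>\<omega>. \<lambda>i\<in>A. Z i \<omega>) \<in> measurable (sig B) (PiM A (\<lambda>_. borel))" .
qed simp

lemma sets_sig_M: "sets (sig A) \<subseteq> sets M"
  by (rule sets_sig_subset) (auto intro: measurable_restrict)

lemma measurable_sig_mono:
  "f \<in> measurable (sig A) N \<Longrightarrow> A \<subseteq> B \<Longrightarrow> f \<in> measurable (sig B) N"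
  using measurable_mono[of N N "sig A" "sig B"] sets_sig_mono[of A B] by auto

lemma measurable_sig_M: "f \<in> measurable (sig A) N \<Longrightarrow> f \<in> measurable M N"
  using measurable_mono[of N N "sig A" M] sets_sig_M[of A] by auto

lemma Z_measurable_sig: "i \<in> A \<Longrightarrow> Z i \<in> borel_measurable (sig A)"
proof -
  assume i: "i \<in> A"
  have "(\<lambda>\<omega>. (\<lambda>i\<in>A. Z i \<omega>) i) \<in> borel_measurable (sig A)"
    by (rule measurable_compose[OF restrict_Z_measurable measurable_component_singleton[OF i]])
  then show ?thesis using i by simp
qed

text \<open>Subfamilies with disjoint index sets are independent as path-valued variables. All
  preimages under \<open>f\<close> and \<open>g\<close> lie in the sigma algebras generated by
  these, and independence passes to smaller set systems.\<close>

lemma indep_sig: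
  assumes f: "f \<in> borel_measurable (sig A)" and g: "g \<in> borel_measurable (sig B)" and "A \<inter> B = {}"
  shows "indep_var borel (f :: 'a \<Rightarrow> real) borel (g :: 'a \<Rightarrow> real)"
proof -
  let ?r = "\<lambda>A \<omega>. \<lambda>i\<in>A. Z i \<omega>" and ?P = "\<lambda>A. PiM A (\<lambda>_. borel :: real measure)"
  let ?S = "\<lambda>A. {?r A -` C \<inter> space M | C. C \<in> sets (?P A)}"
  have "indep_var (?P A) (?r A) (?P B) (?r B)"
    using indep assms(3) by (intro indep_var_restrict) auto
  then have ind: "indep_set (sigma_sets (space M) (?S A)) (sigma_sets (space M) (?S B))"
    unfolding indep_var_eq by auto
  have S: "?S A = sets (sig A)" for A
    unfolding sig_def by (rule sets_vimage_algebra2[symmetric]) (auto simp: space_PiM)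
  have sub: "sigma_sets (space M) {k -` C \<inter> space M | C. C \<in> sets borel} \<subseteq> sigma_sets (space M) (?S D)"
    if "k \<in> borel_measurable (sig D)" for k :: "'a \<Rightarrow> real" and D
    unfolding S using measurable_sets[OF that] by (intro sigma_sets_mono') auto
  have "indep_set (sigma_sets (space M) {f -` C \<inter> space M | C. C \<in> sets borel})
      (sigma_sets (space M) {g -` C \<inter> space M | C. C \<in> sets borel})"
    unfolding indep_set_def
    by (rule indep_sets_mono_sets[OF ind[unfolded indep_set_def]])
       (use sub[OF f] sub[OF g] in \<open>auto split: bool.split_asm\<close>)
  then show ?thesis
    unfolding indep_var_eq using measurable_sig_M[OF f] measurable_sig_M[OF g] by simp
qed

text \<open>Causality is given only up to a null set, whereas independence from later noise needs
  genuine measurability with respect to \<open>sig {..t}\<close>. The Borel function of the past is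
  a version that has it.\<close>

lemma causal_version:
  assumes "causal_at M Z Y t"
  shows "\<exists>Y'. Y' \<in> borel_measurable (sig {..t}) \<and> (AE \<omega> in M. Y t \<omega> = Y' \<omega>)"
proof -
  obtain g where g: "g \<in> borel_measurable (PiM (UNIV :: nat set) (\<lambda>_. borel :: real measure))"
    and eq: "AE \<omega> in M. Y t \<omega> = g (\<lambda>k. Z (t - int k) \<omega>)"
    using assms by (auto simp: causal_at_def)
  have "(\<lambda>\<omega> k. Z (t - int k) \<omega>) \<in> measurable (sig {..t}) (PiM (UNIV :: nat set) (\<lambda>_. borel))"
    by (rule measurable_PiM_single') (auto intro!: Z_measurable_sig)
  then have "(\<lambda>\<omega>. g (\<lambda>k. Z (t - int k) \<omega>)) \<in> borel_measurable (sig {..t})"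
    using g by (rule measurable_compose)
  then show ?thesis using eq by blast
qed

end

section \<open>The ARCH recursion and its iterates\<close>

text \<open>\<open>\<kappa>\<close> bounds the L^2 norm of the squared innovations,
  \<open>\<rho>\<close> the intercept and \<open>A\<close> the sum of the lag coefficients, so that
  one step contracts L^2 by \<open>\<kappa> * A\<close>. An abstract \<open>\<kappa>\<close>
  separates the L^2 theory from the exponent \<zeta>.\<close>

locale arch_model = innovations M Z for M :: "'a measure" and Z :: "int \<Rightarrow> 'a \<Rightarrow> real" +
  fixes p :: nat and \<kappa> A \<rho> \<delta> :: real
  assumes p_pos: "1 \<le> p"
    and ident: "\<And>s t. distr M borel (Z s) = distr M borel (Z t)"
    and mean_W: "\<And>t. (\<integral>\<omega>. (Z t \<omega>)\<^sup>2 \<partial>M) = 1"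
    and sq_int_W: "\<And>t. sq_int (\<lambda>\<omega>. (Z t \<omega>)\<^sup>2)"
    and l2norm_W: "\<And>t. l2norm (\<lambda>\<omega>. (Z t \<omega>)\<^sup>2) \<le> \<kappa>"
    and A_nonneg: "0 \<le> A" and \<rho>_nonneg: "0 \<le> \<rho>"
    and contraction: "\<kappa> * A \<le> 1 - \<delta>" and \<delta>_pos: "0 < \<delta>" and \<delta>_less: "\<delta> < 1"
begin

abbreviation W :: "int \<Rightarrow> 'a \<Rightarrow> real" where "W t \<omega> \<equiv> (Z t \<omega>)\<^sup>2"

text \<open>The noise \<open>w\<close> is an argument because the same recursion is run with the
  true squared innovations and with truncated ones.\<close>

definition arch_step :: "(int \<Rightarrow> 'a \<Rightarrow> real) \<Rightarrow> (nat \<Rightarrow> int \<Rightarrow> real) \<Rightarrow> (int \<Rightarrow> 'a \<Rightarrow> real) \<Rightarrow> int \<Rightarrow> 'a \<Rightarrow> real" where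
  "arch_step w \<alpha> Y t \<omega> = w t \<omega> * (\<alpha> 0 t + (\<Sum>j=1..p. \<alpha> j t * Y (t - int j) \<omega>))"

text \<open>The start at zero makes the iterates monotone for nonnegative coefficients and lets the
  n-th one depend on finitely many innovations.\<close>

primrec iterate :: "(int \<Rightarrow> 'a \<Rightarrow> real) \<Rightarrow> (nat \<Rightarrow> int \<Rightarrow> real) \<Rightarrow> nat \<Rightarrow> int \<Rightarrow> 'a \<Rightarrow> real" where
  "iterate w \<alpha> 0 = (\<lambda>_ _. 0)"
| "iterate w \<alpha> (Suc n) = arch_step w \<alpha> (iterate w \<alpha> n)"

text \<open>The restriction to times up to \<open>T\<close> reflects that a row of the array has
  meaningful coefficients only up to its own length.\<close>

definition admissible :: "(nat \<Rightarrow> int \<Rightarrow> real) \<Rightarrow> int \<Rightarrow> bool" where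
  "admissible \<alpha> T \<longleftrightarrow> (\<forall>t\<le>T. (\<forall>j\<le>p. 0 \<le> \<alpha> j t) \<and> \<alpha> 0 t \<le> \<rho> \<and> (\<Sum>j=1..p. \<alpha> j t) \<le> A)"

text \<open>Adaptedness and nonnegativity are required everywhere, the equation almost everywhere.
  The last clause is uniform tightness: it follows from bounded second moments for the rows and from
  stationarity for the limit processes, and it suffices for uniqueness.\<close>

definition tight_solution :: "(nat \<Rightarrow> int \<Rightarrow> real) \<Rightarrow> int \<Rightarrow> (int \<Rightarrow> 'a \<Rightarrow> real) \<Rightarrow> bool" where
  "tight_solution \<alpha> T Y \<longleftrightarrow>
     (\<forall>t\<le>T. Y t \<in> borel_measurable (sig {..t}) \<and> (\<forall>\<omega>. 0 \<le> Y t \<omega>) \<and>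
        (AE \<omega> in M. Y t \<omega> = arch_step W \<alpha> Y t \<omega>)) \<and>
     (\<forall>\<eta>>0. \<exists>K. \<forall>t\<le>T. prob {\<omega> \<in> space M. Y t \<omega> > K} \<le> \<eta>)"

text \<open>The fixed point of x = \<kappa> \<rho> + (1 - \<delta>) x, hence invariant as an L^2
  bound under one step.\<close>

abbreviation l2bound :: real where "l2bound \<equiv> \<kappa> * \<rho> / \<delta>"

lemma \<kappa>_ge_1: "1 \<le> \<kappa>"
  using l1_le_l2norm[OF sq_int_W[of 0]] l2norm_W[of 0] mean_W[of 0] by simp

lemma \<kappa>_nonneg: "0 \<le> \<kappa>"
  using \<kappa>_ge_1 by simp

text \<open>The factor \<kappa> is at least the mean 1 of a squared innovation, so the lag
  coefficients alone already contract. This is the contraction in L^1, for use where only means are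
  at hand.\<close>

lemma A_le: "A \<le> 1 - \<delta>"
  using contraction mult_right_mono[OF \<kappa>_ge_1 A_nonneg] by linarith

lemma l2bound_nonneg: "0 \<le> l2bound"
  using \<kappa>_ge_1 \<rho>_nonneg \<delta>_pos by simp

lemma l2bound_step: "\<kappa> * (\<rho> + A * l2bound) \<le> l2bound"
proof -
  have "\<kappa> * (\<rho> + A * l2bound) = \<kappa> * \<rho> + (\<kappa> * A) * l2bound" by (simp add: algebra_simps)
  also have "\<dots> \<le> \<kappa> * \<rho> + (1 - \<delta>) * l2bound"
    using mult_right_mono[OF contraction l2bound_nonneg] by simp
  also have "\<dots> = l2bound" using \<delta>_pos by (simp add: field_simps)
  finally show ?thesis .
qed

lemma W_measurable_sig: "t \<in> S \<Longrightarrow> W t \<in> borel_measurable (sig S)"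
  using Z_measurable_sig[of t S] by simp

lemma admissibleD:
  assumes "admissible \<alpha> T" "t \<le> T"
  shows "j \<le> p \<Longrightarrow> 0 \<le> \<alpha> j t" "\<alpha> 0 t \<le> \<rho>" "(\<Sum>j=1..p. \<alpha> j t) \<le> A"
  using assms by (auto simp: admissible_def)

lemma tight_solutionD:
  assumes "tight_solution \<alpha> T Y" "t \<le> T"
  shows "Y t \<in> borel_measurable (sig {..t})" "0 \<le> Y t \<omega>"
    "AE \<omega> in M. Y t \<omega> = arch_step W \<alpha> Y t \<omega>"
  using assms by (auto simp: tight_solution_def)

section \<open>One step of the recursion in L^2\<close>

lemma arch_sum_measurable:
  fixes Y :: "int \<Rightarrow> 'b \<Rightarrow> real"
  assumes "\<And>j. j \<in> {1..p} \<Longrightarrow> Y (t - int j) \<in> borel_measurable N"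
  shows "(\<lambda>\<omega>. \<Sum>j=1..p. \<alpha> j t * Y (t - int j) \<omega>) \<in> borel_measurable N"
  by (intro borel_measurable_sum borel_measurable_times borel_measurable_const assms)

lemma arch_step_mono:
  assumes "\<And>j. j \<le> p \<Longrightarrow> 0 \<le> \<alpha> j t" "0 \<le> w t \<omega>"
    and "\<And>j. j \<in> {1..p} \<Longrightarrow> Y (t - int j) \<omega> \<le> Y' (t - int j) \<omega>"
  shows "arch_step w \<alpha> Y t \<omega> \<le> arch_step w \<alpha> Y' t \<omega>"
  unfolding arch_step_def using assms by (intro mult_left_mono add_left_mono sum_mono) auto

lemma linear_l2norm:
  assumes "\<And>j. j \<in> {1..p} \<Longrightarrow> sq_int (D j)" "\<And>j. j \<in> {1..p} \<Longrightarrow> l2norm (D j) \<le> C"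
  shows "sq_int (\<lambda>\<omega>. \<Sum>j=1..p. b j * D j \<omega>)"
    and "l2norm (\<lambda>\<omega>. \<Sum>j=1..p. b j * D j \<omega>) \<le> (\<Sum>j=1..p. \<bar>b j\<bar>) * C"
proof -
  show "sq_int (\<lambda>\<omega>. \<Sum>j=1..p. b j * D j \<omega>)" using assms by (intro sq_int_sum sq_int_cmult) auto
  have "l2norm (\<lambda>\<omega>. \<Sum>j=1..p. b j * D j \<omega>) \<le> (\<Sum>j=1..p. l2norm (\<lambda>\<omega>. b j * D j \<omega>))"
    using assms by (intro l2norm_sum sq_int_cmult) auto
  also have "\<dots> \<le> (\<Sum>j=1..p. \<bar>b j\<bar> * C)"
    using assms(2) by (intro sum_mono) (auto simp: l2norm_cmult intro!: mult_left_mono)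
  finally show "l2norm (\<lambda>\<omega>. \<Sum>j=1..p. b j * D j \<omega>) \<le> (\<Sum>j=1..p. \<bar>b j\<bar>) * C"
    by (simp add: sum_distrib_right)
qed

lemma arch_sum_l2norm:
  assumes "admissible \<alpha> T" "t \<le> T" "0 \<le> C"
    and "\<And>j. j \<in> {1..p} \<Longrightarrow> sq_int (D (t - int j))" "\<And>j. j \<in> {1..p} \<Longrightarrow> l2norm (D (t - int j)) \<le> C"
  shows "sq_int (\<lambda>\<omega>. \<Sum>j=1..p. \<alpha> j t * D (t - int j) \<omega>)"
    and "l2norm (\<lambda>\<omega>. \<Sum>j=1..p. \<alpha> j t * D (t - int j) \<omega>) \<le> A * C"
proof -
  have "(\<Sum>j=1..p. \<bar>\<alpha> j t\<bar>) = (\<Sum>j=1..p. \<alpha> j t)"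
    using admissibleD(1)[OF assms(1,2)] by (intro sum.cong) auto
  then have "(\<Sum>j=1..p. \<bar>\<alpha> j t\<bar>) * C \<le> A * C"
    using admissibleD(3)[OF assms(1,2)] assms(3) by (intro mult_right_mono) auto
  then show "sq_int (\<lambda>\<omega>. \<Sum>j=1..p. \<alpha> j t * D (t - int j) \<omega>)"
    and "l2norm (\<lambda>\<omega>. \<Sum>j=1..p. \<alpha> j t * D (t - int j) \<omega>) \<le> A * C"
    using linear_l2norm[of "\<lambda>j. D (t - int j)" C "\<lambda>j. \<alpha> j t"] assms(4,5) by auto
qed

text \<open>The noise at time \<open>t\<close> is independent of whatever is determined strictly
  before \<open>t\<close>, so the norms multiply. Combined with \<open>arch_sum_l2norm\<close> this
  gives the factor \<open>\<kappa> * A\<close> per step.\<close>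

lemma noise_mult_l2norm:
  assumes "w \<in> borel_measurable (sig {t})" "sq_int w" "l2norm w \<le> k"
    and "S \<in> borel_measurable (sig {..<t})" "sq_int S" "l2norm S \<le> C"
  shows "sq_int (\<lambda>\<omega>. w \<omega> * S \<omega>)" and "l2norm (\<lambda>\<omega>. w \<omega> * S \<omega>) \<le> k * C"
proof -
  have ind: "indep_var borel w borel S" by (rule indep_sig[OF assms(1,4)]) auto
  show "sq_int (\<lambda>\<omega>. w \<omega> * S \<omega>)" by (rule l2norm_mult_indep[OF ind assms(2,5)])
  show "l2norm (\<lambda>\<omega>. w \<omega> * S \<omega>) \<le> k * C"
    unfolding l2norm_mult_indep(2)[OF ind assms(2,5)]
    using assms(3,6) order_trans[OF l2norm_nonneg assms(3)] by (intro mult_mono) auto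
qed

section \<open>Iterates started from zero\<close>

lemma iterate_measurable:
  assumes "\<And>t. w t \<in> borel_measurable (sig {t})"
  shows "iterate w \<alpha> n t \<in> borel_measurable (sig {t - int (p * n)..t})"
proof (induction n arbitrary: t)
  case (Suc n)
  let ?S = "sig {t - int (p * Suc n)..t}"
  have "w t \<in> borel_measurable ?S"
    by (rule measurable_sig_mono[OF assms]) (auto intro: order_trans[of _ 0])
  moreover have "iterate w \<alpha> n (t - int j) \<in> borel_measurable ?S" if "j \<in> {1..p}" for j
    by (rule measurable_sig_mono[OF Suc.IH]) (use that in auto)
  ultimately show ?case
    unfolding iterate.simps arch_step_def
    by (intro borel_measurable_times borel_measurable_add borel_measurable_const arch_sum_measurable) auto
qed simp

lemma iterate_measurable_past:
  assumes "\<And>t. w t \<in> borel_measurable (sig {t})"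
  shows "iterate w \<alpha> n t \<in> borel_measurable (sig {..t})"
  by (rule measurable_sig_mono[OF iterate_measurable[OF assms]]) auto

text \<open>\<open>B\<close> is chosen before the coefficients and \<open>T\<close>: it arises by
  iterating B -> K (\<rho> + A B) from zero. One bound thus serves all rows of the array.\<close>

lemma iterate_bounded:
  assumes "\<And>t \<omega>. 0 \<le> w t \<omega>" "\<And>t \<omega>. w t \<omega> \<le> K" "0 \<le> K"
  shows "\<exists>B\<ge>0. \<forall>\<alpha> T t \<omega>. admissible \<alpha> T \<longrightarrow> t \<le> T \<longrightarrow> 0 \<le> iterate w \<alpha> n t \<omega> \<and> iterate w \<alpha> n t \<omega> \<le> B"
proof (induction n)
  case 0 then show ?case by auto
next
  case (Suc n)
  then obtain B where B: "0 \<le> B"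
    "\<And>\<alpha> T t \<omega>. admissible \<alpha> T \<Longrightarrow> t \<le> T \<Longrightarrow> 0 \<le> iterate w \<alpha> n t \<omega> \<and> iterate w \<alpha> n t \<omega> \<le> B" by blast
  have "0 \<le> iterate w \<alpha> (Suc n) t \<omega> \<and> iterate w \<alpha> (Suc n) t \<omega> \<le> K * (\<rho> + A * B)"
    if a: "admissible \<alpha> T" "t \<le> T" for \<alpha> T t \<omega>
  proof -
    let ?s = "\<Sum>j=1..p. \<alpha> j t * iterate w \<alpha> n (t - int j) \<omega>"
    have 0: "0 \<le> ?s" using admissibleD(1)[OF a] B(2)[OF a(1)] a(2)
      by (intro sum_nonneg mult_nonneg_nonneg) auto
    have "?s \<le> (\<Sum>j=1..p. \<alpha> j t * B)"
      using admissibleD(1)[OF a] B(2)[OF a(1)] a(2) by (intro sum_mono mult_left_mono) auto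
    also have "\<dots> \<le> A * B"
      using admissibleD(3)[OF a] B(1) by (simp add: sum_distrib_right[symmetric] mult_right_mono)
    finally have "w t \<omega> * (\<alpha> 0 t + ?s) \<le> K * (\<rho> + A * B)"
      using assms admissibleD(1,2)[OF a] 0 by (intro mult_mono add_mono add_nonneg_nonneg) auto
    moreover have "0 \<le> w t \<omega> * (\<alpha> 0 t + ?s)"
      using assms(1) admissibleD(1)[OF a, of 0] 0 by simp
    ultimately show ?thesis by (simp add: arch_step_def)
  qed
  moreover have "0 \<le> K * (\<rho> + A * B)" using assms(3) \<rho>_nonneg A_nonneg B(1) by simp
  ultimately show ?case by blast
qed

lemma iterate_W_nonneg_mono:
  assumes "admissible \<alpha> T" "t \<le> T"
  shows "0 \<le> iterate W \<alpha> n t \<omega> \<and> iterate W \<alpha> n t \<omega> \<le> iterate W \<alpha> (Suc n) t \<omega>"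
  using assms(2)
proof (induction n arbitrary: t)
  case 0
  then show ?case using admissibleD(1)[OF assms(1), of t 0] by (simp add: arch_step_def)
next
  case (Suc n)
  have a: "0 \<le> \<alpha> j t" if "j \<le> p" for j using admissibleD(1)[OF assms(1) Suc.prems that] .
  have IH: "0 \<le> iterate W \<alpha> n (t - int j) \<omega>" "iterate W \<alpha> n (t - int j) \<omega> \<le> iterate W \<alpha> (Suc n) (t - int j) \<omega>" for j
    using Suc.IH[of "t - int j"] Suc.prems by auto
  have "0 \<le> iterate W \<alpha> (Suc n) t \<omega>"
    using a IH by (auto simp: arch_step_def intro!: mult_nonneg_nonneg add_nonneg_nonneg sum_nonneg)
  moreover have "iterate W \<alpha> (Suc n) t \<omega> \<le> iterate W \<alpha> (Suc (Suc n)) t \<omega>"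
    unfolding iterate.simps(2)[of _ _ n] iterate.simps(2)[of _ _ "Suc n"]
    by (intro arch_step_mono a) (simp_all only: IH zero_le_power2 iterate.simps(2)[symmetric])
  ultimately show ?case by blast
qed

text \<open>The bound does not grow with \<open>n\<close>: the sum over the lags belongs to the
  strict past, so multiplication by the noise costs a factor \<open>\<kappa>\<close>, and
  \<open>l2bound\<close> is invariant under the resulting map.\<close>

lemma iterate_W_l2:
  assumes "admissible \<alpha> T" "t \<le> T"
  shows "sq_int (iterate W \<alpha> n t) \<and> l2norm (iterate W \<alpha> n t) \<le> l2bound"
  using assms(2)
proof (induction n arbitrary: t)
  case 0 then show ?case using l2bound_nonneg by simp
next
  case (Suc n)
  let ?S = "\<lambda>\<omega>. \<alpha> 0 t + (\<Sum>j=1..p. \<alpha> j t * iterate W \<alpha> n (t - int j) \<omega>)"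
  have IH: "sq_int (iterate W \<alpha> n (t - int j))" "l2norm (iterate W \<alpha> n (t - int j)) \<le> l2bound" for j
    using Suc.IH[of "t - int j"] Suc.prems by auto
  note sum = arch_sum_l2norm[where D = "iterate W \<alpha> n", OF assms(1) Suc.prems l2bound_nonneg IH]
  have "sq_int ?S" by (intro sq_int_add sq_int_const sum)
  moreover have "l2norm ?S \<le> \<rho> + A * l2bound"
    using l2norm_add[OF sq_int_const[of "\<alpha> 0 t"] sum(1)] sum(2) admissibleD(2)[OF assms(1) Suc.prems]
      admissibleD(1)[OF assms(1) Suc.prems, of 0]
    by auto
  moreover have "?S \<in> borel_measurable (sig {..<t})"
    by (intro borel_measurable_add borel_measurable_const arch_sum_measurable
        measurable_sig_mono[OF iterate_measurable_past] W_measurable_sig) auto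
  ultimately have "sq_int (\<lambda>\<omega>. W t \<omega> * ?S \<omega>)" "l2norm (\<lambda>\<omega>. W t \<omega> * ?S \<omega>) \<le> \<kappa> * (\<rho> + A * l2bound)"
    using noise_mult_l2norm[of "W t" t \<kappa> ?S "\<rho> + A * l2bound"] W_measurable_sig sq_int_W l2norm_W by auto
  then show ?case
    using l2bound_step by (auto simp: arch_step_def[abs_def])
qed

text \<open>Zero lies below every nonnegative solution and the step is monotone. The limit of the
  iterates is therefore the least candidate, and its gap to any solution is nonnegative and
  dominated by that solution.\<close>

lemma iterate_W_le_solution:
  assumes "admissible \<alpha> T" "tight_solution \<alpha> T Y" "t \<le> T"
  shows "AE \<omega> in M. iterate W \<alpha> n t \<omega> \<le> Y t \<omega>"
  using assms(3)
proof (induction n arbitrary: t)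
  case 0
  then show ?case using tight_solutionD(2)[OF assms(2)] by simp
next
  case (Suc n)
  have "AE \<omega> in M. \<forall>j\<in>{1..p}. iterate W \<alpha> n (t - int j) \<omega> \<le> Y (t - int j) \<omega>"
    using Suc.IH Suc.prems by (intro AE_finite_allI) auto
  with tight_solutionD(3)[OF assms(2) Suc.prems] show ?case
  proof eventually_elim
    case (elim \<omega>)
    have "arch_step W \<alpha> (iterate W \<alpha> n) t \<omega> \<le> arch_step W \<alpha> Y t \<omega>"
      using elim(2) admissibleD(1)[OF assms(1) Suc.prems] by (intro arch_step_mono) auto
    then show ?case using elim(1) by simp
  qed
qed

text \<open>Truncating \<open>D\<close> to the event that the dominating process is at most \<open>K\<close> on a window of \<open>p\<close> consecutive times gives integrable
  variables whose means decay geometrically after the window. Only tightness is available, since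
  stationary solutions come without a moment bound.\<close>

lemma homogeneous_solution_zero:
  assumes adm: "admissible \<alpha> T"
    and D: "\<And>t. t \<le> T \<Longrightarrow> D t \<in> borel_measurable (sig {..t})"
    and Y: "\<And>t. t \<le> T \<Longrightarrow> Y t \<in> borel_measurable (sig {..t})"
    and bnd: "\<And>t. t \<le> T \<Longrightarrow> AE \<omega> in M. 0 \<le> D t \<omega> \<and> D t \<omega> \<le> Y t \<omega>"
    and eq: "\<And>t. t \<le> T \<Longrightarrow> AE \<omega> in M. D t \<omega> = W t \<omega> * (\<Sum>j=1..p. \<alpha> j t * D (t - int j) \<omega>)"
    and tight: "\<And>\<eta>. 0 < \<eta> \<Longrightarrow> \<exists>K. \<forall>t\<le>T. prob {\<omega> \<in> space M. Y t \<omega> > K} \<le> \<eta>"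
    and t: "t \<le> T"
  shows "AE \<omega> in M. D t \<omega> = 0"
proof -
  have DM: "D s \<in> borel_measurable M" and YM: "Y s \<in> borel_measurable M" if "s \<le> T" for s
    using measurable_sig_M D[OF that] Y[OF that] by auto
  \<comment> \<open>One \<eta> is spent on Markov's inequality for the truncated variable, and one
    on each of the \<open>p\<close> window times at which the dominating process may exceed its
    level.\<close>
  have main: "prob {\<omega> \<in> space M. D t \<omega> > \<epsilon>} \<le> (1 + real p) * \<eta>" if \<epsilon>: "0 < \<epsilon>" and \<eta>: "0 < \<eta>" for \<epsilon> \<eta>
  proof -
    obtain K0 where K0: "\<And>s. s \<le> T \<Longrightarrow> prob {\<omega> \<in> space M. Y s \<omega> > K0} \<le> \<eta>"
      using tight[OF \<eta>] by blast
    define K where "K = max K0 1"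
    have K: "0 < K" by (simp add: K_def)
    have YK: "prob {\<omega> \<in> space M. Y s \<omega> > K} \<le> \<eta>" if "s \<le> T" for s
    proof -
      have "prob {\<omega> \<in> space M. Y s \<omega> > K} \<le> prob {\<omega> \<in> space M. Y s \<omega> > K0}"
        using YM[OF that] by (intro finite_measure_mono) (auto simp: K_def)
      then show ?thesis using K0[OF that] by simp
    qed
    have "(\<lambda>k. K * (1 - \<delta>) ^ k / \<epsilon>) \<longlonglongrightarrow> K * 0 / \<epsilon>"
      using \<delta>_pos \<delta>_less \<epsilon> by (intro tendsto_intros LIMSEQ_power_zero) auto
    then have "\<forall>\<^sub>F k in sequentially. K * (1 - \<delta>) ^ k / \<epsilon> < \<eta> \<and> 1 \<le> k"
      using \<eta> by (intro eventually_conj eventually_ge_at_top) (auto dest: order_tendstoD)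
    then obtain k where k: "K * (1 - \<delta>) ^ k / \<epsilon> < \<eta>" "1 \<le> k"
      using eventually_happens'[OF sequentially_bot] by blast
    \<comment> \<open>The window starts \<open>k\<close> blocks of length \<open>p\<close> before
      \<open>t\<close>, and each block yields a factor 1 - \<delta>. Since \<open>k\<close> is at
      least 1, the window ends strictly before \<open>t\<close>.\<close>
    define b where "b = t - int (p * k)"
    have pk: "int p \<le> int (p * k)" using mult_le_mono2[OF k(2), of p] by (simp only: of_nat_le_iff mult_1_right)
    define G where "G = {\<omega> \<in> space M. \<forall>s\<in>{b..b + int p - 1}. Y s \<omega> \<le> K}"
    define I where "I = (indicator G :: 'a \<Rightarrow> real)"
    have win: "s \<le> T" if "s \<in> {b..b + int p - 1}" for s using that t pk unfolding b_def atLeastAtMost_iff by linarith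
    have GY: "{\<omega> \<in> space (sig {..b + int p - 1}). Y s \<omega> \<le> K} \<in> sets (sig {..b + int p - 1})"
      if "s \<in> {b..b + int p - 1}" for s
      by (rule borel_measurable_le[OF measurable_sig_mono[OF Y[OF win[OF that]]]]) (use that in auto)
    have b: "b \<in> {b..b + int p - 1}" using p_pos by auto
    have Geq: "G = (\<Inter>s\<in>{b..b + int p - 1}. {\<omega> \<in> space (sig {..b + int p - 1}). Y s \<omega> \<le> K})"
      (is "_ = ?I")
    proof (intro set_eqI iffI)
      fix \<omega> assume "\<omega> \<in> ?I"
      then have "\<And>s. s \<in> {b..b + int p - 1} \<Longrightarrow> \<omega> \<in> space M \<and> Y s \<omega> \<le> K" by simp
      with b show "\<omega> \<in> G" unfolding G_def by blast
    qed (simp add: G_def)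
    \<comment> \<open>The truncation event is decided by the end of the window. Its indicator can
      thus be carried through all later steps without affecting the independence of their
      noise.\<close>
    have G: "G \<in> sets (sig {..b + int p - 1})"
      unfolding Geq using b by (intro sets.finite_INT GY) auto
    then have I: "I \<in> borel_measurable (sig {..b + int p - 1})" by (simp add: I_def)
    have I01: "0 \<le> I \<omega>" "I \<omega> \<le> 1" for \<omega> by (auto simp: I_def indicator_def)
    have IM: "I \<in> borel_measurable M" using I by (rule measurable_sig_M)
    \<comment> \<open>Strong induction on the distance from the start of the window. Inside the
      window the truncation gives the bound \<open>K\<close>; afterwards a step reaches back at most
      \<open>p\<close> times, so the exponent grows by one per full block.\<close>
    have decay: "integrable M (\<lambda>\<omega>. D (b + int i) \<omega> * I \<omega>) \<and>
        (\<integral>\<omega>. D (b + int i) \<omega> * I \<omega> \<partial>M) \<le> K * (1 - \<delta>) ^ (i div p)" if "b + int i \<le> T" for i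
      using that
    proof (induction i rule: less_induct)
      case (less i)
      let ?s = "b + int i"
      note [measurable] = DM[OF less.prems] IM
      show ?case
      proof (cases "i < p")
        case True
        have le: "AE \<omega> in M. 0 \<le> D ?s \<omega> * I \<omega> \<and> D ?s \<omega> * I \<omega> \<le> K"
          using bnd[OF less.prems]
        proof eventually_elim
          case (elim \<omega>)
          have "?s \<in> {b..b + int p - 1}" using True by auto
          then have "Y ?s \<omega> \<le> K" if "\<omega> \<in> G" using that by (auto simp: G_def)
          then show ?case using elim K by (auto simp: I_def indicator_def)
        qed
        then have int: "integrable M (\<lambda>\<omega>. D ?s \<omega> * I \<omega>)"
          by (intro integrable_const_bound[where B = K]) (auto elim: eventually_mono)
        have "(\<integral>\<omega>. D ?s \<omega> * I \<omega> \<partial>M) \<le> (\<integral>\<omega>. K \<partial>M)"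
          using le int by (intro integral_mono_AE) (auto elim: eventually_mono)
        then show ?thesis using int True by (simp add: prob_space)
      next
        case False
        define S where "S \<omega> = (\<Sum>j=1..p. \<alpha> j ?s * (D (?s - int j) \<omega> * I \<omega>))" for \<omega>
        have lag: "integrable M (\<lambda>\<omega>. D (?s - int j) \<omega> * I \<omega>)"
            "(\<integral>\<omega>. D (?s - int j) \<omega> * I \<omega> \<partial>M) \<le> K * (1 - \<delta>) ^ (i div p - 1)" if j: "j \<in> {1..p}" for j
        proof -
          have s: "?s - int j = b + int (i - j)" using j False by auto
          have "i - j < i" "b + int (i - j) \<le> T" using j False less.prems by auto
          note IH = less.IH[OF this]
          show "integrable M (\<lambda>\<omega>. D (?s - int j) \<omega> * I \<omega>)" unfolding s by (rule IH[THEN conjunct1])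
          \<comment> \<open>The longest lag is the worst case: each lag leads to a distance of at
            least \<open>i - p\<close>, one block earlier.\<close>
          have "i div p - 1 = (i - p) div p" using False p_pos by (simp add: le_div_geq)
          also have "\<dots> \<le> (i - j) div p" using j by (intro div_le_mono) auto
          finally have "(1 - \<delta>) ^ ((i - j) div p) \<le> (1 - \<delta>) ^ (i div p - 1)"
            using \<delta>_pos \<delta>_less by (intro power_decreasing) auto
          then show "(\<integral>\<omega>. D (?s - int j) \<omega> * I \<omega> \<partial>M) \<le> K * (1 - \<delta>) ^ (i div p - 1)"
            unfolding s using K by (intro order_trans[OF IH[THEN conjunct2]] mult_left_mono) auto
        qed
        have Sint: "integrable M S"
          unfolding S_def using lag by (intro Bochner_Integration.integrable_sum integrable_mult_right) auto
        have "(\<integral>\<omega>. S \<omega> \<partial>M) = (\<Sum>j=1..p. \<alpha> j ?s * (\<integral>\<omega>. D (?s - int j) \<omega> * I \<omega> \<partial>M))"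
          unfolding S_def using lag by (subst Bochner_Integration.integral_sum) auto
        also have "\<dots> \<le> (\<Sum>j=1..p. \<alpha> j ?s * (K * (1 - \<delta>) ^ (i div p - 1)))"
          using lag(2) admissibleD(1)[OF adm less.prems] by (intro sum_mono mult_left_mono) auto
        also have "\<dots> \<le> (1 - \<delta>) * (K * (1 - \<delta>) ^ (i div p - 1))"
          unfolding sum_distrib_right[symmetric] using admissibleD(3)[OF adm less.prems] A_le K \<delta>_less
          by (intro mult_right_mono) auto
        also have "\<dots> = K * (1 - \<delta>) ^ (i div p)"
        proof -
          have "i div p = Suc (i div p - 1)" using False p_pos by (simp add: div_greater_zero_iff)
          then have "(1 - \<delta>) ^ (i div p) = (1 - \<delta>) * (1 - \<delta>) ^ (i div p - 1)" by (metis power_Suc)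
          then show ?thesis by simp
        qed
        finally have ES: "(\<integral>\<omega>. S \<omega> \<partial>M) \<le> K * (1 - \<delta>) ^ (i div p)" .
        have Sm: "S \<in> borel_measurable (sig {..<?s})"
          unfolding S_def
        proof (intro borel_measurable_sum borel_measurable_times borel_measurable_const)
          show "D (?s - int j) \<in> borel_measurable (sig {..<?s})" if "j \<in> {1..p}" for j
            by (rule measurable_sig_mono[OF D]) (use less.prems that in auto)
          show "I \<in> borel_measurable (sig {..<?s})"
            by (rule measurable_sig_mono[OF I]) (use False in auto)
        qed
        have ind: "indep_var borel (W ?s) borel S"
          by (rule indep_sig[OF W_measurable_sig Sm, of ?s "{?s}"]) auto
        have Wint: "integrable M (W ?s)" by (rule sq_int_integrable[OF sq_int_W])
        have ae: "AE \<omega> in M. D ?s \<omega> * I \<omega> = W ?s \<omega> * S \<omega>"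
          using eq[OF less.prems]
          by eventually_elim (simp add: S_def sum_distrib_right mult.assoc)
        have [measurable]: "S \<in> borel_measurable M" using Sm by (rule measurable_sig_M)
        have "integrable M (\<lambda>\<omega>. D ?s \<omega> * I \<omega>)"
          using indep_var_integrable[OF ind Wint Sint] ae by (subst integrable_cong_AE[where g = "\<lambda>\<omega>. W ?s \<omega> * S \<omega>"]) auto
        \<comment> \<open>Independence and the unit mean of the squared innovation remove the noise
          from the expectation, so only the sum of the coefficients remains and no second moment is
          involved.\<close>
        moreover have "(\<integral>\<omega>. D ?s \<omega> * I \<omega> \<partial>M) = (\<integral>\<omega>. S \<omega> \<partial>M)"
          using indep_var_lebesgue_integral[OF ind Wint Sint] ae mean_W
          by (subst integral_cong_AE[where g = "\<lambda>\<omega>. W ?s \<omega> * S \<omega>"]) auto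
        ultimately show ?thesis using ES by simp
      qed
    qed
    note [measurable] = DM[OF t] IM YM
    have tb: "t = b + int (p * k)" by (simp add: b_def)
    have int: "integrable M (\<lambda>\<omega>. D t \<omega> * I \<omega>)"
      and le: "(\<integral>\<omega>. D t \<omega> * I \<omega> \<partial>M) \<le> K * (1 - \<delta>) ^ k"
      using decay[of "p * k"] t p_pos unfolding tb[symmetric] by auto
    have "AE \<omega> in M. 0 \<le> D t \<omega> * I \<omega>"
      using bnd[OF t] by eventually_elim (use I01 in auto)
    then have "prob {\<omega> \<in> space M. D t \<omega> * I \<omega> \<ge> \<epsilon>} \<le> (\<integral>\<omega>. D t \<omega> * I \<omega> \<partial>M) / \<epsilon>"
      using integral_Markov_inequality_measure[OF int _ _ \<epsilon>, of "{}"] by simp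
    also have "\<dots> \<le> K * (1 - \<delta>) ^ k / \<epsilon>" using le \<epsilon> by (intro divide_right_mono) auto
    also have "\<dots> \<le> \<eta>" using k(1) by simp
    finally have p1: "prob {\<omega> \<in> space M. D t \<omega> * I \<omega> \<ge> \<epsilon>} \<le> \<eta>" .
    let ?U = "\<Union>s\<in>{b..b + int p - 1}. {\<omega> \<in> space M. Y s \<omega> > K}"
    have Us: "{\<omega> \<in> space M. Y s \<omega> > K} \<in> events" if "s \<in> {b..b + int p - 1}" for s
      using YM[OF win[OF that]] by simp
    have "prob ?U \<le> (\<Sum>s\<in>{b..b + int p - 1}. prob {\<omega> \<in> space M. Y s \<omega> > K})"
      using Us by (intro finite_measure_subadditive_finite) auto
    also have "\<dots> \<le> (\<Sum>s\<in>{b..b + int p - 1}. \<eta>)" using win YK by (intro sum_mono) auto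
    also have "\<dots> = real p * \<eta>" by simp
    finally have p2: "prob ?U \<le> real p * \<eta>" .
    have UM: "?U \<in> events" using Us by (intro sets.finite_UN) auto
    have EM: "{\<omega> \<in> space M. D t \<omega> * I \<omega> \<ge> \<epsilon>} \<in> events" by measurable
    have "{\<omega> \<in> space M. D t \<omega> > \<epsilon>} \<subseteq> {\<omega> \<in> space M. D t \<omega> * I \<omega> \<ge> \<epsilon>} \<union> ?U"
    proof
      fix \<omega> assume \<omega>: "\<omega> \<in> {\<omega> \<in> space M. D t \<omega> > \<epsilon>}"
      show "\<omega> \<in> {\<omega> \<in> space M. D t \<omega> * I \<omega> \<ge> \<epsilon>} \<union> ?U"
      proof (cases "\<omega> \<in> G")
        case True then show ?thesis using \<omega> by (simp add: I_def)
      next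
        case False
        then have "\<exists>s\<in>{b..b + int p - 1}. Y s \<omega> > K" using \<omega> unfolding G_def by (simp add: not_le)
        then show ?thesis using \<omega> by simp
      qed
    qed
    then have "prob {\<omega> \<in> space M. D t \<omega> > \<epsilon>} \<le> prob ({\<omega> \<in> space M. D t \<omega> * I \<omega> \<ge> \<epsilon>} \<union> ?U)"
      by (intro finite_measure_mono sets.Un UM EM)
    also have "\<dots> \<le> prob {\<omega> \<in> space M. D t \<omega> * I \<omega> \<ge> \<epsilon>} + prob ?U"
      by (intro measure_Un_le UM EM)
    finally show ?thesis using p1 p2 by (simp add: algebra_simps)
  qed
  have zero: "prob {\<omega> \<in> space M. D t \<omega> > \<epsilon>} = 0" if "0 < \<epsilon>" for \<epsilon>
  proof (rule ccontr)
    let ?P = "prob {\<omega> \<in> space M. D t \<omega> > \<epsilon>}"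
    assume "?P \<noteq> 0"
    then have pos: "0 < ?P" by (simp add: measure_nonneg order_less_le)
    \<comment> \<open>Choosing \<eta> as this multiple of the probability itself turns the bound
      into P \<le> P/2.\<close>
    have "?P \<le> (1 + real p) * (?P / (2 * (1 + real p)))"
      using pos by (intro main that) auto
    also have "\<dots> = ?P / 2" by (simp add: field_simps)
    finally show False using pos by simp
  qed
  have "AE \<omega> in M. \<not> D t \<omega> > \<epsilon>" if "0 < \<epsilon>" for \<epsilon>
    using zero[OF that] DM[OF t] by (subst AE_iff_measurable[OF _ refl]) (auto simp: emeasure_eq_measure)
  then have "AE \<omega> in M. \<forall>n. \<not> D t \<omega> > inverse (real (Suc n))"
    by (subst AE_all_countable) simp
  with bnd[OF t] show ?thesis
  proof eventually_elim
    case (elim \<omega>)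
    then show ?case using reals_Archimedean[of "D t \<omega>"] by (metis order_less_le order_less_le_trans)
  qed
qed

text \<open>The iterates increase and stay below \<open>Y\<close>, so they converge, and their limit
  \<open>L\<close> solves the same equation by continuity of the step. The difference
  \<open>Y - L\<close> then solves the homogeneous recursion, lies between 0 and the tight process
  \<open>Y\<close>, and vanishes.\<close>

lemma iterate_tendsto_solution:
  assumes adm: "admissible \<alpha> T" and sol: "tight_solution \<alpha> T Y" and t: "t \<le> T"
  shows "AE \<omega> in M. (\<lambda>n. iterate W \<alpha> n t \<omega>) \<longlonglongrightarrow> Y t \<omega>"
proof -
  \<comment> \<open>\<open>lim\<close> is total: it has some value also where the iterates diverge.
    Hence \<open>L\<close> is measurable everywhere, while convergence to it is claimed almost
    everywhere only.\<close>
  define L where "L s \<omega> = lim (\<lambda>n. iterate W \<alpha> n s \<omega>)" for s \<omega>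
  define D where "D s \<omega> = Y s \<omega> - L s \<omega>" for s \<omega>
  have "AE \<omega> in M. \<forall>s n. s \<le> T \<longrightarrow> iterate W \<alpha> n s \<omega> \<le> Y s \<omega>"
    using iterate_W_le_solution[OF adm sol] by (simp add: AE_all_countable AE_impI)
  then have conv: "AE \<omega> in M. \<forall>s\<le>T. (\<lambda>n. iterate W \<alpha> n s \<omega>) \<longlonglongrightarrow> L s \<omega>"
    and LY: "AE \<omega> in M. \<forall>s\<le>T. 0 \<le> L s \<omega> \<and> L s \<omega> \<le> Y s \<omega>"
  proof -
    assume *: "AE \<omega> in M. \<forall>s n. s \<le> T \<longrightarrow> iterate W \<alpha> n s \<omega> \<le> Y s \<omega>"
    have **: "(\<lambda>n. iterate W \<alpha> n s \<omega>) \<longlonglongrightarrow> L s \<omega> \<and> 0 \<le> L s \<omega> \<and> L s \<omega> \<le> Y s \<omega>"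
      if sT: "s \<le> T" and le: "\<forall>n. iterate W \<alpha> n s \<omega> \<le> Y s \<omega>" for s \<omega>
    proof -
      have mono: "incseq (\<lambda>n. iterate W \<alpha> n s \<omega>)"
        using iterate_W_nonneg_mono[OF adm sT] by (intro incseq_SucI) blast
      then obtain l where "(\<lambda>n. iterate W \<alpha> n s \<omega>) \<longlonglongrightarrow> l"
        using incseq_convergent[of "\<lambda>n. iterate W \<alpha> n s \<omega>" "Y s \<omega>"] le by blast
      then have l: "(\<lambda>n. iterate W \<alpha> n s \<omega>) \<longlonglongrightarrow> L s \<omega>"
        unfolding L_def by (metis limI)
      then show ?thesis
        using LIMSEQ_le_const[OF l, of 0] LIMSEQ_le_const2[OF l, of "Y s \<omega>"] le
          iterate_W_nonneg_mono[OF adm sT] by blast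
    qed
    show "AE \<omega> in M. \<forall>s\<le>T. (\<lambda>n. iterate W \<alpha> n s \<omega>) \<longlonglongrightarrow> L s \<omega>"
      and "AE \<omega> in M. \<forall>s\<le>T. 0 \<le> L s \<omega> \<and> L s \<omega> \<le> Y s \<omega>"
      using * by (eventually_elim, use ** in blast)+
  qed
  have Lm: "L s \<in> borel_measurable (sig {..s})" for s
    unfolding L_def
    by (intro borel_measurable_lim_metric iterate_measurable_past W_measurable_sig) auto
  have "AE \<omega> in M. D t \<omega> = 0"
  proof (rule homogeneous_solution_zero[OF adm, where Y = Y])
    fix s assume s: "s \<le> T"
    show Ym: "Y s \<in> borel_measurable (sig {..s})" by (rule tight_solutionD[OF sol s])
    show "D s \<in> borel_measurable (sig {..s})"
      unfolding D_def using Ym Lm by (intro borel_measurable_diff)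
    show "AE \<omega> in M. 0 \<le> D s \<omega> \<and> D s \<omega> \<le> Y s \<omega>"
      using LY by eventually_elim (use s in \<open>auto simp: D_def\<close>)
    show "AE \<omega> in M. D s \<omega> = W s \<omega> * (\<Sum>j=1..p. \<alpha> j s * D (s - int j) \<omega>)"
      using conv tight_solutionD(3)[OF sol s]
    proof eventually_elim
      case (elim \<omega>)
      have lag: "(\<lambda>n. iterate W \<alpha> n (s - int j) \<omega>) \<longlonglongrightarrow> L (s - int j) \<omega>" for j
        using elim(1) s by auto
      have "(\<lambda>n. arch_step W \<alpha> (iterate W \<alpha> n) s \<omega>) \<longlonglongrightarrow> arch_step W \<alpha> L s \<omega>"
        unfolding arch_step_def by (intro tendsto_intros lag)
      moreover have "(\<lambda>n. iterate W \<alpha> (Suc n) s \<omega>) \<longlonglongrightarrow> L s \<omega>"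
        using elim(1) s by (intro LIMSEQ_Suc) blast
      ultimately have "L s \<omega> = arch_step W \<alpha> L s \<omega>"
        by (simp add: LIMSEQ_unique)
      then have "D s \<omega> = arch_step W \<alpha> Y s \<omega> - arch_step W \<alpha> L s \<omega>"
        using elim(2) by (simp add: D_def)
      also have "\<dots> = W s \<omega> * ((\<Sum>j=1..p. \<alpha> j s * Y (s - int j) \<omega>) - (\<Sum>j=1..p. \<alpha> j s * L (s - int j) \<omega>))"
        by (simp add: arch_step_def algebra_simps)
      finally show ?case by (simp add: D_def sum_subtractf right_diff_distrib)
    qed
  next
    show "\<exists>K. \<forall>t\<le>T. prob {\<omega> \<in> space M. Y t \<omega> > K} \<le> \<eta>" if "0 < \<eta>" for \<eta>
      using sol that by (auto simp: tight_solution_def)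
  qed (rule t)
  with conv show ?thesis by eventually_elim (use t in \<open>auto simp: D_def\<close>)
qed

text \<open>Square integrability is a conclusion here, drawn from mere tightness: the solution is
  the limit of the iterates, which carry the bound.\<close>

lemma solution_l2:
  assumes "admissible \<alpha> T" "tight_solution \<alpha> T Y" "t \<le> T"
  shows "sq_int (Y t)" and "l2norm (Y t) \<le> l2bound"
  using l2norm_limit_bound[OF _ _ measurable_sig_M[OF tight_solutionD(1)[OF assms(2,3)]]
      iterate_tendsto_solution[OF assms]] iterate_W_l2[OF assms(1,3)] by blast+

section \<open>Approximation and comparison of solutions\<close>

definition truncated_W :: "real \<Rightarrow> int \<Rightarrow> 'a \<Rightarrow> real" where
  "truncated_W K t \<omega> = min (W t \<omega>) K"

lemma truncated_W_measurable: "truncated_W K t \<in> borel_measurable (sig {t})"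
  unfolding truncated_W_def[abs_def] by (intro borel_measurable_min W_measurable_sig) auto

lemma truncated_W_l2:
  assumes "0 \<le> K"
  shows "sq_int (truncated_W K t)" and "l2norm (truncated_W K t) \<le> \<kappa>"
proof -
  have m: "truncated_W K t \<in> borel_measurable M" by (rule measurable_sig_M[OF truncated_W_measurable])
  have "AE \<omega> in M. \<bar>truncated_W K t \<omega>\<bar> \<le> \<bar>W t \<omega>\<bar>" using assms by (simp add: truncated_W_def)
  note * = sq_int_AE_bound[OF sq_int_W m this]
  show "sq_int (truncated_W K t)" by (rule *)
  show "l2norm (truncated_W K t) \<le> \<kappa>" using * l2norm_W[of t] by linarith
qed

text \<open>Dominated convergence at time 0, with the square of \<open>W 0\<close> as dominating
  function. The error depends only on the law of the innovation, so the level found at time 0 serves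
  all times.\<close>

lemma truncation_error:
  assumes "0 < e"
  shows "\<exists>K\<ge>0. \<forall>t. l2norm (\<lambda>\<omega>. W t \<omega> - truncated_W K t \<omega>) \<le> e"
proof -
  have "(\<lambda>n. \<integral>\<omega>. (W 0 \<omega> - truncated_W (real n) 0 \<omega>)\<^sup>2 \<partial>M) \<longlonglongrightarrow> (\<integral>\<omega>. 0 \<partial>M)"
  proof (rule integral_dominated_convergence)
    show "integrable M (\<lambda>\<omega>. (W 0 \<omega>)\<^sup>2)" using sq_int_W[of 0] by (simp add: sq_int_def)
    show "(\<lambda>\<omega>. (W 0 \<omega> - truncated_W (real n) 0 \<omega>)\<^sup>2) \<in> borel_measurable M" for n
      by (simp add: truncated_W_def)
    show "AE \<omega> in M. (\<lambda>n. (W 0 \<omega> - truncated_W (real n) 0 \<omega>)\<^sup>2) \<longlonglongrightarrow> 0"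
    proof (intro AE_I2 tendsto_eventually)
      fix \<omega>
      obtain N :: nat where "W 0 \<omega> \<le> real N" using real_arch_simple by blast
      then have "\<forall>n\<ge>N. (W 0 \<omega> - truncated_W (real n) 0 \<omega>)\<^sup>2 = 0" by (auto simp: truncated_W_def)
      then show "\<forall>\<^sub>F n in sequentially. (W 0 \<omega> - truncated_W (real n) 0 \<omega>)\<^sup>2 = 0"
        unfolding eventually_sequentially by blast
    qed
    show "AE \<omega> in M. norm ((W 0 \<omega> - truncated_W (real n) 0 \<omega>)\<^sup>2) \<le> (W 0 \<omega>)\<^sup>2" for n
      unfolding truncated_W_def real_norm_def abs_power2 by (intro AE_I2 power_mono) auto
  qed simp
  then have "\<forall>\<^sub>F n in sequentially. (\<integral>\<omega>. (W 0 \<omega> - truncated_W (real n) 0 \<omega>)\<^sup>2 \<partial>M) < e\<^sup>2"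
    using assms by (intro order_tendstoD) auto
  then obtain n where "(\<integral>\<omega>. (W 0 \<omega> - truncated_W (real n) 0 \<omega>)\<^sup>2 \<partial>M) < e\<^sup>2"
    using eventually_happens'[OF sequentially_bot] by blast
  then have "(l2norm (\<lambda>\<omega>. W 0 \<omega> - truncated_W (real n) 0 \<omega>))\<^sup>2 \<le> e\<^sup>2"
    unfolding l2norm_squared by (rule less_imp_le)
  then have 0: "l2norm (\<lambda>\<omega>. W 0 \<omega> - truncated_W (real n) 0 \<omega>) \<le> e"
    using assms by (rule power2_le_imp_le[OF _ less_imp_le])
  have eq: "(\<integral>\<omega>. (W t \<omega> - truncated_W K t \<omega>)\<^sup>2 \<partial>M) = (\<integral>x. (x\<^sup>2 - min (x\<^sup>2) K)\<^sup>2 \<partial>distr M borel (Z t))" for K t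
    unfolding truncated_W_def by (subst integral_distr) auto
  have "l2norm (\<lambda>\<omega>. W t \<omega> - truncated_W (real n) t \<omega>) \<le> e" for t
    using 0 ident[of t 0] by (simp add: l2norm_def eq)
  then show ?thesis by (intro exI[of _ "real n"]) auto
qed

text \<open>Splitting \<open>W S - w S' = (W - w) S + w (S - S')\<close> makes the second term a contraction.\<close>

lemma truncated_iterate_error:
  assumes adm: "admissible \<alpha> T" and sol: "tight_solution \<alpha> T Y" and "t \<le> T" and K: "0 \<le> K"
    and e: "\<And>t. l2norm (\<lambda>\<omega>. W t \<omega> - truncated_W K t \<omega>) \<le> e"
  shows "l2norm (\<lambda>\<omega>. Y t \<omega> - iterate (truncated_W K) \<alpha> n t \<omega>)
      \<le> e * (\<rho> + A * l2bound) / \<delta> + (1 - \<delta>) ^ n * l2bound"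
  using assms(3)
proof (induction n arbitrary: t)
  case 0
  have "0 \<le> e" using e[of 0] l2norm_nonneg order_trans by blast
  then have "0 \<le> e * (\<rho> + A * l2bound) / \<delta>"
    using \<rho>_nonneg A_nonneg \<kappa>_nonneg \<delta>_pos by (intro divide_nonneg_pos mult_nonneg_nonneg add_nonneg_nonneg) auto
  then show ?case using solution_l2[OF adm sol 0] by simp
next
  case (Suc n)
  let ?w = "truncated_W K" and ?y = "iterate (truncated_W K) \<alpha> n"
  let ?B = "e * (\<rho> + A * l2bound) / \<delta> + (1 - \<delta>) ^ n * l2bound"
  have e0: "0 \<le> e" using e[of 0] l2norm_nonneg order_trans by blast
  have B0: "0 \<le> ?B"
    using e0 \<rho>_nonneg A_nonneg \<kappa>_nonneg \<delta>_pos \<delta>_less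
    by (intro divide_nonneg_pos mult_nonneg_nonneg add_nonneg_nonneg) auto
  obtain C where C: "\<And>t \<omega>. t \<le> T \<Longrightarrow> \<bar>?y t \<omega>\<bar> \<le> C"
    using iterate_bounded[of ?w K n] adm K unfolding truncated_W_def by fastforce
  have ym: "?y s \<in> borel_measurable (sig {..s})" for s
    by (intro iterate_measurable_past truncated_W_measurable)
  have y2: "sq_int (?y s)" if "s \<le> T" for s
    using C[OF that] measurable_sig_M[OF ym] by (intro sq_int_bounded) auto
  note Y2 = solution_l2[OF adm sol]
  note Ym = tight_solutionD(1)[OF sol]
  define S where "S \<omega> = \<alpha> 0 t + (\<Sum>j=1..p. \<alpha> j t * Y (t - int j) \<omega>)" for \<omega>
  define R where "R \<omega> = (\<Sum>j=1..p. \<alpha> j t * (Y (t - int j) \<omega> - ?y (t - int j) \<omega>))" for \<omega>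
  have lag: "t - int j \<le> T" for j using Suc.prems by simp
  have S: "sq_int S" "l2norm S \<le> \<rho> + A * l2bound" "S \<in> borel_measurable (sig {..<t})"
  proof -
    note sum = arch_sum_l2norm[where D = Y, OF adm Suc.prems l2bound_nonneg Y2[OF lag]]
    show "sq_int S" unfolding S_def by (intro sq_int_add sq_int_const sum)
    show "l2norm S \<le> \<rho> + A * l2bound"
      using l2norm_add[OF sq_int_const[of "\<alpha> 0 t"] sum(1)] sum(2) admissibleD(2)[OF adm Suc.prems]
        admissibleD(1)[OF adm Suc.prems, of 0] by (auto simp: S_def[abs_def])
    show "S \<in> borel_measurable (sig {..<t})"
      unfolding S_def
      by (intro borel_measurable_add borel_measurable_const arch_sum_measurable
          measurable_sig_mono[OF Ym[OF lag]]) auto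
  qed
  have R: "sq_int R" "l2norm R \<le> A * ?B" "R \<in> borel_measurable (sig {..<t})"
  proof -
    have "sq_int (\<lambda>\<omega>. Y (t - int j) \<omega> - ?y (t - int j) \<omega>)" for j
      by (intro sq_int_diff Y2 y2 lag)
    note sum = arch_sum_l2norm[where D = "\<lambda>t \<omega>. Y t \<omega> - ?y t \<omega>", OF adm Suc.prems B0 this Suc.IH[OF lag]]
    show "sq_int R" "l2norm R \<le> A * ?B" unfolding R_def[abs_def] by (rule sum)+
    show "R \<in> borel_measurable (sig {..<t})"
      unfolding R_def
      by (intro borel_measurable_sum borel_measurable_times borel_measurable_const borel_measurable_diff
          measurable_sig_mono[OF Ym[OF lag]] measurable_sig_mono[OF ym]) auto
  qed
  have dw: "sq_int (\<lambda>\<omega>. W t \<omega> - ?w t \<omega>)" by (intro sq_int_diff sq_int_W truncated_W_l2 K)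
  have dwm: "(\<lambda>\<omega>. W t \<omega> - ?w t \<omega>) \<in> borel_measurable (sig {t})"
    by (intro borel_measurable_diff W_measurable_sig truncated_W_measurable) auto
  note T1 = noise_mult_l2norm[OF dwm dw e S(3,1,2)]
  note T2 = noise_mult_l2norm[OF truncated_W_measurable truncated_W_l2[OF K] R(3,1,2)]
  have "AE \<omega> in M. Y t \<omega> - iterate ?w \<alpha> (Suc n) t \<omega> = (W t \<omega> - ?w t \<omega>) * S \<omega> + ?w t \<omega> * R \<omega>"
    using tight_solutionD(3)[OF sol Suc.prems]
    by eventually_elim (simp add: arch_step_def S_def R_def sum_subtractf algebra_simps)
  moreover have "(\<lambda>\<omega>. Y t \<omega> - iterate ?w \<alpha> (Suc n) t \<omega>) \<in> borel_measurable M"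
    by (intro borel_measurable_diff measurable_sig_M[OF Ym[OF Suc.prems]]
        measurable_sig_M[OF iterate_measurable_past] truncated_W_measurable)
  ultimately have "l2norm (\<lambda>\<omega>. Y t \<omega> - iterate ?w \<alpha> (Suc n) t \<omega>) \<le> e * (\<rho> + A * l2bound) + \<kappa> * (A * ?B)"
    using l2norm_triangle_AE(2)[OF T1(1) T2(1)] T1(2) T2(2) by fastforce
  also have "\<dots> \<le> e * (\<rho> + A * l2bound) + (1 - \<delta>) * ?B"
    using mult_right_mono[OF contraction B0] by (simp only: mult.assoc add_left_mono)
  \<comment> \<open>The first summand of \<open>?B\<close> is the fixed point of x = e (\<rho> + A
    l2bound) + (1 - \<delta>) x, so only the geometric summand changes in the induction.\<close>
  also have "\<dots> = e * (\<rho> + A * l2bound) / \<delta> + (1 - \<delta>) ^ Suc n * l2bound"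
    using \<delta>_pos by (simp add: field_simps)
  finally show ?case .
qed

text \<open>The order of quantifiers is the point: truncation level and number of steps are fixed
  before coefficients, horizon, solution and time, so the approximation is uniform over the
  array.\<close>

lemma solution_truncated_approximation:
  assumes "0 < \<epsilon>"
  shows "\<exists>K\<ge>0. \<exists>n. \<forall>\<alpha> T Y t. admissible \<alpha> T \<longrightarrow> tight_solution \<alpha> T Y \<longrightarrow> t \<le> T \<longrightarrow>
      l2norm (\<lambda>\<omega>. Y t \<omega> - iterate (truncated_W K) \<alpha> n t \<omega>) \<le> \<epsilon>"
proof -
  let ?c = "\<rho> + A * l2bound"
  have c: "0 \<le> ?c" using \<rho>_nonneg A_nonneg l2bound_nonneg by (intro add_nonneg_nonneg mult_nonneg_nonneg)
  \<comment> \<open>Half of \<epsilon> is reserved for the truncation and half for the geometric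
    term. The added 1 keeps the denominator positive when \<open>?c\<close> is zero.\<close>
  define e where "e = \<epsilon> * \<delta> / (2 * (?c + 1))"
  have e: "0 < e" using assms \<delta>_pos c by (simp add: e_def divide_pos_pos)
  have "e * ?c \<le> e * (?c + 1)" using e by (intro mult_left_mono) auto
  also have "e * (?c + 1) = \<epsilon> * \<delta> / 2"
  proof -
    have "x / (2 * y) * y = x / 2" if "y \<noteq> 0" for x y :: real using that by simp
    moreover have "?c + 1 \<noteq> 0" using c by linarith
    ultimately show ?thesis unfolding e_def by blast
  qed
  finally have e1: "e * ?c / \<delta> \<le> \<epsilon> / 2" using \<delta>_pos by (simp add: pos_divide_le_eq)
  have "(\<lambda>n. (1 - \<delta>) ^ n * l2bound) \<longlonglongrightarrow> 0 * l2bound"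
    using \<delta>_pos \<delta>_less by (intro tendsto_intros LIMSEQ_power_zero) auto
  then have "\<forall>\<^sub>F n in sequentially. (1 - \<delta>) ^ n * l2bound < \<epsilon> / 2"
    using assms by (intro order_tendstoD) auto
  then obtain n where n: "(1 - \<delta>) ^ n * l2bound < \<epsilon> / 2"
    using eventually_happens'[OF sequentially_bot] by blast
  obtain K where K: "0 \<le> K" "\<And>t. l2norm (\<lambda>\<omega>. W t \<omega> - truncated_W K t \<omega>) \<le> e"
    using truncation_error[OF e] by blast
  have "l2norm (\<lambda>\<omega>. Y t \<omega> - iterate (truncated_W K) \<alpha> n t \<omega>) \<le> \<epsilon>"
    if "admissible \<alpha> T" "tight_solution \<alpha> T Y" "t \<le> T" for \<alpha> T Y t
    using truncated_iterate_error[OF that K, of n] e1 n by linarith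
  then show ?thesis using K(1) by blast
qed

text \<open>Coefficients have to be close only on the last \<open>p * n\<close> times. What happened
  before enters through the crude bound \<open>2 * l2bound\<close>, reduced by a factor 1 - \<delta>
  in each of the \<open>n\<close> steps.\<close>

lemma solution_comparison:
  assumes adm: "admissible \<alpha> T" "admissible \<alpha>' T" and sol: "tight_solution \<alpha> T Y" "tight_solution \<alpha>' T Y'"
    and "t \<le> T" and \<eta>: "0 \<le> \<eta>"
    and "\<And>j s. j \<le> p \<Longrightarrow> s \<le> t \<Longrightarrow> t - int (p * n) \<le> s \<Longrightarrow> \<bar>\<alpha> j s - \<alpha>' j s\<bar> \<le> \<eta>"
  shows "l2norm (\<lambda>\<omega>. Y t \<omega> - Y' t \<omega>)
      \<le> \<kappa> * \<eta> * (1 + real p * l2bound) / \<delta> + (1 - \<delta>) ^ n * (2 * l2bound)"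
  using assms(5,7)
proof (induction n arbitrary: t)
  case 0
  have "0 \<le> \<kappa> * \<eta> * (1 + real p * l2bound) / \<delta>"
    using \<kappa>_nonneg \<rho>_nonneg \<eta> \<delta>_pos by (intro divide_nonneg_pos mult_nonneg_nonneg add_nonneg_nonneg) auto
  then show ?case
    using l2norm_diff[OF solution_l2(1)[OF adm(1) sol(1)] solution_l2(1)[OF adm(2) sol(2)], of t t]
      solution_l2(2)[OF adm(1) sol(1), of t] solution_l2(2)[OF adm(2) sol(2), of t] 0(1) by simp
next
  case (Suc n)
  let ?c = "\<kappa> * \<eta> * (1 + real p * l2bound)"
  let ?B = "?c / \<delta> + (1 - \<delta>) ^ n * (2 * l2bound)"
  have B0: "0 \<le> ?B"
    using \<kappa>_nonneg \<rho>_nonneg \<eta> \<delta>_pos \<delta>_less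
    by (intro divide_nonneg_pos mult_nonneg_nonneg add_nonneg_nonneg) auto
  have lag: "t - int j \<le> T" for j using Suc.prems(1) by simp
  have pn: "int (p * Suc n) = int p + int (p * n)" "0 \<le> int (p * n)" by (simp_all add: algebra_simps)
  have IH: "l2norm (\<lambda>\<omega>. Y (t - int j) \<omega> - Y' (t - int j) \<omega>) \<le> ?B" if "j \<in> {1..p}" for j
  proof (rule Suc.IH[OF lag])
    fix i s assume "i \<le> p" "s \<le> t - int j" "t - int j - int (p * n) \<le> s"
    then show "\<bar>\<alpha> i s - \<alpha>' i s\<bar> \<le> \<eta>" using that pn by (intro Suc.prems(2)) auto
  qed
  have close: "\<bar>\<alpha> j t - \<alpha>' j t\<bar> \<le> \<eta>" if "j \<le> p" for j
    using that pn by (intro Suc.prems(2)) (auto simp del: of_nat_mult)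
  note Y2 = solution_l2[OF adm(1) sol(1)] and Y2' = solution_l2[OF adm(2) sol(2)]
  note Ym = tight_solutionD(1)[OF sol(1)] and Ym' = tight_solutionD(1)[OF sol(2)]
  \<comment> \<open>\<open>S\<close> collects the change of coefficients, acting on the bounded
    solution \<open>Y'\<close>; \<open>R\<close> keeps the coefficients and acts on the difference
    of the solutions, where the step contracts.\<close>
  define S where "S \<omega> = (\<alpha> 0 t - \<alpha>' 0 t) + (\<Sum>j=1..p. (\<alpha> j t - \<alpha>' j t) * Y' (t - int j) \<omega>)" for \<omega>
  define R where "R \<omega> = (\<Sum>j=1..p. \<alpha> j t * (Y (t - int j) \<omega> - Y' (t - int j) \<omega>))" for \<omega>
  have S: "sq_int S" "l2norm S \<le> \<eta> * (1 + real p * l2bound)" "S \<in> borel_measurable (sig {..<t})"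
  proof -
    note sum = linear_l2norm[where D = "\<lambda>j. Y' (t - int j)" and b = "\<lambda>j. \<alpha> j t - \<alpha>' j t", OF Y2'[OF lag]]
    show "sq_int S" unfolding S_def by (intro sq_int_add sq_int_const sum)
    have "(\<Sum>j=1..p. \<bar>\<alpha> j t - \<alpha>' j t\<bar>) \<le> (\<Sum>j=1..p. \<eta>)" using close by (intro sum_mono) auto
    then have "(\<Sum>j=1..p. \<bar>\<alpha> j t - \<alpha>' j t\<bar>) * l2bound \<le> (real p * \<eta>) * l2bound"
      using l2bound_nonneg by (intro mult_right_mono) auto
    moreover have "l2norm S \<le> \<bar>\<alpha> 0 t - \<alpha>' 0 t\<bar> + (\<Sum>j=1..p. \<bar>\<alpha> j t - \<alpha>' j t\<bar>) * l2bound"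
      using l2norm_add[OF sq_int_const[of "\<alpha> 0 t - \<alpha>' 0 t"] sum(1)] sum(2) by (auto simp: S_def[abs_def])
    moreover have "\<eta> * (1 + real p * l2bound) = \<eta> + (real p * \<eta>) * l2bound"
      by (simp only: distrib_left mult_1_right mult.assoc mult.left_commute)
    ultimately show "l2norm S \<le> \<eta> * (1 + real p * l2bound)" using close[of 0] by linarith
    show "S \<in> borel_measurable (sig {..<t})"
      unfolding S_def
      by (intro borel_measurable_add borel_measurable_const borel_measurable_sum borel_measurable_times
          measurable_sig_mono[OF Ym'[OF lag]]) auto
  qed
  have R: "sq_int R" "l2norm R \<le> A * ?B" "R \<in> borel_measurable (sig {..<t})"
  proof -
    have "sq_int (\<lambda>\<omega>. Y (t - int j) \<omega> - Y' (t - int j) \<omega>)" for j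
      by (intro sq_int_diff Y2 Y2' lag)
    note sum = arch_sum_l2norm[where D = "\<lambda>t \<omega>. Y t \<omega> - Y' t \<omega>", OF adm(1) Suc.prems(1) B0 this IH]
    show "sq_int R" "l2norm R \<le> A * ?B" unfolding R_def[abs_def] by (rule sum; assumption)+
    show "R \<in> borel_measurable (sig {..<t})"
      unfolding R_def
      by (intro borel_measurable_sum borel_measurable_times borel_measurable_const borel_measurable_diff
          measurable_sig_mono[OF Ym[OF lag]] measurable_sig_mono[OF Ym'[OF lag]]) auto
  qed
  have Wm: "W t \<in> borel_measurable (sig {t})" by (rule W_measurable_sig) simp
  note T1 = noise_mult_l2norm[OF Wm sq_int_W l2norm_W S(3,1,2)]
  note T2 = noise_mult_l2norm[OF Wm sq_int_W l2norm_W R(3,1,2)]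
  have "AE \<omega> in M. Y t \<omega> - Y' t \<omega> = W t \<omega> * S \<omega> + W t \<omega> * R \<omega>"
    using tight_solutionD(3)[OF sol(1) Suc.prems(1)] tight_solutionD(3)[OF sol(2) Suc.prems(1)]
    by eventually_elim (simp add: arch_step_def S_def R_def sum_subtractf sum.distrib algebra_simps)
  moreover have "(\<lambda>\<omega>. Y t \<omega> - Y' t \<omega>) \<in> borel_measurable M"
    by (intro borel_measurable_diff measurable_sig_M[OF Ym[OF Suc.prems(1)]] measurable_sig_M[OF Ym'[OF Suc.prems(1)]])
  ultimately have "l2norm (\<lambda>\<omega>. Y t \<omega> - Y' t \<omega>) \<le> ?c + \<kappa> * (A * ?B)"
    using l2norm_triangle_AE(2)[OF T1(1) T2(1)] T1(2) T2(2) by (fastforce simp: mult.assoc)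
  also have "\<dots> \<le> ?c + (1 - \<delta>) * ?B"
    using mult_right_mono[OF contraction B0] by (simp only: mult.assoc add_left_mono)
  also have "\<dots> = ?c / \<delta> + (1 - \<delta>) ^ Suc n * (2 * l2bound)"
    using \<delta>_pos by (simp add: field_simps)
  finally show ?case .
qed

end

section \<open>Averages of weakly dependent variables\<close>

lemma shifted_real_at_top: "filterlim (\<lambda>N. real N - real h) at_top sequentially"
  using filterlim_tendsto_add_at_top[OF tendsto_const[of "- real h"] filterlim_real_sequentially] by simp

text \<open>The sum divided by N is the integral of a step function, to which dominated convergence
  applies. Measurability of \<open>G\<close> comes as a by-product, \<open>G\<close> being a
  pointwise limit of step functions.\<close>

lemma step_average_limit:
  fixes f :: "nat \<Rightarrow> int \<Rightarrow> real" and G :: "real \<Rightarrow> real" and h :: nat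
  assumes h: "0 < h"
    and bound: "\<And>N t. 1 \<le> t \<Longrightarrow> t \<le> int N - int h \<Longrightarrow> \<bar>f N t\<bar> \<le> C"
    and lim: "\<And>u. 0 < u \<Longrightarrow> u < 1 \<Longrightarrow> (\<lambda>N. f N \<lceil>real N * u\<rceil>) \<longlonglongrightarrow> G u"
  shows "set_integrable lborel {0<..<1} G"
    and "(\<lambda>N. (\<Sum>t=1..int N - int h. f N t) / (real N - real h)) \<longlonglongrightarrow> (LINT u:{0<..<1}|lborel. G u)"
proof -
  \<comment> \<open>Cells open on the left and closed on the right are those on which the ceiling of
    N u is constant. The step function is zero on the last \<open>h\<close> cells.\<close>
  define F where "F N u = (\<Sum>t=1..int N - int h. f N t * indicator {(real_of_int t - 1) / real N<..real_of_int t / real N} u)"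
    for N and u :: real
  have F: "F N u = (if 0 < u \<and> \<lceil>real N * u\<rceil> \<le> int N - int h then f N \<lceil>real N * u\<rceil> else 0)" if N: "0 < N" for N u
  proof -
    have "(indicator {(real_of_int t - 1) / real N<..real_of_int t / real N} u :: real) = (if t = \<lceil>real N * u\<rceil> then 1 else 0)" for t
    proof -
      have "u \<in> {(real_of_int t - 1) / real N<..real_of_int t / real N} \<longleftrightarrow> \<lceil>real N * u\<rceil> = t"
        using N by (simp add: ceiling_eq_iff pos_divide_less_eq pos_le_divide_eq mult.commute)
      then show ?thesis by (auto simp: indicator_def)
    qed
    then have "F N u = (\<Sum>t=1..int N - int h. if t = \<lceil>real N * u\<rceil> then f N t else 0)"
      unfolding F_def by (intro sum.cong) auto
    also have "\<dots> = (if \<lceil>real N * u\<rceil> \<in> {1..int N - int h} then f N \<lceil>real N * u\<rceil> else 0)"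
      by (simp add: sum.delta)
    finally show ?thesis using N by (auto simp: zero_less_mult_iff one_le_ceiling)
  qed
  have Fm [measurable]: "F N \<in> borel_measurable borel" for N
    unfolding F_def by measurable
  have FI: "indicator {0<..<1} u * F N u = F N u" if N: "0 < N" for N u
  proof (cases "u < 1")
    case False
    then have "real N * 1 \<le> real N * u" by (intro mult_left_mono) auto
    then have "int N \<le> \<lceil>real N * u\<rceil>" by linarith
    then show ?thesis using F[OF N, of u] h by auto
  qed (use F[OF N, of u] in auto)
  have Flim: "(\<lambda>N. indicator {0<..<1} u * F N u) \<longlonglongrightarrow> indicator {0<..<1} u * G u" for u
  proof (cases "u \<in> {0<..<1}")
    case True
    \<comment> \<open>Beyond this index N u + 1 < N - h, so the cell containing \<open>u\<close> is
      not among the \<open>h\<close> omitted ones; this uses u < 1.\<close>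
    obtain N0 :: nat where N0: "(1 + real h) / (1 - u) < real N0" using reals_Archimedean2 by blast
    have "F N u = f N \<lceil>real N * u\<rceil>" if "max N0 1 \<le> N" for N
    proof -
      have "(1 + real h) / (1 - u) < real N" using N0 that by (simp add: order_less_le_trans)
      then have "real N * u + 1 < real N - real h"
        using True by (simp add: pos_divide_less_eq algebra_simps)
      then have "\<lceil>real N * u\<rceil> \<le> int N - int h" by linarith
      then show ?thesis using F[of N u] True that by auto
    qed
    then have ev: "\<forall>\<^sub>F N in sequentially. f N \<lceil>real N * u\<rceil> = F N u"
      unfolding eventually_sequentially by metis
    have "(\<lambda>N. F N u) \<longlonglongrightarrow> G u"
      by (rule Lim_transform_eventually[OF lim ev]) (use True in auto)
    then show ?thesis using True by simp
  qed simp
  have Fbound: "\<bar>indicator {0<..<1} u * F N u\<bar> \<le> indicator {0<..<1} u * \<bar>C\<bar>" for N u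
  proof (cases "N = 0")
    case True then show ?thesis using h by (simp add: F_def)
  next
    case False
    then have "\<bar>F N u\<bar> \<le> \<bar>C\<bar>"
      using F[of N u] bound[of "\<lceil>real N * u\<rceil>" N] by (auto simp: zero_less_mult_iff one_le_ceiling)
    then show ?thesis by (auto simp: indicator_def)
  qed
  have Gm: "(\<lambda>u. indicator {0<..<1} u * G u) \<in> borel_measurable lborel"
    by (rule borel_measurable_LIMSEQ_real[OF Flim]) simp
  have Cint: "integrable lborel (\<lambda>u. indicator {0<..<1::real} u * \<bar>C\<bar>)"
    by (intro integrable_mult_left integrable_real_indicator) auto
  have dom: "integrable lborel (\<lambda>u. indicator {0<..<1} u * G u)"
    "(\<lambda>N. \<integral>u. indicator {0<..<1} u * F N u \<partial>lborel) \<longlonglongrightarrow> (\<integral>u. indicator {0<..<1} u * G u \<partial>lborel)"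
    using integrable_dominated_convergence[OF Gm _ Cint, of "\<lambda>N u. indicator {0<..<1} u * F N u"]
      integral_dominated_convergence[OF Gm _ Cint, of "\<lambda>N u. indicator {0<..<1} u * F N u"] Flim Fbound
    by auto
  then show "set_integrable lborel {0<..<1} G" by (simp add: set_integrable_def)
  have Fint: "(\<integral>u. indicator {0<..<1} u * F N u \<partial>lborel) = (\<Sum>t=1..int N - int h. f N t) / real N" if N: "0 < N" for N
  proof -
    have "(\<integral>u. F N u \<partial>lborel) = (\<Sum>t=1..int N - int h. \<integral>u. f N t * indicator {(real_of_int t - 1) / real N<..real_of_int t / real N} u \<partial>lborel)"
      unfolding F_def by (intro Bochner_Integration.integral_sum integrable_mult_right integrable_real_indicator)
        (auto simp: divide_right_mono)
    also have "\<dots> = (\<Sum>t=1..int N - int h. f N t * (1 / real N))"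
      using N by (intro sum.cong) (auto simp: divide_right_mono diff_divide_distrib)
    finally show ?thesis unfolding FI[OF N] by (simp add: sum_divide_distrib)
  qed
  \<comment> \<open>The average divides by N - h, whereas a cell of the step function has length
    1/N.\<close>
  have ratio: "(\<lambda>N. real N / (real N - real h)) \<longlonglongrightarrow> 1"
  proof (rule Lim_transform_eventually)
    show "(\<lambda>N. 1 + real h / (real N - real h)) \<longlonglongrightarrow> 1"
      using tendsto_add[OF tendsto_const[of 1] tendsto_divide_0[OF tendsto_const[of "real h"]
        filterlim_at_top_imp_at_infinity[OF shifted_real_at_top[of h]]]] by simp
    show "\<forall>\<^sub>F N in sequentially. 1 + real h / (real N - real h) = real N / (real N - real h)"
      using eventually_gt_at_top[of h] by eventually_elim (simp add: field_simps)
  qed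
  have "(\<lambda>N. (\<integral>u. indicator {0<..<1} u * F N u \<partial>lborel) * (real N / (real N - real h)))
      \<longlonglongrightarrow> (\<integral>u. indicator {0<..<1} u * G u \<partial>lborel) * 1"
    by (intro tendsto_mult dom ratio)
  moreover have "\<forall>\<^sub>F N in sequentially. (\<integral>u. indicator {0<..<1} u * F N u \<partial>lborel) * (real N / (real N - real h))
      = (\<Sum>t=1..int N - int h. f N t) / (real N - real h)"
    using eventually_gt_at_top[of 0] by eventually_elim (simp add: Fint)
  ultimately show "(\<lambda>N. (\<Sum>t=1..int N - int h. f N t) / (real N - real h)) \<longlonglongrightarrow> (LINT u:{0<..<1}|lborel. G u)"
    by (simp add: set_lebesgue_integral_def Lim_transform_eventually)
qed

context prob_space begin

text \<open>Of all pairs of indices only those at distance at most \<open>d\<close> contribute to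
  the variance, at most \<open>2 * d + 1\<close> per index, each by no more than the square of
  \<open>2 * B\<close>. The L^2 norm of the centred sum thus grows like the square root of the
  number of terms.\<close>

lemma bounded_sum_l1:
  fixes U :: "int \<Rightarrow> 'a \<Rightarrow> real"
  assumes fin: "finite I" and m: "\<And>t. t \<in> I \<Longrightarrow> U t \<in> borel_measurable M"
    and B: "\<And>t \<omega>. t \<in> I \<Longrightarrow> \<bar>U t \<omega>\<bar> \<le> B" and B0: "0 \<le> B"
    and uncorr: "\<And>s t. s \<in> I \<Longrightarrow> t \<in> I \<Longrightarrow> int d < \<bar>s - t\<bar> \<Longrightarrow>
       (\<integral>\<omega>. U s \<omega> * U t \<omega> \<partial>M) = (\<integral>\<omega>. U s \<omega> \<partial>M) * (\<integral>\<omega>. U t \<omega> \<partial>M)"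
  shows "(\<integral>\<omega>. \<bar>\<Sum>t\<in>I. U t \<omega> - (\<integral>\<omega>. U t \<omega> \<partial>M)\<bar> \<partial>M) \<le> 2 * B * sqrt (real (card I) * (2 * real d + 1))"
proof -
  define c where "c t = (\<integral>\<omega>. U t \<omega> \<partial>M)" for t
  define R where "R t \<omega> = U t \<omega> - c t" for t \<omega>
  have int: "integrable M (U t)" if "t \<in> I" for t
    by (rule integrable_const_bound[where B = B]) (use m B that in auto)
  have int2: "integrable M (\<lambda>\<omega>. U s \<omega> * U t \<omega>)" if "s \<in> I" "t \<in> I" for s t
  proof (rule integrable_const_bound[where B = "B * B"])
    show "AE \<omega> in M. norm (U s \<omega> * U t \<omega>) \<le> B * B"
      using B[OF that(1)] B[OF that(2)] B0 by (auto simp: abs_mult intro!: mult_mono)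
  qed (use m that in auto)
  have cB: "\<bar>c t\<bar> \<le> B" if "t \<in> I" for t
  proof -
    have "\<bar>c t\<bar> \<le> (\<integral>\<omega>. \<bar>U t \<omega>\<bar> \<partial>M)" unfolding c_def by (rule integral_abs_bound)
    also have "\<dots> \<le> (\<integral>\<omega>. B \<partial>M)" using int[OF that] B[OF that] by (intro integral_mono) auto
    finally show ?thesis by (simp add: prob_space)
  qed
  have Rint: "integrable M (\<lambda>\<omega>. R s \<omega> * R t \<omega>)" if "s \<in> I" "t \<in> I" for s t
    unfolding R_def using int int2 that by (auto simp: left_diff_distrib right_diff_distrib)
  have ER: "(\<integral>\<omega>. R s \<omega> * R t \<omega> \<partial>M) = (\<integral>\<omega>. U s \<omega> * U t \<omega> \<partial>M) - c s * c t" if "s \<in> I" "t \<in> I" for s t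
  proof -
    have "(\<integral>\<omega>. R s \<omega> * R t \<omega> \<partial>M) = (\<integral>\<omega>. U s \<omega> * U t \<omega> - c t * U s \<omega> - c s * U t \<omega> + c s * c t \<partial>M)"
      unfolding R_def by (intro Bochner_Integration.integral_cong) (auto simp: algebra_simps)
    also have "\<dots> = (\<integral>\<omega>. U s \<omega> * U t \<omega> \<partial>M) - c t * c s - c s * c t + c s * c t"
      using int[OF that(1)] int[OF that(2)] int2[OF that] by (simp add: c_def prob_space)
    finally show ?thesis by simp
  qed
  have RB: "(\<integral>\<omega>. R s \<omega> * R t \<omega> \<partial>M) \<le> (2 * B)\<^sup>2" if "s \<in> I" "t \<in> I" for s t
  proof -
    have "R s \<omega> * R t \<omega> \<le> (2 * B)\<^sup>2" for \<omega>
    proof -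
      have "\<bar>R s \<omega>\<bar> \<le> 2 * B" "\<bar>R t \<omega>\<bar> \<le> 2 * B"
        using B[OF that(1), of \<omega>] B[OF that(2), of \<omega>] cB[OF that(1)] cB[OF that(2)] by (auto simp: R_def)
      then have "\<bar>R s \<omega>\<bar> * \<bar>R t \<omega>\<bar> \<le> (2 * B) * (2 * B)" using B0 by (intro mult_mono) auto
      then show ?thesis by (simp add: abs_mult[symmetric] power2_eq_square)
    qed
    then have "(\<integral>\<omega>. R s \<omega> * R t \<omega> \<partial>M) \<le> (\<integral>\<omega>. (2 * B)\<^sup>2 \<partial>M)"
      using Rint[OF that] by (intro integral_mono) auto
    then show ?thesis by (simp add: prob_space)
  qed
  have "(\<integral>\<omega>. (\<Sum>t\<in>I. R t \<omega>)\<^sup>2 \<partial>M) = (\<Sum>s\<in>I. \<Sum>t\<in>I. \<integral>\<omega>. R s \<omega> * R t \<omega> \<partial>M)"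
    using Rint by (simp add: power2_eq_square sum_product Bochner_Integration.integral_sum)
  also have "\<dots> \<le> (\<Sum>s\<in>I. \<Sum>t\<in>I. if t \<in> {s - int d..s + int d} then (2 * B)\<^sup>2 else 0)"
  proof (intro sum_mono)
    fix s t assume st: "s \<in> I" "t \<in> I"
    show "(\<integral>\<omega>. R s \<omega> * R t \<omega> \<partial>M) \<le> (if t \<in> {s - int d..s + int d} then (2 * B)\<^sup>2 else 0)"
    proof (cases "int d < \<bar>s - t\<bar>")
      case True
      then have "(\<integral>\<omega>. R s \<omega> * R t \<omega> \<partial>M) = 0" using ER[OF st] uncorr[OF st] by (simp add: c_def)
      then show ?thesis by simp
    next
      case False
      then have "t \<in> {s - int d..s + int d}" by auto
      then show ?thesis using RB[OF st] by simp
    qed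
  qed
  also have "\<dots> \<le> (\<Sum>s\<in>I. real (2 * d + 1) * (2 * B)\<^sup>2)"
  proof (intro sum_mono)
    fix s
    have "(\<Sum>t\<in>I. if t \<in> {s - int d..s + int d} then (2 * B)\<^sup>2 else 0) = real (card (I \<inter> {s - int d..s + int d})) * (2 * B)\<^sup>2"
      by (subst sum.inter_restrict[OF fin, symmetric]) simp
    also have "\<dots> \<le> real (card {s - int d..s + int d}) * (2 * B)\<^sup>2"
      by (intro mult_right_mono of_nat_mono card_mono) auto
    also have "card {s - int d..s + int d} = 2 * d + 1" by simp
    finally show "(\<Sum>t\<in>I. if t \<in> {s - int d..s + int d} then (2 * B)\<^sup>2 else 0) \<le> real (2 * d + 1) * (2 * B)\<^sup>2" .
  qed
  also have "\<dots> = (2 * B)\<^sup>2 * (real (card I) * (2 * real d + 1))" by simp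
  finally have "l2norm (\<lambda>\<omega>. \<Sum>t\<in>I. R t \<omega>) \<le> sqrt ((2 * B)\<^sup>2 * (real (card I) * (2 * real d + 1)))"
    unfolding l2norm_def by (rule real_sqrt_le_mono)
  also have "\<dots> = 2 * B * sqrt (real (card I) * (2 * real d + 1))"
    using B0 by (simp add: real_sqrt_mult)
  finally have "l2norm (\<lambda>\<omega>. \<Sum>t\<in>I. R t \<omega>) \<le> 2 * B * sqrt (real (card I) * (2 * real d + 1))" .
  moreover have "sq_int (\<lambda>\<omega>. \<Sum>t\<in>I. R t \<omega>)"
    unfolding R_def using m B by (intro sq_int_sum sq_int_diff sq_int_const sq_int_bounded[where B = B]) auto
  ultimately show ?thesis using l1_le_l2norm[of "\<lambda>\<omega>. \<Sum>t\<in>I. R t \<omega>"] by (simp add: R_def c_def)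
qed

text \<open>For a fixed accuracy the approximants have a bound \<open>B\<close> and a range
  \<open>d\<close> independent of N, so their centred averages vanish in the limit. Replacing the
  variables and their means costs at most r/4 each, which leaves room below r.\<close>

lemma weak_law_approx_dependent:
  fixes V :: "nat \<Rightarrow> int \<Rightarrow> 'a \<Rightarrow> real" and h :: nat
  assumes V: "\<And>N t. t \<in> {1..int N - int h} \<Longrightarrow> integrable M (V N t)"
    and approx: "\<And>\<epsilon>. 0 < \<epsilon> \<Longrightarrow> \<exists>V' B d. \<forall>N. \<forall>t\<in>{1..int N - int h}.
        V' N t \<in> borel_measurable M \<and> (\<forall>\<omega>. \<bar>V' N t \<omega>\<bar> \<le> B) \<and> (\<integral>\<omega>. \<bar>V N t \<omega> - V' N t \<omega>\<bar> \<partial>M) \<le> \<epsilon> \<and>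
        (\<forall>s\<in>{1..int N - int h}. int d < \<bar>s - t\<bar> \<longrightarrow>
          (\<integral>\<omega>. V' N s \<omega> * V' N t \<omega> \<partial>M) = (\<integral>\<omega>. V' N s \<omega> \<partial>M) * (\<integral>\<omega>. V' N t \<omega> \<partial>M))"
  shows "(\<lambda>N. \<integral>\<omega>. \<bar>(\<Sum>t=1..int N - int h. V N t \<omega>) / (real N - real h)
      - (\<Sum>t=1..int N - int h. \<integral>\<omega>. V N t \<omega> \<partial>M) / (real N - real h)\<bar> \<partial>M) \<longlonglongrightarrow> 0"
    (is "?L \<longlonglongrightarrow> 0")
proof (rule LIMSEQ_I)
  fix r :: real assume r: "0 < r"
  have r4: "0 < r / 4" using r by simp
  obtain V' B0 d where P: "\<forall>N. \<forall>t\<in>{1..int N - int h}.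
        V' N t \<in> borel_measurable M \<and> (\<forall>\<omega>. \<bar>V' N t \<omega>\<bar> \<le> B0) \<and> (\<integral>\<omega>. \<bar>V N t \<omega> - V' N t \<omega>\<bar> \<partial>M) \<le> r / 4 \<and>
        (\<forall>s\<in>{1..int N - int h}. int d < \<bar>s - t\<bar> \<longrightarrow>
          (\<integral>\<omega>. V' N s \<omega> * V' N t \<omega> \<partial>M) = (\<integral>\<omega>. V' N s \<omega> \<partial>M) * (\<integral>\<omega>. V' N t \<omega> \<partial>M))"
    using approx[OF r4] by blast
  note P' = P[rule_format]
  have V'm: "V' N t \<in> borel_measurable M" and B0: "\<bar>V' N t \<omega>\<bar> \<le> B0"
    and close: "(\<integral>\<omega>. \<bar>V N t \<omega> - V' N t \<omega>\<bar> \<partial>M) \<le> r / 4" if "t \<in> {1..int N - int h}" for N t \<omega>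
    using P'[OF that] by blast+
  have uncorr: "(\<integral>\<omega>. V' N s \<omega> * V' N t \<omega> \<partial>M) = (\<integral>\<omega>. V' N s \<omega> \<partial>M) * (\<integral>\<omega>. V' N t \<omega> \<partial>M)"
    if "s \<in> {1..int N - int h}" "t \<in> {1..int N - int h}" "int d < \<bar>s - t\<bar>" for N s t
    using P'[OF that(2)] that by blast
  \<comment> \<open>\<open>B0\<close> is constrained only through index ranges that may be empty;
    the absolute value makes the bound nonnegative at once.\<close>
  define B where "B = \<bar>B0\<bar>"
  have B: "\<bar>V' N t \<omega>\<bar> \<le> B" if "t \<in> {1..int N - int h}" for N t \<omega>
    using B0[OF that, of \<omega>] by (simp add: B_def)
  have V'i: "integrable M (V' N t)" if "t \<in> {1..int N - int h}" for N t
    by (rule integrable_const_bound[where B = B]) (use V'm[OF that] B[OF that] in auto)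
  have bound: "?L N \<le> r / 2 + 2 * B * sqrt ((2 * real d + 1) / (real N - real h))" if N: "h < N" for N
  proof -
    let ?I = "{1..int N - int h}" and ?n = "real N - real h"
    have n: "0 < ?n" using N by simp
    have alg: "m * (r / 4) + 2 * B * (m * x) + m * (r / 4) = m * (r / 2 + 2 * B * x)" for m x :: real
      by (simp add: algebra_simps)
    have card: "real (card ?I) = ?n" using N by simp
    let ?c = "\<lambda>t. \<integral>\<omega>. V N t \<omega> \<partial>M" and ?c' = "\<lambda>t. \<integral>\<omega>. V' N t \<omega> \<partial>M"
    have di: "integrable M (\<lambda>\<omega>. \<bar>V N t \<omega> - V' N t \<omega>\<bar>)" if "t \<in> ?I" for t
      using V[OF that] V'i[OF that] by auto
    have dc: "\<bar>?c' t - ?c t\<bar> \<le> r / 4" if "t \<in> ?I" for t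
    proof -
      have "?c' t - ?c t = (\<integral>\<omega>. V' N t \<omega> - V N t \<omega> \<partial>M)" using V[OF that] V'i[OF that] by simp
      also have "\<bar>\<dots>\<bar> \<le> (\<integral>\<omega>. \<bar>V' N t \<omega> - V N t \<omega>\<bar> \<partial>M)" by (rule integral_abs_bound)
      finally show ?thesis using close[OF that] by (simp add: abs_minus_commute)
    qed
    let ?E = "\<lambda>\<omega>. (\<Sum>t\<in>?I. \<bar>V N t \<omega> - V' N t \<omega>\<bar>)" and ?S = "\<lambda>\<omega>. \<bar>\<Sum>t\<in>?I. V' N t \<omega> - ?c' t\<bar>"
    have Ei: "integrable M ?E" using di by (intro Bochner_Integration.integrable_sum)
    have Si: "integrable M ?S" using V'i by (intro integrable_abs Bochner_Integration.integrable_sum Bochner_Integration.integrable_diff) auto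
    have "?n * ?L N = (\<integral>\<omega>. \<bar>\<Sum>t\<in>?I. V N t \<omega> - ?c t\<bar> \<partial>M)"
    proof -
      have "\<bar>(\<Sum>t\<in>?I. V N t \<omega>) / ?n - (\<Sum>t\<in>?I. ?c t) / ?n\<bar> = \<bar>\<Sum>t\<in>?I. V N t \<omega> - ?c t\<bar> / ?n" for \<omega>
        using n by (simp add: sum_subtractf diff_divide_distrib[symmetric] abs_divide)
      then show ?thesis using n by simp
    qed
    also have "\<dots> \<le> (\<integral>\<omega>. ?E \<omega> + ?S \<omega> + ?n * (r / 4) \<partial>M)"
    proof (rule integral_mono)
      show "integrable M (\<lambda>\<omega>. \<bar>\<Sum>t\<in>?I. V N t \<omega> - ?c t\<bar>)"
        using V by (intro integrable_abs Bochner_Integration.integrable_sum Bochner_Integration.integrable_diff) auto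
      show "integrable M (\<lambda>\<omega>. ?E \<omega> + ?S \<omega> + ?n * (r / 4))" using Ei Si by auto
      fix \<omega>
      have "(\<Sum>t\<in>?I. V N t \<omega> - ?c t) = (\<Sum>t\<in>?I. V N t \<omega> - V' N t \<omega>) + (\<Sum>t\<in>?I. V' N t \<omega> - ?c' t) + (\<Sum>t\<in>?I. ?c' t - ?c t)"
        by (simp add: sum.distrib[symmetric])
      moreover have "\<bar>\<Sum>t\<in>?I. V N t \<omega> - V' N t \<omega>\<bar> \<le> ?E \<omega>" by (rule sum_abs)
      moreover have "\<bar>\<Sum>t\<in>?I. ?c' t - ?c t\<bar> \<le> ?n * (r / 4)"
      proof -
        have "\<bar>\<Sum>t\<in>?I. ?c' t - ?c t\<bar> \<le> (\<Sum>t\<in>?I. \<bar>?c' t - ?c t\<bar>)" by (rule sum_abs)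
        also have "\<dots> \<le> (\<Sum>t\<in>?I. r / 4)" using dc by (rule sum_mono)
        finally show ?thesis using card by simp
      qed
      ultimately show "\<bar>\<Sum>t\<in>?I. V N t \<omega> - ?c t\<bar> \<le> ?E \<omega> + ?S \<omega> + ?n * (r / 4)" by linarith
    qed
    also have "\<dots> = (\<Sum>t\<in>?I. \<integral>\<omega>. \<bar>V N t \<omega> - V' N t \<omega>\<bar> \<partial>M) + (\<integral>\<omega>. ?S \<omega> \<partial>M) + ?n * (r / 4)"
      using Ei Si di by (simp add: prob_space Bochner_Integration.integral_sum)
    also have "\<dots> \<le> ?n * (r / 4) + 2 * B * sqrt (?n * (2 * real d + 1)) + ?n * (r / 4)"
    proof (intro add_mono order_refl)
      have "(\<Sum>t\<in>?I. \<integral>\<omega>. \<bar>V N t \<omega> - V' N t \<omega>\<bar> \<partial>M) \<le> (\<Sum>t\<in>?I. r / 4)" using close by (rule sum_mono)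
      then show "(\<Sum>t\<in>?I. \<integral>\<omega>. \<bar>V N t \<omega> - V' N t \<omega>\<bar> \<partial>M) \<le> ?n * (r / 4)" using card by simp
      show "(\<integral>\<omega>. ?S \<omega> \<partial>M) \<le> 2 * B * sqrt (?n * (2 * real d + 1))"
        using bounded_sum_l1[of ?I "V' N" B d] V'm B uncorr unfolding card by (simp add: B_def)
    qed
    also have "sqrt (?n * (2 * real d + 1)) = ?n * sqrt ((2 * real d + 1) / ?n)"
    proof -
      have "?n * (2 * real d + 1) = ?n\<^sup>2 * ((2 * real d + 1) / ?n)"
        using n by (simp add: power2_eq_square)
      then show ?thesis using n by (simp only: real_sqrt_mult real_sqrt_abs abs_of_pos)
    qed
    finally have "?n * ?L N \<le> ?n * (r / 2 + 2 * B * sqrt ((2 * real d + 1) / ?n))"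
      unfolding alg .
    then show ?thesis using n by (rule mult_left_le_imp_le)
  qed
  have "(\<lambda>N. r / 2 + 2 * B * sqrt ((2 * real d + 1) / (real N - real h))) \<longlonglongrightarrow> r / 2 + 2 * B * sqrt 0"
  proof (intro tendsto_intros)
    show "(\<lambda>N. (2 * real d + 1) / (real N - real h)) \<longlonglongrightarrow> 0"
      by (intro tendsto_divide_0[OF tendsto_const] filterlim_at_top_imp_at_infinity shifted_real_at_top)
  qed
  then have "\<forall>\<^sub>F N in sequentially. r / 2 + 2 * B * sqrt ((2 * real d + 1) / (real N - real h)) < r"
    by (rule order_tendstoD) (use r in simp)
  then have "\<forall>\<^sub>F N in sequentially. \<bar>?L N\<bar> < r"
    using eventually_gt_at_top[of h]
  proof eventually_elim
    case (elim N)
    have "0 \<le> ?L N" by simp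
    then show ?case using bound[OF elim(2)] elim(1) by linarith
  qed
  then show "\<exists>no. \<forall>n\<ge>no. norm (?L n - 0) < r"
    unfolding eventually_sequentially by simp
qed

end

section \<open>Squares of tvARCH processes\<close>

context arch_model
begin

text \<open>The squares of a process satisfy adaptedness and the equation only up to null sets, so
  they are tied to a version \<open>Y\<close> for which \<open>tight_solution\<close> holds.\<close>

definition square_solution :: "(nat \<Rightarrow> int \<Rightarrow> real) \<Rightarrow> int \<Rightarrow> (int \<Rightarrow> 'a \<Rightarrow> real) \<Rightarrow> bool" where
  "square_solution \<alpha> T X \<longleftrightarrow>
     (\<exists>Y. tight_solution \<alpha> T Y \<and> (\<forall>t\<le>T. X t \<in> borel_measurable M \<and> (AE \<omega> in M. (X t \<omega>)\<^sup>2 = Y t \<omega>)))"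

text \<open>Squaring X = \<sigma> Z removes the free sign of \<sigma> and leaves the affine
  recursion. \<open>S\<close> is the set of times at which the equations are given: a half-line for
  a row, all integers for a stationary process.\<close>

lemma square_solutionI:
  assumes "arch_equations M Z p \<alpha> S X" "{..T} \<subseteq> S" "\<And>t. t \<le> T \<Longrightarrow> causal_at M Z X t"
    and tight: "\<And>\<eta>. 0 < \<eta> \<Longrightarrow> \<exists>K. \<forall>t\<le>T. prob {\<omega> \<in> space M. (X t \<omega>)\<^sup>2 > K} \<le> \<eta>"
  shows "square_solution \<alpha> T X"
proof -
  obtain \<sigma> where \<sigma>: "\<forall>t\<in>S. AE \<omega> in M. X t \<omega> = \<sigma> t \<omega> * Z t \<omega> \<and>
      (\<sigma> t \<omega>)\<^sup>2 = \<alpha> 0 t + (\<Sum>j=1..p. \<alpha> j t * (X (t - int j) \<omega>)\<^sup>2)"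
    by (rule exE[OF assms(1)[unfolded arch_equations_def]])
  have "\<forall>t. \<exists>X'. t \<le> T \<longrightarrow> X' \<in> borel_measurable (sig {..t}) \<and> (AE \<omega> in M. X t \<omega> = X' \<omega>)"
    using causal_version assms(3) by blast
  then obtain X' where X'_all: "\<forall>t. t \<le> T \<longrightarrow> X' t \<in> borel_measurable (sig {..t}) \<and> (AE \<omega> in M. X t \<omega> = X' t \<omega>)"
    by (rule choice[THEN exE])
  then have X': "\<And>t. t \<le> T \<Longrightarrow> X' t \<in> borel_measurable (sig {..t})"
    and XX': "\<And>t. t \<le> T \<Longrightarrow> AE \<omega> in M. X t \<omega> = X' t \<omega>" by auto
  have Xm: "X t \<in> borel_measurable M" if "t \<le> T" for t
    using assms(3)[OF that] by (simp add: causal_at_def)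
  define Y where "Y t \<omega> = (X' t \<omega>)\<^sup>2" for t \<omega>
  have Ym: "Y t \<in> borel_measurable (sig {..t})" if "t \<le> T" for t
    unfolding Y_def[abs_def] using X'[OF that] by simp
  have YX: "AE \<omega> in M. (X t \<omega>)\<^sup>2 = Y t \<omega>" if "t \<le> T" for t
    using XX'[OF that] by eventually_elim (simp add: Y_def)
  have "AE \<omega> in M. Y t \<omega> = arch_step W \<alpha> Y t \<omega>" if "t \<le> T" for t
  proof -
    \<comment> \<open>The index 0 is included so that one null set covers the current time together
      with all lags.\<close>
    have "AE \<omega> in M. \<forall>j\<in>{0..p}. (X (t - int j) \<omega>)\<^sup>2 = Y (t - int j) \<omega>"
      using that by (intro AE_finite_allI YX) auto
    moreover have "AE \<omega> in M. X t \<omega> = \<sigma> t \<omega> * Z t \<omega> \<and>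
        (\<sigma> t \<omega>)\<^sup>2 = \<alpha> 0 t + (\<Sum>j=1..p. \<alpha> j t * (X (t - int j) \<omega>)\<^sup>2)"
      by (rule \<sigma>[rule_format]) (use assms(2) that in auto)
    ultimately show ?thesis
    proof eventually_elim
      case (elim \<omega>)
      have "(\<Sum>j=1..p. \<alpha> j t * (X (t - int j) \<omega>)\<^sup>2) = (\<Sum>j=1..p. \<alpha> j t * Y (t - int j) \<omega>)"
        using elim(1) by (intro sum.cong) auto
      moreover have "Y t \<omega> = (X t \<omega>)\<^sup>2" using bspec[OF elim(1), of 0] by simp
      ultimately show ?case
        using elim(2) by (simp add: arch_step_def power_mult_distrib mult.commute)
    qed
  qed
  moreover have "\<exists>K. \<forall>t\<le>T. prob {\<omega> \<in> space M. Y t \<omega> > K} \<le> \<eta>" if \<eta>: "0 < \<eta>" for \<eta>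
  proof -
    obtain K where K: "\<And>t. t \<le> T \<Longrightarrow> prob {\<omega> \<in> space M. (X t \<omega>)\<^sup>2 > K} \<le> \<eta>" using tight[OF \<eta>] by blast
    have "prob {\<omega> \<in> space M. Y t \<omega> > K} = prob {\<omega> \<in> space M. (X t \<omega>)\<^sup>2 > K}" if t: "t \<le> T" for t
    proof (rule finite_measure_eq_AE)
      show "AE \<omega> in M. (\<omega> \<in> {\<omega> \<in> space M. Y t \<omega> > K}) = (\<omega> \<in> {\<omega> \<in> space M. (X t \<omega>)\<^sup>2 > K})"
        using YX[OF t] by eventually_elim simp
    qed (use Xm[OF t] measurable_sig_M[OF Ym[OF t]] in measurable)
    then show ?thesis using K by (intro exI[of _ K]) simp
  qed
  ultimately have "tight_solution \<alpha> T Y"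
    using Ym by (simp add: tight_solution_def Y_def)
  then show ?thesis using Xm YX unfolding square_solution_def by blast
qed

lemma square_solution_l2:
  assumes "admissible \<alpha> T" "square_solution \<alpha> T X" "t \<le> T"
  shows "sq_int (\<lambda>\<omega>. (X t \<omega>)\<^sup>2)" and "l2norm (\<lambda>\<omega>. (X t \<omega>)\<^sup>2) \<le> l2bound"
proof -
  obtain Y where Y: "tight_solution \<alpha> T Y" "X t \<in> borel_measurable M" "AE \<omega> in M. (X t \<omega>)\<^sup>2 = Y t \<omega>"
    using assms unfolding square_solution_def by blast
  have "(\<lambda>\<omega>. (X t \<omega>)\<^sup>2) \<in> borel_measurable M" using Y(2) by simp
  note * = sq_int_AE_cong[OF solution_l2(1)[OF assms(1) Y(1) assms(3)] this Y(3)]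
  show "sq_int (\<lambda>\<omega>. (X t \<omega>)\<^sup>2)" by (rule *)
  show "l2norm (\<lambda>\<omega>. (X t \<omega>)\<^sup>2) \<le> l2bound"
    unfolding *(2) by (rule solution_l2(2)[OF assms(1) Y(1) assms(3)])
qed

lemma square_solution_comparison:
  assumes adm: "admissible \<alpha> T" "admissible \<alpha>' T"
    and sol: "square_solution \<alpha> T X" "square_solution \<alpha>' T X'"
    and t: "t \<le> T" and \<eta>: "0 \<le> \<eta>"
    and close: "\<And>j s. j \<le> p \<Longrightarrow> s \<le> t \<Longrightarrow> t - int (p * n) \<le> s \<Longrightarrow> \<bar>\<alpha> j s - \<alpha>' j s\<bar> \<le> \<eta>"
  shows "l2norm (\<lambda>\<omega>. (X t \<omega>)\<^sup>2 - (X' t \<omega>)\<^sup>2)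
      \<le> \<kappa> * \<eta> * (1 + real p * l2bound) / \<delta> + (1 - \<delta>) ^ n * (2 * l2bound)"
proof -
  obtain Y where Y: "tight_solution \<alpha> T Y" "X t \<in> borel_measurable M" "AE \<omega> in M. (X t \<omega>)\<^sup>2 = Y t \<omega>"
    using sol(1) t unfolding square_solution_def by blast
  obtain Y' where Y': "tight_solution \<alpha>' T Y'" "X' t \<in> borel_measurable M" "AE \<omega> in M. (X' t \<omega>)\<^sup>2 = Y' t \<omega>"
    using sol(2) t unfolding square_solution_def by blast
  have sq: "sq_int (\<lambda>\<omega>. Y t \<omega> - Y' t \<omega>)"
    by (intro sq_int_diff solution_l2(1)[OF adm(1) Y(1) t] solution_l2(1)[OF adm(2) Y'(1) t])
  have m: "(\<lambda>\<omega>. (X t \<omega>)\<^sup>2 - (X' t \<omega>)\<^sup>2) \<in> borel_measurable M" using Y(2) Y'(2) by simp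
  have "AE \<omega> in M. (X t \<omega>)\<^sup>2 - (X' t \<omega>)\<^sup>2 = Y t \<omega> - Y' t \<omega>" using Y(3) Y'(3) by eventually_elim simp
  note * = sq_int_AE_cong(2)[OF sq m this]
  show ?thesis unfolding * by (rule solution_comparison[OF adm Y(1) Y'(1) t \<eta> close])
qed

text \<open>The approximant depends on the coefficients and the time alone, while range and bound
  depend on neither. Both weak laws draw on it with the same constants for every row.\<close>

lemma square_solution_approximation:
  assumes "0 < \<epsilon>"
  obtains y :: "(nat \<Rightarrow> int \<Rightarrow> real) \<Rightarrow> int \<Rightarrow> 'a \<Rightarrow> real" and B :: real and d :: nat
  where "\<And>\<alpha> t. y \<alpha> t \<in> borel_measurable (sig {t - int d..t})" and "0 \<le> B"
    and "\<And>\<alpha> T t \<omega>. admissible \<alpha> T \<Longrightarrow> t \<le> T \<Longrightarrow> \<bar>y \<alpha> t \<omega>\<bar> \<le> B"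
    and "\<And>\<alpha> T X t. admissible \<alpha> T \<Longrightarrow> square_solution \<alpha> T X \<Longrightarrow> t \<le> T \<Longrightarrow>
        l2norm (\<lambda>\<omega>. (X t \<omega>)\<^sup>2 - y \<alpha> t \<omega>) \<le> \<epsilon>"
proof -
  obtain K n where K: "0 \<le> K" and approx: "\<And>\<alpha> T Y t. admissible \<alpha> T \<Longrightarrow> tight_solution \<alpha> T Y \<Longrightarrow> t \<le> T \<Longrightarrow>
      l2norm (\<lambda>\<omega>. Y t \<omega> - iterate (truncated_W K) \<alpha> n t \<omega>) \<le> \<epsilon>"
    using solution_truncated_approximation[OF assms] by blast
  let ?y = "\<lambda>\<alpha>. iterate (truncated_W K) \<alpha> n"
  have "0 \<le> truncated_W K t \<omega>" "truncated_W K t \<omega> \<le> K" for t \<omega>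
    using K by (auto simp: truncated_W_def)
  then obtain B where B: "0 \<le> B" "\<And>\<alpha> T t \<omega>. admissible \<alpha> T \<Longrightarrow> t \<le> T \<Longrightarrow> 0 \<le> ?y \<alpha> t \<omega> \<and> ?y \<alpha> t \<omega> \<le> B"
    using iterate_bounded[of "truncated_W K" K n] K by blast
  have ym: "?y \<alpha> t \<in> borel_measurable (sig {t - int (p * n)..t})" for \<alpha> t
    by (intro iterate_measurable truncated_W_measurable)
  have close: "l2norm (\<lambda>\<omega>. (X t \<omega>)\<^sup>2 - ?y \<alpha> t \<omega>) \<le> \<epsilon>"
    if adm: "admissible \<alpha> T" and sol: "square_solution \<alpha> T X" and t: "t \<le> T" for \<alpha> T X t
  proof -
    obtain Y where Y: "tight_solution \<alpha> T Y" "X t \<in> borel_measurable M" "AE \<omega> in M. (X t \<omega>)\<^sup>2 = Y t \<omega>"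
      using sol t unfolding square_solution_def by blast
    have yM: "?y \<alpha> t \<in> borel_measurable M" by (rule measurable_sig_M[OF ym])
    have "\<bar>?y \<alpha> t \<omega>\<bar> \<le> B" for \<omega> using B(2)[OF adm t, of \<omega>] by linarith
    then have sq: "sq_int (\<lambda>\<omega>. Y t \<omega> - ?y \<alpha> t \<omega>)"
      by (intro sq_int_diff solution_l2(1)[OF adm Y(1) t] sq_int_bounded[OF yM])
    have m: "(\<lambda>\<omega>. (X t \<omega>)\<^sup>2 - ?y \<alpha> t \<omega>) \<in> borel_measurable M" using Y(2) yM by simp
    have "AE \<omega> in M. (X t \<omega>)\<^sup>2 - ?y \<alpha> t \<omega> = Y t \<omega> - ?y \<alpha> t \<omega>" using Y(3) by eventually_elim simp
    then show ?thesis using sq_int_AE_cong(2)[OF sq m] approx[OF adm Y(1) t] by simp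
  qed
  show thesis
  proof (rule that[of ?y "p * n" B])
    show "\<bar>?y \<alpha> t \<omega>\<bar> \<le> B" if "admissible \<alpha> T" "t \<le> T" for \<alpha> T t \<omega>
      using B(2)[OF that, of \<omega>] by linarith
  qed (use ym B close in auto)
qed

lemma indep_integral_mult:
  assumes "f \<in> borel_measurable (sig I)" "g \<in> borel_measurable (sig J)" "I \<inter> J = {}"
    and "integrable M f" "integrable M g"
  shows "(\<integral>\<omega>. f \<omega> * g \<omega> \<partial>M) = (\<integral>\<omega>. f \<omega> \<partial>M) * (\<integral>\<omega>. (g \<omega> :: real) \<partial>M)"
  by (rule indep_var_lebesgue_integral[OF indep_sig[OF assms(1-3)] assms(4,5)])

section \<open>Weak laws for the rows of the array\<close>

context
  fixes \<alpha> :: "nat \<Rightarrow> nat \<Rightarrow> int \<Rightarrow> real" and X :: "nat \<Rightarrow> int \<Rightarrow> 'a \<Rightarrow> real" and h :: nat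
  assumes adm: "\<And>N. 1 \<le> N \<Longrightarrow> admissible (\<alpha> N) (int N)"
    and sol: "\<And>N. 1 \<le> N \<Longrightarrow> square_solution (\<alpha> N) (int N) (X N)"
begin

lemma row_l2:
  assumes "1 \<le> N" "t \<le> int N"
  shows "sq_int (\<lambda>\<omega>. (X N t \<omega>)\<^sup>2)" and "l2norm (\<lambda>\<omega>. (X N t \<omega>)\<^sup>2) \<le> l2bound"
  using square_solution_l2[OF adm[OF assms(1)] sol[OF assms(1)] assms(2)] by auto

text \<open>An approximant at time t uses the innovations from t - d to t, so approximants more than
  \<open>d\<close> apart are independent.\<close>

lemma sample_mean_law:
  "(\<lambda>N. \<integral>\<omega>. \<bar>(\<Sum>t=1..int N - int h. (X N t \<omega>)\<^sup>2) / (real N - real h)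
      - (\<Sum>t=1..int N - int h. \<integral>\<omega>. (X N t \<omega>)\<^sup>2 \<partial>M) / (real N - real h)\<bar> \<partial>M) \<longlonglongrightarrow> 0"
proof (rule weak_law_approx_dependent)
  fix N t assume "t \<in> {1..int N - int h}"
  then show "integrable M (\<lambda>\<omega>. (X N t \<omega>)\<^sup>2)" by (intro sq_int_integrable row_l2) auto
next
  fix \<epsilon> :: real assume "0 < \<epsilon>"
  then obtain y B d where ym: "\<And>\<alpha> t. y \<alpha> t \<in> borel_measurable (sig {t - int d..t})" and B0: "0 \<le> B"
    and yB: "\<And>\<alpha> T t \<omega>. admissible \<alpha> T \<Longrightarrow> t \<le> T \<Longrightarrow> \<bar>y \<alpha> t \<omega>\<bar> \<le> B"
    and close: "\<And>\<alpha> T X t. admissible \<alpha> T \<Longrightarrow> square_solution \<alpha> T X \<Longrightarrow> t \<le> T \<Longrightarrow>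
        l2norm (\<lambda>\<omega>. (X t \<omega>)\<^sup>2 - y \<alpha> t \<omega>) \<le> \<epsilon>"
    by (rule square_solution_approximation) blast
  have row: "y (\<alpha> N) t \<in> borel_measurable M \<and> (\<forall>\<omega>. \<bar>y (\<alpha> N) t \<omega>\<bar> \<le> B) \<and>
      (\<integral>\<omega>. \<bar>(X N t \<omega>)\<^sup>2 - y (\<alpha> N) t \<omega>\<bar> \<partial>M) \<le> \<epsilon> \<and>
      (\<forall>s\<in>{1..int N - int h}. int d < \<bar>s - t\<bar> \<longrightarrow>
        (\<integral>\<omega>. y (\<alpha> N) s \<omega> * y (\<alpha> N) t \<omega> \<partial>M) = (\<integral>\<omega>. y (\<alpha> N) s \<omega> \<partial>M) * (\<integral>\<omega>. y (\<alpha> N) t \<omega> \<partial>M))"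
    if t: "t \<in> {1..int N - int h}" for N t
  proof -
    have N: "1 \<le> N" "t \<le> int N" using t by auto
    have yM: "y (\<alpha> N) s \<in> borel_measurable M" for s by (rule measurable_sig_M[OF ym])
    have ysq: "sq_int (y (\<alpha> N) s)" if "s \<le> int N" for s
      by (rule sq_int_bounded[OF yM yB[OF adm[OF N(1)] that]])
    have "(\<integral>\<omega>. \<bar>(X N t \<omega>)\<^sup>2 - y (\<alpha> N) t \<omega>\<bar> \<partial>M) \<le> \<epsilon>"
      using l1_le_l2norm[OF sq_int_diff[OF row_l2(1)[OF N] ysq[OF N(2)]]]
        close[OF adm[OF N(1)] sol[OF N(1)] N(2)] by linarith
    moreover have "(\<integral>\<omega>. y (\<alpha> N) s \<omega> * y (\<alpha> N) t \<omega> \<partial>M) = (\<integral>\<omega>. y (\<alpha> N) s \<omega> \<partial>M) * (\<integral>\<omega>. y (\<alpha> N) t \<omega> \<partial>M)"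
      if "s \<in> {1..int N - int h}" "int d < \<bar>s - t\<bar>" for s
      using that N by (intro indep_integral_mult[OF ym ym] sq_int_integrable ysq) auto
    ultimately show ?thesis using yM yB[OF adm[OF N(1)] N(2)] by blast
  qed
  show "\<exists>V' B d. \<forall>N. \<forall>t\<in>{1..int N - int h}.
        V' N t \<in> borel_measurable M \<and> (\<forall>\<omega>. \<bar>V' N t \<omega>\<bar> \<le> B) \<and> (\<integral>\<omega>. \<bar>(X N t \<omega>)\<^sup>2 - V' N t \<omega>\<bar> \<partial>M) \<le> \<epsilon> \<and>
        (\<forall>s\<in>{1..int N - int h}. int d < \<bar>s - t\<bar> \<longrightarrow>
          (\<integral>\<omega>. V' N s \<omega> * V' N t \<omega> \<partial>M) = (\<integral>\<omega>. V' N s \<omega> \<partial>M) * (\<integral>\<omega>. V' N t \<omega> \<partial>M))"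
    using row by (intro exI[of _ "\<lambda>N. y (\<alpha> N)"] exI[of _ B] exI[of _ d]) blast
qed

text \<open>The product of approximants at t and t + h uses the innovations from t - d to t + h,
  which lengthens the range of dependence to \<open>d + h\<close>.\<close>

lemma sample_product_law:
  "(\<lambda>N. \<integral>\<omega>. \<bar>(\<Sum>t=1..int N - int h. (X N t \<omega>)\<^sup>2 * (X N (t + int h) \<omega>)\<^sup>2) / (real N - real h)
      - (\<Sum>t=1..int N - int h. \<integral>\<omega>. (X N t \<omega>)\<^sup>2 * (X N (t + int h) \<omega>)\<^sup>2 \<partial>M) / (real N - real h)\<bar> \<partial>M) \<longlonglongrightarrow> 0"
proof (rule weak_law_approx_dependent)
  fix N t assume "t \<in> {1..int N - int h}"
  then show "integrable M (\<lambda>\<omega>. (X N t \<omega>)\<^sup>2 * (X N (t + int h) \<omega>)\<^sup>2)"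
    by (intro sq_int_mult_integrable row_l2) auto
next
  fix \<epsilon> :: real assume \<epsilon>: "0 < \<epsilon>"
  \<comment> \<open>An error \<open>e\<close> in each factor gives at most e l2bound + (l2bound + e)
    e = e (2 l2bound + e) for the product. The cap at 1 makes this at most e (2 l2bound +
    1).\<close>
  define e where "e = min 1 (\<epsilon> / (2 * l2bound + 1))"
  have L: "0 < 2 * l2bound + 1" using l2bound_nonneg by linarith
  have e: "0 < e" using \<epsilon> L by (simp add: e_def)
  have e1: "e \<le> 1" by (simp add: e_def)
  have "e \<le> \<epsilon> / (2 * l2bound + 1)" unfolding e_def by (rule min.cobounded2)
  then have e2: "e * (2 * l2bound + 1) \<le> \<epsilon>" using L by (simp only: pos_le_divide_eq)
  obtain y B d where ym: "\<And>\<alpha> t. y \<alpha> t \<in> borel_measurable (sig {t - int d..t})" and B0: "0 \<le> B"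
    and yB: "\<And>\<alpha> T t \<omega>. admissible \<alpha> T \<Longrightarrow> t \<le> T \<Longrightarrow> \<bar>y \<alpha> t \<omega>\<bar> \<le> B"
    and close: "\<And>\<alpha> T X t. admissible \<alpha> T \<Longrightarrow> square_solution \<alpha> T X \<Longrightarrow> t \<le> T \<Longrightarrow>
        l2norm (\<lambda>\<omega>. (X t \<omega>)\<^sup>2 - y \<alpha> t \<omega>) \<le> e"
    by (rule square_solution_approximation[OF e]) blast
  let ?v = "\<lambda>N t \<omega>. y (\<alpha> N) t \<omega> * y (\<alpha> N) (t + int h) \<omega>"
  have row: "?v N t \<in> borel_measurable M \<and> (\<forall>\<omega>. \<bar>?v N t \<omega>\<bar> \<le> B * B) \<and>
      (\<integral>\<omega>. \<bar>(X N t \<omega>)\<^sup>2 * (X N (t + int h) \<omega>)\<^sup>2 - ?v N t \<omega>\<bar> \<partial>M) \<le> \<epsilon> \<and>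
      (\<forall>s\<in>{1..int N - int h}. int (d + h) < \<bar>s - t\<bar> \<longrightarrow>
        (\<integral>\<omega>. ?v N s \<omega> * ?v N t \<omega> \<partial>M) = (\<integral>\<omega>. ?v N s \<omega> \<partial>M) * (\<integral>\<omega>. ?v N t \<omega> \<partial>M))"
    if t: "t \<in> {1..int N - int h}" for N t
  proof -
    have N: "1 \<le> N" "t \<le> int N" "t + int h \<le> int N" using t by auto
    have yM: "y (\<alpha> N) s \<in> borel_measurable M" for s by (rule measurable_sig_M[OF ym])
    note yB' = yB[OF adm[OF N(1)]]
    have ysq: "sq_int (y (\<alpha> N) s)" if "s \<le> int N" for s
      by (rule sq_int_bounded[OF yM yB'[OF that]])
    have vM: "?v N t \<in> borel_measurable M" using yM by (intro borel_measurable_times)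
    have vB: "\<bar>?v N t \<omega>\<bar> \<le> B * B" for \<omega>
      using yB'[OF N(2)] yB'[OF N(3)] B0 by (auto simp: abs_mult intro!: mult_mono)
    have yn: "l2norm (y (\<alpha> N) t) \<le> l2bound + e"
    proof -
      have "l2norm (y (\<alpha> N) t) = l2norm (\<lambda>\<omega>. (X N t \<omega>)\<^sup>2 - ((X N t \<omega>)\<^sup>2 - y (\<alpha> N) t \<omega>))" by simp
      also have "\<dots> \<le> l2norm (\<lambda>\<omega>. (X N t \<omega>)\<^sup>2) + l2norm (\<lambda>\<omega>. (X N t \<omega>)\<^sup>2 - y (\<alpha> N) t \<omega>)"
        by (intro l2norm_diff sq_int_diff row_l2 ysq N)
      also have "\<dots> \<le> l2bound + e"
        by (intro add_mono row_l2 N close[OF adm[OF N(1)] sol[OF N(1)]])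
      finally show ?thesis .
    qed
    have "(\<integral>\<omega>. \<bar>(X N t \<omega>)\<^sup>2 * (X N (t + int h) \<omega>)\<^sup>2 - ?v N t \<omega>\<bar> \<partial>M)
        \<le> l2norm (\<lambda>\<omega>. (X N t \<omega>)\<^sup>2 - y (\<alpha> N) t \<omega>) * l2norm (\<lambda>\<omega>. (X N (t + int h) \<omega>)\<^sup>2)
          + l2norm (y (\<alpha> N) t) * l2norm (\<lambda>\<omega>. (X N (t + int h) \<omega>)\<^sup>2 - y (\<alpha> N) (t + int h) \<omega>)"
      by (intro product_l1_diff row_l2 ysq N)
    also have "\<dots> \<le> e * l2bound + (l2bound + e) * e"
      using e l2bound_nonneg
      by (intro add_mono mult_mono row_l2 N close[OF adm[OF N(1)] sol[OF N(1)]] yn l2norm_nonneg) auto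
    also have "\<dots> = e * (2 * l2bound + e)" by (simp only: distrib_left distrib_right mult.commute mult_2 add.assoc)
    also have "\<dots> \<le> e * (2 * l2bound + 1)" using e e1 by (intro mult_left_mono add_left_mono) auto
    also have "\<dots> \<le> \<epsilon>" by (rule e2)
    finally have vclose: "(\<integral>\<omega>. \<bar>(X N t \<omega>)\<^sup>2 * (X N (t + int h) \<omega>)\<^sup>2 - ?v N t \<omega>\<bar> \<partial>M) \<le> \<epsilon>" .
    have vsig: "?v N s \<in> borel_measurable (sig {s - int d..s + int h})" for s
      by (intro borel_measurable_times measurable_sig_mono[OF ym]) auto
    have "(\<integral>\<omega>. ?v N s \<omega> * ?v N t \<omega> \<partial>M) = (\<integral>\<omega>. ?v N s \<omega> \<partial>M) * (\<integral>\<omega>. ?v N t \<omega> \<partial>M)"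
      if s: "s \<in> {1..int N - int h}" "int (d + h) < \<bar>s - t\<bar>" for s
    proof (rule indep_integral_mult[OF vsig vsig])
      show "{s - int d..s + int h} \<inter> {t - int d..t + int h} = {}" using s(2) by auto
      show "integrable M (?v N s)" "integrable M (?v N t)"
        using s N by (auto intro!: sq_int_mult_integrable ysq)
    qed
    then show ?thesis using vM vB vclose by blast
  qed
  show "\<exists>V' B d. \<forall>N. \<forall>t\<in>{1..int N - int h}.
        V' N t \<in> borel_measurable M \<and> (\<forall>\<omega>. \<bar>V' N t \<omega>\<bar> \<le> B) \<and>
        (\<integral>\<omega>. \<bar>(X N t \<omega>)\<^sup>2 * (X N (t + int h) \<omega>)\<^sup>2 - V' N t \<omega>\<bar> \<partial>M) \<le> \<epsilon> \<and>
        (\<forall>s\<in>{1..int N - int h}. int d < \<bar>s - t\<bar> \<longrightarrow>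
          (\<integral>\<omega>. V' N s \<omega> * V' N t \<omega> \<partial>M) = (\<integral>\<omega>. V' N s \<omega> \<partial>M) * (\<integral>\<omega>. V' N t \<omega> \<partial>M))"
    using row by (intro exI[of _ ?v] exI[of _ "B * B"] exI[of _ "d + h"]) blast
qed

text \<open>The closeness hypothesis is stated for every window size \<open>d\<close>, since the
  number of steps back grows as the accuracy \<open>r\<close> shrinks. The offset \<open>k\<close>
  allows comparison at the shifted time as well.\<close>

lemma local_stationary_limit:
  assumes \<alpha>': "\<And>T. admissible (\<lambda>j t. \<alpha>' j) T" and sol': "\<And>T. square_solution (\<lambda>j t. \<alpha>' j) T X'"
    and close: "\<And>d \<eta>. 0 < \<eta> \<Longrightarrow> \<forall>\<^sub>F N in sequentially. \<forall>s j. \<bar>s - \<tau> N\<bar> \<le> int d \<longrightarrow> j \<le> p \<longrightarrow>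
        s \<le> int N \<and> \<bar>\<alpha> N j s - \<alpha>' j\<bar> \<le> \<eta>"
  shows "(\<lambda>N. l2norm (\<lambda>\<omega>. (X N (\<tau> N + int k) \<omega>)\<^sup>2 - (X' (\<tau> N + int k) \<omega>)\<^sup>2)) \<longlonglongrightarrow> 0"
proof (rule LIMSEQ_I)
  fix r :: real assume r: "0 < r"
  have "(\<lambda>n. (1 - \<delta>) ^ n * (2 * l2bound)) \<longlonglongrightarrow> 0 * (2 * l2bound)"
    using \<delta>_pos \<delta>_less by (intro tendsto_intros LIMSEQ_power_zero) auto
  then have "\<forall>\<^sub>F n in sequentially. (1 - \<delta>) ^ n * (2 * l2bound) < r / 2"
    by (rule order_tendstoD) (use r in simp)
  then obtain n where n: "(1 - \<delta>) ^ n * (2 * l2bound) < r / 2"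
    using eventually_happens'[OF sequentially_bot] by blast
  define c where "c = \<kappa> * (1 + real p * l2bound) / \<delta>"
  have c: "0 < c"
    unfolding c_def using \<kappa>_ge_1 l2bound_nonneg \<delta>_pos
    by (intro divide_pos_pos mult_pos_pos add_pos_nonneg mult_nonneg_nonneg) auto
  \<comment> \<open>With this tolerance the coefficient term of the comparison bound equals r/2; the
    other half is left to the geometric term.\<close>
  define \<eta> where "\<eta> = r / (2 * c)"
  have \<eta>: "0 < \<eta>" using r c by (simp add: \<eta>_def)
  have c\<eta>: "\<kappa> * \<eta> * (1 + real p * l2bound) / \<delta> = r / 2"
  proof -
    have "\<kappa> * \<eta> * (1 + real p * l2bound) / \<delta> = c * \<eta>" by (simp add: c_def)
    also have "\<dots> = r / 2" using c by (simp add: \<eta>_def)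
    finally show ?thesis .
  qed
  have "\<forall>\<^sub>F N in sequentially. (\<forall>s j. \<bar>s - \<tau> N\<bar> \<le> int (p * n + k) \<longrightarrow> j \<le> p \<longrightarrow>
      s \<le> int N \<and> \<bar>\<alpha> N j s - \<alpha>' j\<bar> \<le> \<eta>) \<and> 1 \<le> N"
    by (intro eventually_conj close \<eta> eventually_ge_at_top)
  then obtain N0 where N0: "\<And>N s j. N0 \<le> N \<Longrightarrow> \<bar>s - \<tau> N\<bar> \<le> int (p * n + k) \<Longrightarrow> j \<le> p \<Longrightarrow>
      s \<le> int N \<and> \<bar>\<alpha> N j s - \<alpha>' j\<bar> \<le> \<eta>" and N1: "\<And>N. N0 \<le> N \<Longrightarrow> 1 \<le> N"
    unfolding eventually_sequentially by blast
  have "l2norm (\<lambda>\<omega>. (X N (\<tau> N + int k) \<omega>)\<^sup>2 - (X' (\<tau> N + int k) \<omega>)\<^sup>2) < r" if N: "N0 \<le> N" for N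
  proof -
    have win: "\<bar>s - \<tau> N\<bar> \<le> int (p * n + k)" if "s \<le> \<tau> N + int k" "\<tau> N + int k - int (p * n) \<le> s" for s
    proof -
      have "0 \<le> int (p * n)" by simp
      then show ?thesis using that unfolding of_nat_add by linarith
    qed
    have "l2norm (\<lambda>\<omega>. (X N (\<tau> N + int k) \<omega>)\<^sup>2 - (X' (\<tau> N + int k) \<omega>)\<^sup>2)
      \<le> \<kappa> * \<eta> * (1 + real p * l2bound) / \<delta> + (1 - \<delta>) ^ n * (2 * l2bound)"
    proof (rule square_solution_comparison[OF adm[OF N1[OF N]] \<alpha>' sol[OF N1[OF N]] sol'])
      show "\<tau> N + int k \<le> int N" using N0[OF N win, of "\<tau> N + int k" 0] by simp
      show "0 \<le> \<eta>" using \<eta> by simp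
      show "\<bar>\<alpha> N j s - \<alpha>' j\<bar> \<le> \<eta>" if "j \<le> p" "s \<le> \<tau> N + int k" "\<tau> N + int k - int (p * n) \<le> s" for j s
        using N0[OF N win[OF that(2,3)] that(1)] by blast
    qed
    then show ?thesis unfolding c\<eta> using n by linarith
  qed
  then show "\<exists>no. \<forall>N\<ge>no. norm (l2norm (\<lambda>\<omega>. (X N (\<tau> N + int k) \<omega>)\<^sup>2 - (X' (\<tau> N + int k) \<omega>)\<^sup>2) - 0) < r"
    by (intro exI[of _ N0]) simp
qed

end

end

section \<open>The limit functional and convergence in probability\<close>

text \<open>The closed triangle of the double integral touches the endpoints, where nothing is known
  about \<open>m\<close>. Changing a function at two points preserves measurability.\<close>

lemma measurable_extend_Ioo:
  fixes m :: "real \<Rightarrow> real"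
  assumes "set_integrable lborel {0<..<1} m"
  shows "(\<lambda>u. indicator {0..1} u * m u) \<in> borel_measurable borel"
proof -
  have [measurable]: "(\<lambda>u. indicator {0<..<1} u * m u) \<in> borel_measurable borel"
    using assms unfolding set_integrable_def by (auto dest!: borel_measurable_integrable)
  have "(\<lambda>u. indicator {0<..<1} u * m u + m 0 * indicator {0} u + m 1 * indicator {1} u) \<in> borel_measurable borel"
    by measurable
  also have "(\<lambda>u. indicator {0<..<1} u * m u + m 0 * indicator {0} u + m 1 * indicator {1} u) = (\<lambda>u. indicator {0..1} u * m u)"
    by (auto simp: fun_eq_iff indicator_def)
  finally show ?thesis .
qed

lemma lborel_pair_product_integral:
  fixes f g :: "real \<Rightarrow> real"
  assumes "integrable lborel f" "integrable lborel g"
  shows "integrable (lborel \<Otimes>\<^sub>M lborel) (\<lambda>z. f (fst z) * g (snd z))"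
    and "(\<integral>z. f (fst z) * g (snd z) \<partial>(lborel \<Otimes>\<^sub>M lborel)) = (\<integral>u. f u \<partial>lborel) * (\<integral>v. g v \<partial>lborel)"
proof -
  have [measurable]: "f \<in> borel_measurable borel" "g \<in> borel_measurable borel"
    using assms by auto
  show int: "integrable (lborel \<Otimes>\<^sub>M lborel) (\<lambda>z. f (fst z) * g (snd z))"
  proof (rule lborel_pair.Fubini_integrable)
    show "(\<lambda>z. f (fst z) * g (snd z)) \<in> borel_measurable (lborel \<Otimes>\<^sub>M lborel)" by measurable
    show "integrable lborel (\<lambda>x. \<integral>y. norm (f (fst (x, y)) * g (snd (x, y))) \<partial>lborel)"
      using assms by (simp add: abs_mult)
    show "AE x in lborel. integrable lborel (\<lambda>y. f (fst (x, y)) * g (snd (x, y)))"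
      using assms by simp
  qed
  have "(\<integral>z. f (fst z) * g (snd z) \<partial>(lborel \<Otimes>\<^sub>M lborel)) = (\<integral>u. \<integral>v. f u * g v \<partial>lborel \<partial>lborel)"
    using lborel_pair.integral_fst'[OF int] by simp
  then show "(\<integral>z. f (fst z) * g (snd z) \<partial>(lborel \<Otimes>\<^sub>M lborel)) = (\<integral>u. f u \<partial>lborel) * (\<integral>v. g v \<partial>lborel)"
    using assms by simp
qed

text \<open>Symmetrising over the two triangles turns the double integral into the variance of \<open>m\<close> under
  the uniform distribution.\<close>

lemma triangle_integral_eq_variance:
  fixes m :: "real \<Rightarrow> real"
  assumes int: "set_integrable lborel {0<..<1} m" and bound: "\<And>u. 0 < u \<Longrightarrow> u < 1 \<Longrightarrow> \<bar>m u\<bar> \<le> C"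
  shows "set_integrable lborel {0<..<1} (\<lambda>u. (m u)\<^sup>2)"
    and "(LINT (u, v):{(u, v). 0 \<le> u \<and> u < v \<and> v \<le> 1}|lborel. (m u - m v)\<^sup>2)
      = (LINT u:{0<..<1}|lborel. (m u)\<^sup>2) - (LINT u:{0<..<1}|lborel. m u)\<^sup>2"
proof -
  let ?P = "(lborel :: real measure) \<Otimes>\<^sub>M (lborel :: real measure)"
  let ?I = "indicator {0<..<1::real} :: real \<Rightarrow> real"
  \<comment> \<open>\<open>k\<close> carries the computation on the open square. \<open>e\<close>
    below is the cut-off to the closed interval that matches the stated domain; the two give the
    same integral.\<close>
  define k where "k u = ?I u * m u" for u
  define e where "e u = indicator {0..1} u * m u" for u
  have em [measurable]: "e \<in> borel_measurable borel" unfolding e_def[abs_def] by (rule measurable_extend_Ioo[OF int])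
  have ki: "integrable lborel k" using int by (simp add: set_integrable_def k_def[abs_def])
  have km [measurable]: "k \<in> borel_measurable borel" using ki by auto
  have Ii: "integrable lborel ?I" by (intro integrable_real_indicator) auto
  have k2i: "integrable lborel (\<lambda>u. (k u)\<^sup>2)"
  proof (rule Bochner_Integration.integrable_bound[OF integrable_mult_right[OF Ii, of "C\<^sup>2"]])
    have "(k u)\<^sup>2 \<le> C\<^sup>2 * ?I u" for u
    proof (cases "u \<in> {0<..<1}")
      case True
      then have "\<bar>m u\<bar> \<le> \<bar>C\<bar>" using bound[of u] by auto
      then show ?thesis using True by (simp add: k_def abs_le_square_iff)
    qed (simp add: k_def)
    then show "AE u in lborel. norm ((k u)\<^sup>2) \<le> norm (C\<^sup>2 * ?I u)" by simp
  qed simp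
  have k2: "(k u)\<^sup>2 = ?I u * (m u)\<^sup>2" for u by (simp add: k_def power_mult_distrib indicator_def)
  show "set_integrable lborel {0<..<1} (\<lambda>u. (m u)\<^sup>2)" using k2i by (simp add: set_integrable_def k2)
  define \<phi> where "\<phi> z = indicator {(u, v). 0 < u \<and> u < v \<and> v < 1} z * (k (fst z) - k (snd z))\<^sup>2" for z :: "real \<times> real"
  have T: "{(u, v). 0 < u \<and> u < v \<and> v < (1::real)} \<in> sets ?P"
  proof -
    have "{z \<in> space ?P. 0 < fst z \<and> fst z < snd z \<and> snd z < 1} \<in> sets ?P" by measurable
    then show ?thesis by (simp add: space_pair_measure case_prod_beta')
  qed
  have \<phi>m [measurable]: "\<phi> \<in> borel_measurable ?P"
    unfolding \<phi>_def[abs_def] using T by measurable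
  \<comment> \<open>The squared difference over the whole open square, expanded into products of
    functions of one variable so that each term factorises under Fubini. On the diagonal it
    vanishes, as does the sum over the two triangles.\<close>
  define \<psi> where "\<psi> z = (k (fst z))\<^sup>2 * ?I (snd z) + ?I (fst z) * (k (snd z))\<^sup>2 - 2 * (k (fst z) * k (snd z))" for z
  have \<psi>: "integrable ?P \<psi>"
    "integral\<^sup>L ?P \<psi> = 2 * ((\<integral>u. (k u)\<^sup>2 \<partial>lborel) - (\<integral>u. k u \<partial>lborel)\<^sup>2)"
  proof -
    note P = lborel_pair_product_integral[OF k2i Ii] lborel_pair_product_integral[OF Ii k2i]
      lborel_pair_product_integral[OF ki ki]
    show "integrable ?P \<psi>" unfolding \<psi>_def using P(1,3,5) by auto
    have "(\<integral>u. ?I u \<partial>lborel) = 1" by simp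
    then show "integral\<^sup>L ?P \<psi> = 2 * ((\<integral>u. (k u)\<^sup>2 \<partial>lborel) - (\<integral>u. k u \<partial>lborel)\<^sup>2)"
      unfolding \<psi>_def using P by (simp add: power2_eq_square)
  qed
  have \<phi>\<psi>: "\<phi> (u, v) + \<phi> (v, u) = \<psi> (u, v)" for u v
    by (auto simp: \<phi>_def \<psi>_def k_def indicator_def power2_eq_square algebra_simps)
  have \<phi>i: "integrable ?P \<phi>"
  proof (rule Bochner_Integration.integrable_bound[OF \<psi>(1) \<phi>m])
    have "\<bar>\<phi> z\<bar> \<le> \<bar>\<psi> z\<bar>" for z
    proof -
      have "0 \<le> \<phi> (fst z, snd z)" "0 \<le> \<phi> (snd z, fst z)" by (simp_all add: \<phi>_def)
      then show ?thesis using \<phi>\<psi>[of "fst z" "snd z"] by simp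
    qed
    then show "AE z in ?P. norm (\<phi> z) \<le> norm (\<psi> z)" by simp
  qed
  have sw: "integrable ?P (\<lambda>(u, v). \<phi> (v, u))" "(\<integral>(u, v). \<phi> (v, u) \<partial>?P) = integral\<^sup>L ?P \<phi>"
    using lborel_pair.integrable_product_swap[OF \<phi>i] lborel_pair.integral_product_swap[OF \<phi>m] by auto
  have "2 * integral\<^sup>L ?P \<phi> = integral\<^sup>L ?P \<phi> + (\<integral>(u, v). \<phi> (v, u) \<partial>?P)" using sw by simp
  also have "\<dots> = (\<integral>z. \<phi> z + (case z of (u, v) \<Rightarrow> \<phi> (v, u)) \<partial>?P)"
    by (intro Bochner_Integration.integral_add[symmetric] \<phi>i sw)
  also have "\<dots> = integral\<^sup>L ?P \<psi>"
    by (intro Bochner_Integration.integral_cong refl) (auto simp: \<phi>\<psi> split: prod.split)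
  finally have \<phi>I: "integral\<^sup>L ?P \<phi> = (\<integral>u. (k u)\<^sup>2 \<partial>lborel) - (\<integral>u. k u \<partial>lborel)\<^sup>2"
    using \<psi>(2) by simp
  define \<phi>' where "\<phi>' z = indicator {(u, v). 0 \<le> u \<and> u < v \<and> v \<le> 1} z * (e (fst z) - e (snd z))\<^sup>2" for z :: "real \<times> real"
  have T': "{(u, v). 0 \<le> u \<and> u < v \<and> v \<le> (1::real)} \<in> sets ?P"
  proof -
    have "{z \<in> space ?P. 0 \<le> fst z \<and> fst z < snd z \<and> snd z \<le> 1} \<in> sets ?P" by measurable
    then show ?thesis by (simp add: space_pair_measure case_prod_beta')
  qed
  have \<phi>'m [measurable]: "\<phi>' \<in> borel_measurable ?P"
    unfolding \<phi>'_def[abs_def] using T' by measurable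
  \<comment> \<open>Inside the closed triangle, leaving out the lines u = 0 and v = 1 already gives
    the open triangle, because u < v.\<close>
  have "AE z in ?P. fst z \<noteq> 0 \<and> snd z \<noteq> 1"
  proof (rule lborel_pair.AE_pair_measure)
    show "{z \<in> space ?P. fst z \<noteq> 0 \<and> snd z \<noteq> 1} \<in> sets ?P" by measurable
    have "AE u in lborel. u \<noteq> (0::real)" "AE v in lborel. v \<noteq> (1::real)" by (auto intro: AE_lborel_singleton)
    then show "AE u in lborel. AE v in lborel. fst (u, v) \<noteq> (0::real) \<and> snd (u, v) \<noteq> (1::real)"
      by (auto elim!: eventually_mono)
  qed
  then have "AE z in ?P. \<phi>' z = \<phi> z"
    by eventually_elim (auto simp: \<phi>_def \<phi>'_def k_def e_def indicator_def)
  then have "integral\<^sup>L ?P \<phi>' = integral\<^sup>L ?P \<phi>" by (intro integral_cong_AE) auto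
  moreover have "(LINT (u, v):{(u, v). 0 \<le> u \<and> u < v \<and> v \<le> 1}|lborel. (m u - m v)\<^sup>2) = integral\<^sup>L ?P \<phi>'"
    unfolding set_lebesgue_integral_def lborel_prod
    by (intro Bochner_Integration.integral_cong refl) (auto simp: \<phi>'_def e_def indicator_def)
  ultimately show "(LINT (u, v):{(u, v). 0 \<le> u \<and> u < v \<and> v \<le> 1}|lborel. (m u - m v)\<^sup>2)
      = (LINT u:{0<..<1}|lborel. (m u)\<^sup>2) - (LINT u:{0<..<1}|lborel. m u)\<^sup>2"
    using \<phi>I k2 by (simp add: set_lebesgue_integral_def k_def)
qed

text \<open>A uniformly continuous function on (0,1] extends to the closure. This ensures that
  \<open>Lim\<close> in the extension of the coefficients denotes an actual limit and not an
  unspecified value.\<close>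

lemma hoelder_right_limit:
  fixes f :: "real \<Rightarrow> real"
  assumes "0 < \<beta>" "0 < K" "\<And>u v. u \<in> {0<..1} \<Longrightarrow> v \<in> {0<..1} \<Longrightarrow> \<bar>f u - f v\<bar> \<le> K * \<bar>u - v\<bar> powr \<beta>"
  shows "(f \<longlongrightarrow> Lim (at_right 0) f) (at_right 0)"
proof -
  have "uniformly_continuous_on {0<..1} f"
    unfolding uniformly_continuous_on_def
  proof (intro allI impI)
    fix e :: real assume e: "0 < e"
    \<comment> \<open>The solution of K d^\<beta> = e.\<close>
    define d where "d = (e / K) powr (1 / \<beta>)"
    have d: "0 < d" using e assms by (simp add: d_def)
    have "dist (f v) (f u) < e" if "u \<in> {0<..1}" "v \<in> {0<..1}" "dist v u < d" for u v
    proof -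
      have "\<bar>v - u\<bar> powr \<beta> < d powr \<beta>"
        using that(3) assms(1) by (intro powr_less_mono2) (auto simp: dist_real_def)
      also have "d powr \<beta> = e / K" using e assms by (simp add: d_def powr_powr)
      finally have "K * \<bar>v - u\<bar> powr \<beta> < e" using assms(2) by (simp add: pos_less_divide_eq mult.commute)
      then show ?thesis using assms(3)[OF that(2,1)] by (simp add: dist_real_def)
    qed
    then show "\<exists>d>0. \<forall>x\<in>{0<..1}. \<forall>x'\<in>{0<..1}. dist x' x < d \<longrightarrow> dist (f x') (f x) < e"
      using d by blast
  qed
  then obtain l where "(f \<longlongrightarrow> l) (at 0 within {0<..1})"
    by (rule uniformly_continuous_on_extension_at_closure[where x = 0]) auto
  moreover have "at (0::real) within {0<..1} = at_right 0"
    by (rule at_within_nhd[of 0 "{..<1}"]) auto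
  ultimately have l: "(f \<longlongrightarrow> l) (at_right 0)" by simp
  then have "Lim (at_right 0) f = l" by (intro tendsto_Lim) auto
  then show ?thesis using l by simp
qed

section \<open>Convergence in probability and stationary moments\<close>

context prob_space begin

text \<open>Markov's inequality around the deterministic centre \<open>m N\<close>, once that centre
  is within \<epsilon>/2 of the limit.\<close>

lemma converges_in_prob_centered:
  assumes int: "\<And>N. integrable M (S N)" and l1: "(\<lambda>N. \<integral>\<omega>. \<bar>S N \<omega> - m N\<bar> \<partial>M) \<longlonglongrightarrow> 0"
    and m: "m \<longlonglongrightarrow> L"
  shows "converges_in_prob M S L"
  unfolding converges_in_prob_def
proof (intro allI impI)
  fix \<epsilon> :: real assume \<epsilon>: "0 < \<epsilon>"
  have "\<forall>\<^sub>F N in sequentially. dist (m N) L < \<epsilon> / 2" using m by (rule tendstoD) (use \<epsilon> in simp)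
  then have le: "\<forall>\<^sub>F N in sequentially. prob {\<omega> \<in> space M. \<bar>S N \<omega> - L\<bar> > \<epsilon>} \<le> (\<integral>\<omega>. \<bar>S N \<omega> - m N\<bar> \<partial>M) / (\<epsilon> / 2)"
  proof eventually_elim
    case (elim N)
    have [measurable]: "S N \<in> borel_measurable M" using int by auto
    have "prob {\<omega> \<in> space M. \<bar>S N \<omega> - L\<bar> > \<epsilon>} \<le> prob {\<omega> \<in> space M. \<bar>S N \<omega> - m N\<bar> \<ge> \<epsilon> / 2}"
    proof (rule finite_measure_mono)
      show "{\<omega> \<in> space M. \<bar>S N \<omega> - L\<bar> > \<epsilon>} \<subseteq> {\<omega> \<in> space M. \<bar>S N \<omega> - m N\<bar> \<ge> \<epsilon> / 2}"
      proof safe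
        fix \<omega> assume "\<epsilon> < \<bar>S N \<omega> - L\<bar>"
        then show "\<epsilon> / 2 \<le> \<bar>S N \<omega> - m N\<bar>" using elim unfolding dist_real_def by linarith
      qed
    qed measurable
    also have "\<dots> \<le> (\<integral>\<omega>. \<bar>S N \<omega> - m N\<bar> \<partial>M) / (\<epsilon> / 2)"
      by (rule integral_Markov_inequality_measure[where A = "{}"]) (use int \<epsilon> in auto)
    finally show ?case .
  qed
  have "(\<lambda>N. (\<integral>\<omega>. \<bar>S N \<omega> - m N\<bar> \<partial>M) / (\<epsilon> / 2)) \<longlonglongrightarrow> 0 / (\<epsilon> / 2)"
    using \<epsilon> by (intro tendsto_divide l1 tendsto_const) auto
  then have lim: "(\<lambda>N. (\<integral>\<omega>. \<bar>S N \<omega> - m N\<bar> \<partial>M) / (\<epsilon> / 2)) \<longlonglongrightarrow> 0" by simp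
  show "(\<lambda>N. prob {\<omega> \<in> space M. \<bar>S N \<omega> - L\<bar> > \<epsilon>}) \<longlonglongrightarrow> 0"
    by (rule tendsto_sandwich[OF _ le tendsto_const lim]) simp
qed

lemma converges_in_prob_diff_square:
  assumes m: "\<And>N. S N \<in> borel_measurable M" "\<And>N. R N \<in> borel_measurable M"
    and S: "converges_in_prob M S a" and R: "converges_in_prob M R b"
  shows "converges_in_prob M (\<lambda>N \<omega>. S N \<omega> - (R N \<omega>)\<^sup>2) (a - b\<^sup>2)"
  unfolding converges_in_prob_def
proof (intro allI impI)
  fix \<epsilon> :: real assume \<epsilon>: "0 < \<epsilon>"
  \<comment> \<open>If r is within 1 of b, then \<open>c\<close> bounds the sum r + b in the
    factorisation of the difference of squares; this is also why \<eta> is capped at 1.\<close>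
  define c where "c = 1 + 2 * \<bar>b\<bar>"
  have c: "0 < c" by (simp add: c_def)
  define \<eta> where "\<eta> = min 1 (\<epsilon> / (2 * c))"
  have \<eta>: "0 < \<eta>" "\<eta> \<le> 1" using \<epsilon> c by (auto simp: \<eta>_def)
  have "\<eta> \<le> \<epsilon> / (2 * c)" unfolding \<eta>_def by (rule min.cobounded2)
  then have \<eta>c: "\<eta> * c \<le> \<epsilon> / 2" using c by (simp add: field_simps)
  note [measurable] = m
  have le: "prob {\<omega> \<in> space M. \<bar>S N \<omega> - (R N \<omega>)\<^sup>2 - (a - b\<^sup>2)\<bar> > \<epsilon>}
      \<le> prob {\<omega> \<in> space M. \<bar>S N \<omega> - a\<bar> > \<epsilon> / 2} + prob {\<omega> \<in> space M. \<bar>R N \<omega> - b\<bar> > \<eta>}" for N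
  proof -
    have "prob {\<omega> \<in> space M. \<bar>S N \<omega> - (R N \<omega>)\<^sup>2 - (a - b\<^sup>2)\<bar> > \<epsilon>}
        \<le> prob ({\<omega> \<in> space M. \<bar>S N \<omega> - a\<bar> > \<epsilon> / 2} \<union> {\<omega> \<in> space M. \<bar>R N \<omega> - b\<bar> > \<eta>})"
    proof (rule finite_measure_mono)
      show "{\<omega> \<in> space M. \<bar>S N \<omega> - (R N \<omega>)\<^sup>2 - (a - b\<^sup>2)\<bar> > \<epsilon>}
        \<subseteq> {\<omega> \<in> space M. \<bar>S N \<omega> - a\<bar> > \<epsilon> / 2} \<union> {\<omega> \<in> space M. \<bar>R N \<omega> - b\<bar> > \<eta>}"
      proof (safe, rule ccontr)
        fix \<omega> assume big: "\<epsilon> < \<bar>S N \<omega> - (R N \<omega>)\<^sup>2 - (a - b\<^sup>2)\<bar>"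
          and "\<not> \<epsilon> / 2 < \<bar>S N \<omega> - a\<bar>" and close: "\<not> \<eta> < \<bar>R N \<omega> - b\<bar>"
        let ?r = "R N \<omega>"
        have "\<bar>?r + b\<bar> \<le> c" using close \<eta>(2) unfolding c_def by linarith
        then have "\<bar>?r - b\<bar> * \<bar>?r + b\<bar> \<le> \<eta> * c" using close \<eta>(1) by (intro mult_mono) auto
        moreover have "?r\<^sup>2 - b\<^sup>2 = (?r - b) * (?r + b)" by (simp add: power2_eq_square algebra_simps)
        ultimately have "\<bar>?r\<^sup>2 - b\<^sup>2\<bar> \<le> \<epsilon> / 2" using \<eta>c by (simp add: abs_mult)
        then show False using big \<open>\<not> \<epsilon> / 2 < \<bar>S N \<omega> - a\<bar>\<close> by linarith
      qed
    qed measurable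
    also have "\<dots> \<le> prob {\<omega> \<in> space M. \<bar>S N \<omega> - a\<bar> > \<epsilon> / 2} + prob {\<omega> \<in> space M. \<bar>R N \<omega> - b\<bar> > \<eta>}"
      by (rule measure_Un_le) measurable
    finally show ?thesis .
  qed
  have "(\<lambda>N. prob {\<omega> \<in> space M. \<bar>S N \<omega> - a\<bar> > \<epsilon> / 2} + prob {\<omega> \<in> space M. \<bar>R N \<omega> - b\<bar> > \<eta>}) \<longlonglongrightarrow> 0 + 0"
    using S[unfolded converges_in_prob_def, rule_format, of "\<epsilon> / 2"] R[unfolded converges_in_prob_def, rule_format, OF \<eta>(1)] \<epsilon>
    by (intro tendsto_add) simp_all
  then have lim: "(\<lambda>N. prob {\<omega> \<in> space M. \<bar>S N \<omega> - a\<bar> > \<epsilon> / 2} + prob {\<omega> \<in> space M. \<bar>R N \<omega> - b\<bar> > \<eta>}) \<longlonglongrightarrow> 0"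
    by simp
  show "(\<lambda>N. prob {\<omega> \<in> space M. \<bar>S N \<omega> - (R N \<omega>)\<^sup>2 - (a - b\<^sup>2)\<bar> > \<epsilon>}) \<longlonglongrightarrow> 0"
    by (rule tendsto_sandwich[OF _ _ tendsto_const lim]) (use le in auto)
qed

lemma stationary_expectation:
  fixes F :: "(int \<Rightarrow> real) \<Rightarrow> real"
  assumes stat: "strictly_stationary M Y" and F: "F \<in> borel_measurable (\<Pi>\<^sub>M t\<in>UNIV. borel)"
  shows "(\<integral>\<omega>. F (\<lambda>i. Y (i + k) \<omega>) \<partial>M) = (\<integral>\<omega>. F (\<lambda>i. Y i \<omega>) \<partial>M)"
proof -
  have Ym: "Y t \<in> borel_measurable M" for t using stat by (simp add: strictly_stationary_def)
  have path: "(\<lambda>\<omega> t. Y (t + k) \<omega>) \<in> measurable M (\<Pi>\<^sub>M t\<in>UNIV. borel)" for k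
    by (rule measurable_PiM_single') (use Ym in auto)
  have "(\<integral>\<omega>. F (\<lambda>i. Y (i + k) \<omega>) \<partial>M) = (\<integral>x. F x \<partial>distr M (\<Pi>\<^sub>M t\<in>UNIV. borel) (\<lambda>\<omega> t. Y (t + k) \<omega>))"
    by (rule integral_distr[OF path F, symmetric])
  also have "distr M (\<Pi>\<^sub>M t\<in>UNIV. borel) (\<lambda>\<omega> t. Y (t + k) \<omega>) = distr M (\<Pi>\<^sub>M t\<in>UNIV. borel) (\<lambda>\<omega> t. Y t \<omega>)"
    using stat by (simp add: strictly_stationary_def)
  also have "(\<integral>x. F x \<partial>distr M (\<Pi>\<^sub>M t\<in>UNIV. borel) (\<lambda>\<omega> t. Y t \<omega>)) = (\<integral>\<omega>. F (\<lambda>i. Y i \<omega>) \<partial>M)"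
    using path[of 0] F by (intro integral_distr) auto
  finally show ?thesis .
qed

lemma stationary_square_moments:
  assumes stat: "strictly_stationary M Y"
  shows "(\<integral>\<omega>. (Y t \<omega>)\<^sup>2 \<partial>M) = (\<integral>\<omega>. (Y s \<omega>)\<^sup>2 \<partial>M)"
    and "(\<integral>\<omega>. (Y t \<omega>)\<^sup>2 * (Y (t + h) \<omega>)\<^sup>2 \<partial>M) = (\<integral>\<omega>. (Y s \<omega>)\<^sup>2 * (Y (s + h) \<omega>)\<^sup>2 \<partial>M)"
proof -
  have 1: "(\<integral>\<omega>. (Y t \<omega>)\<^sup>2 \<partial>M) = (\<integral>\<omega>. (Y 0 \<omega>)\<^sup>2 \<partial>M)" for t
    using stationary_expectation[OF stat, of "\<lambda>x. (x 0)\<^sup>2" t] by simp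
  show "(\<integral>\<omega>. (Y t \<omega>)\<^sup>2 \<partial>M) = (\<integral>\<omega>. (Y s \<omega>)\<^sup>2 \<partial>M)" by (simp only: 1[of t] 1[of s])
  have 2: "(\<integral>\<omega>. (Y t \<omega>)\<^sup>2 * (Y (t + h) \<omega>)\<^sup>2 \<partial>M) = (\<integral>\<omega>. (Y 0 \<omega>)\<^sup>2 * (Y h \<omega>)\<^sup>2 \<partial>M)" for t
    using stationary_expectation[OF stat, of "\<lambda>x. (x 0)\<^sup>2 * (x h)\<^sup>2" t] by (simp add: add.commute)
  show "(\<integral>\<omega>. (Y t \<omega>)\<^sup>2 * (Y (t + h) \<omega>)\<^sup>2 \<partial>M) = (\<integral>\<omega>. (Y s \<omega>)\<^sup>2 * (Y (s + h) \<omega>)\<^sup>2 \<partial>M)"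
    by (simp only: 2[of t] 2[of s])
qed

text \<open>All one-dimensional laws agree, and a single real random variable is tight because the
  events beyond level n decrease to the empty set.\<close>

lemma stationary_square_tight:
  assumes stat: "strictly_stationary M Y" and \<eta>: "0 < \<eta>"
  shows "\<exists>K. \<forall>t. prob {\<omega> \<in> space M. (Y t \<omega>)\<^sup>2 > K} \<le> \<eta>"
proof -
  have [measurable]: "Y t \<in> borel_measurable M" for t using stat by (simp add: strictly_stationary_def)
  have shift: "prob {\<omega> \<in> space M. (Y t \<omega>)\<^sup>2 > K} = prob {\<omega> \<in> space M. (Y 0 \<omega>)\<^sup>2 > K}" for t K
  proof -
    have E: "(\<integral>\<omega>. indicat_real {r. r\<^sup>2 > K} (Y t \<omega>) \<partial>M) = prob {\<omega> \<in> space M. (Y t \<omega>)\<^sup>2 > K}" for t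
    proof -
      have "(\<integral>\<omega>. indicat_real {r. r\<^sup>2 > K} (Y t \<omega>) \<partial>M) = (\<integral>\<omega>. indicat_real {\<omega> \<in> space M. (Y t \<omega>)\<^sup>2 > K} \<omega> \<partial>M)"
        by (intro Bochner_Integration.integral_cong) (auto simp: indicator_def)
      then show ?thesis by simp
    qed
    have "(\<lambda>x. indicator {r. r\<^sup>2 > K} (x 0) :: real) \<in> borel_measurable (\<Pi>\<^sub>M t\<in>(UNIV::int set). (borel :: real measure))"
      by measurable
    from stationary_expectation[OF stat this, of t] show ?thesis by (simp add: E)
  qed
  have lim: "(\<lambda>n. prob {\<omega> \<in> space M. (Y 0 \<omega>)\<^sup>2 > real n}) \<longlonglongrightarrow> prob (\<Inter>n. {\<omega> \<in> space M. (Y 0 \<omega>)\<^sup>2 > real n})"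
    by (intro finite_Lim_measure_decseq) (auto simp: decseq_def intro: order_le_less_trans)
  have "\<exists>n. \<not> (Y 0 \<omega>)\<^sup>2 > real n" for \<omega>
    using real_arch_simple[of "(Y 0 \<omega>)\<^sup>2"] by (simp add: not_less)
  then have empty: "(\<Inter>n. {\<omega> \<in> space M. (Y 0 \<omega>)\<^sup>2 > real n}) = {}" by blast
  from lim have "(\<lambda>n. prob {\<omega> \<in> space M. (Y 0 \<omega>)\<^sup>2 > real n}) \<longlonglongrightarrow> 0" unfolding empty by simp
  then have "\<forall>\<^sub>F n in sequentially. prob {\<omega> \<in> space M. (Y 0 \<omega>)\<^sup>2 > real n} < \<eta>"
    using \<eta> by (rule order_tendstoD)
  then obtain n where "prob {\<omega> \<in> space M. (Y 0 \<omega>)\<^sup>2 > real n} < \<eta>"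
    using eventually_happens'[OF sequentially_bot] by blast
  then have "prob {\<omega> \<in> space M. (Y t \<omega>)\<^sup>2 > real n} \<le> \<eta>" for t
    using shift[of "real n" t] by linarith
  then show ?thesis by blast
qed

lemma bounded_second_moment_tight:
  fixes X :: "'i \<Rightarrow> 'a \<Rightarrow> real" and \<eta> :: real
  assumes "\<And>t. t \<in> I \<Longrightarrow> integrable M (\<lambda>\<omega>. (X t \<omega>)\<^sup>2)" "\<And>t. t \<in> I \<Longrightarrow> (\<integral>\<omega>. (X t \<omega>)\<^sup>2 \<partial>M) \<le> C"
    and \<eta>: "0 < \<eta>"
  shows "\<exists>K. \<forall>t\<in>I. prob {\<omega> \<in> space M. (X t \<omega>)\<^sup>2 > K} \<le> \<eta>"
proof -
  \<comment> \<open>Markov's inequality with this level gives exactly \<eta>. The absolute value and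
    the added 1 make the level positive whatever the sign of \<open>C\<close>.\<close>
  define K where "K = (\<bar>C\<bar> + 1) / \<eta>"
  have K: "0 < K" using \<eta> by (simp add: K_def)
  have "prob {\<omega> \<in> space M. (X t \<omega>)\<^sup>2 > K} \<le> \<eta>" if t: "t \<in> I" for t
  proof -
    have [measurable]: "(\<lambda>\<omega>. (X t \<omega>)\<^sup>2) \<in> borel_measurable M" using assms(1)[OF t] by auto
    have "prob {\<omega> \<in> space M. (X t \<omega>)\<^sup>2 > K} \<le> prob {\<omega> \<in> space M. (X t \<omega>)\<^sup>2 \<ge> K}"
      by (intro finite_measure_mono) auto
    also have "\<dots> \<le> (\<integral>\<omega>. (X t \<omega>)\<^sup>2 \<partial>M) / K"
      by (rule integral_Markov_inequality_measure[where A = "{}"]) (use assms(1)[OF t] K in auto)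
    also have "\<dots> \<le> (\<bar>C\<bar> + 1) / K" using assms(2)[OF t] K by (intro divide_right_mono) auto
    also have "\<dots> = \<eta>" using \<eta> by (simp add: K_def field_simps)
    finally show ?thesis .
  qed
  then show ?thesis by blast
qed

end

section \<open>The sample autocovariance\<close>

context arch_model
begin

context
  fixes \<alpha> :: "nat \<Rightarrow> nat \<Rightarrow> int \<Rightarrow> real" and X :: "nat \<Rightarrow> int \<Rightarrow> 'a \<Rightarrow> real" and h :: nat
    and \<alpha>' :: "real \<Rightarrow> nat \<Rightarrow> real" and X' :: "real \<Rightarrow> int \<Rightarrow> 'a \<Rightarrow> real" and s :: int
  assumes adm: "\<And>N. 1 \<le> N \<Longrightarrow> admissible (\<alpha> N) (int N)"
    and sol: "\<And>N. 1 \<le> N \<Longrightarrow> square_solution (\<alpha> N) (int N) (X N)"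
    and h_pos: "0 < h"
    and adm': "\<And>u T. 0 < u \<Longrightarrow> u < 1 \<Longrightarrow> admissible (\<lambda>j t. \<alpha>' u j) T"
    and sol': "\<And>u T. 0 < u \<Longrightarrow> u < 1 \<Longrightarrow> square_solution (\<lambda>j t. \<alpha>' u j) T (X' u)"
    and stat: "\<And>u. 0 < u \<Longrightarrow> u < 1 \<Longrightarrow> strictly_stationary M (X' u)"
    and close: "\<And>u d \<eta>. 0 < u \<Longrightarrow> u < 1 \<Longrightarrow> 0 < \<eta> \<Longrightarrow>
        \<forall>\<^sub>F N in sequentially. \<forall>s j. \<bar>s - \<lceil>real N * u\<rceil>\<bar> \<le> int d \<longrightarrow> j \<le> p \<longrightarrow>
          s \<le> int N \<and> \<bar>\<alpha> N j s - \<alpha>' u j\<bar> \<le> \<eta>"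
begin

lemma stationary_l2:
  assumes "0 < u" "u < 1"
  shows "sq_int (\<lambda>\<omega>. (X' u t \<omega>)\<^sup>2)" and "l2norm (\<lambda>\<omega>. (X' u t \<omega>)\<^sup>2) \<le> l2bound"
  using square_solution_l2[OF adm' sol' order_refl] assms by auto

text \<open>Only the horizon part of \<open>close\<close> matters here: the window of size
  \<open>h\<close> contains the shifted time.\<close>

lemma eventually_inside:
  assumes "0 < u" "u < 1"
  shows "\<forall>\<^sub>F N in sequentially. 1 \<le> N \<and> \<lceil>real N * u\<rceil> + int h \<le> int N"
  using close[OF assms zero_less_one, of h] eventually_ge_at_top[of 1]
proof eventually_elim
  case (elim N)
  then show ?case using elim(1)[rule_format, of "\<lceil>real N * u\<rceil> + int h" 0] by auto
qed

lemma local_limit: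
  assumes "0 < u" "u < 1"
  shows "(\<lambda>N. l2norm (\<lambda>\<omega>. (X N (\<lceil>real N * u\<rceil> + int k) \<omega>)\<^sup>2 - (X' u (\<lceil>real N * u\<rceil> + int k) \<omega>)\<^sup>2)) \<longlonglongrightarrow> 0"
  by (rule local_stationary_limit[OF adm sol adm'[OF assms] sol'[OF assms] close[OF assms]])

text \<open>Stationarity moves the fixed time \<open>s\<close> to the moving time of the row. Both
  processes are then compared at the same time with the same innovations, where they are close in
  L^2.\<close>

lemma mean_limit:
  assumes u: "0 < u" "u < 1"
  shows "(\<lambda>N. \<integral>\<omega>. (X N \<lceil>real N * u\<rceil> \<omega>)\<^sup>2 \<partial>M) \<longlonglongrightarrow> (\<integral>\<omega>. (X' u s \<omega>)\<^sup>2 \<partial>M)"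
proof (rule LIM_zero_cancel, rule Lim_null_comparison)
  let ?\<tau> = "\<lambda>N. \<lceil>real N * u\<rceil>"
  show "(\<lambda>N. l2norm (\<lambda>\<omega>. (X N (?\<tau> N) \<omega>)\<^sup>2 - (X' u (?\<tau> N) \<omega>)\<^sup>2)) \<longlonglongrightarrow> 0"
    using local_limit[OF u, of 0] by simp
  show "\<forall>\<^sub>F N in sequentially. norm ((\<integral>\<omega>. (X N (?\<tau> N) \<omega>)\<^sup>2 \<partial>M) - (\<integral>\<omega>. (X' u s \<omega>)\<^sup>2 \<partial>M))
      \<le> l2norm (\<lambda>\<omega>. (X N (?\<tau> N) \<omega>)\<^sup>2 - (X' u (?\<tau> N) \<omega>)\<^sup>2)"
    using eventually_inside[OF u]
  proof eventually_elim
    case (elim N)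
    have sq: "sq_int (\<lambda>\<omega>. (X N (?\<tau> N) \<omega>)\<^sup>2)" using elim by (intro row_l2[OF adm sol]) auto
    note sq' = stationary_l2(1)[OF u, of "?\<tau> N"]
    have "(\<integral>\<omega>. (X N (?\<tau> N) \<omega>)\<^sup>2 \<partial>M) - (\<integral>\<omega>. (X' u s \<omega>)\<^sup>2 \<partial>M)
        = (\<integral>\<omega>. (X N (?\<tau> N) \<omega>)\<^sup>2 - (X' u (?\<tau> N) \<omega>)\<^sup>2 \<partial>M)"
      unfolding stationary_square_moments(1)[OF stat[OF u], of s "?\<tau> N"]
      by (intro Bochner_Integration.integral_diff[symmetric] sq_int_integrable sq sq')
    also have "norm \<dots> \<le> (\<integral>\<omega>. \<bar>(X N (?\<tau> N) \<omega>)\<^sup>2 - (X' u (?\<tau> N) \<omega>)\<^sup>2\<bar> \<partial>M)"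
      unfolding real_norm_def by (rule integral_abs_bound)
    also have "\<dots> \<le> l2norm (\<lambda>\<omega>. (X N (?\<tau> N) \<omega>)\<^sup>2 - (X' u (?\<tau> N) \<omega>)\<^sup>2)"
      by (intro l1_le_l2norm sq_int_diff sq sq')
    finally show ?case .
  qed
qed

text \<open>As for the mean, stationarity transports the pair of times. The two L^2 errors enter
  with the other factor held below \<open>l2bound\<close>.\<close>

lemma product_mean_limit:
  assumes u: "0 < u" "u < 1"
  shows "(\<lambda>N. \<integral>\<omega>. (X N \<lceil>real N * u\<rceil> \<omega>)\<^sup>2 * (X N (\<lceil>real N * u\<rceil> + int h) \<omega>)\<^sup>2 \<partial>M)
      \<longlonglongrightarrow> (\<integral>\<omega>. (X' u s \<omega>)\<^sup>2 * (X' u (s + int h) \<omega>)\<^sup>2 \<partial>M)"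
proof (rule LIM_zero_cancel, rule Lim_null_comparison)
  let ?\<tau> = "\<lambda>N. \<lceil>real N * u\<rceil>"
  let ?\<Delta> = "\<lambda>k N. l2norm (\<lambda>\<omega>. (X N (?\<tau> N + int k) \<omega>)\<^sup>2 - (X' u (?\<tau> N + int k) \<omega>)\<^sup>2)"
  have "(\<lambda>N. ?\<Delta> 0 N * l2bound + l2bound * ?\<Delta> h N) \<longlonglongrightarrow> 0 * l2bound + l2bound * 0"
    by (intro tendsto_intros local_limit u)
  then show "(\<lambda>N. ?\<Delta> 0 N * l2bound + l2bound * ?\<Delta> h N) \<longlonglongrightarrow> 0" by simp
  show "\<forall>\<^sub>F N in sequentially. norm ((\<integral>\<omega>. (X N (?\<tau> N) \<omega>)\<^sup>2 * (X N (?\<tau> N + int h) \<omega>)\<^sup>2 \<partial>M)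
      - (\<integral>\<omega>. (X' u s \<omega>)\<^sup>2 * (X' u (s + int h) \<omega>)\<^sup>2 \<partial>M)) \<le> ?\<Delta> 0 N * l2bound + l2bound * ?\<Delta> h N"
    using eventually_inside[OF u]
  proof eventually_elim
    case (elim N)
    have sq: "sq_int (\<lambda>\<omega>. (X N (?\<tau> N) \<omega>)\<^sup>2)" "sq_int (\<lambda>\<omega>. (X N (?\<tau> N + int h) \<omega>)\<^sup>2)"
      and n: "l2norm (\<lambda>\<omega>. (X N (?\<tau> N + int h) \<omega>)\<^sup>2) \<le> l2bound"
      using elim by (auto intro!: row_l2[OF adm sol])
    note sq' = stationary_l2[OF u]
    have eq: "(\<integral>\<omega>. (X N (?\<tau> N) \<omega>)\<^sup>2 * (X N (?\<tau> N + int h) \<omega>)\<^sup>2 \<partial>M)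
        - (\<integral>\<omega>. (X' u s \<omega>)\<^sup>2 * (X' u (s + int h) \<omega>)\<^sup>2 \<partial>M)
        = (\<integral>\<omega>. (X N (?\<tau> N) \<omega>)\<^sup>2 * (X N (?\<tau> N + int h) \<omega>)\<^sup>2
          - (X' u (?\<tau> N) \<omega>)\<^sup>2 * (X' u (?\<tau> N + int h) \<omega>)\<^sup>2 \<partial>M)"
      unfolding stationary_square_moments(2)[OF stat[OF u], of s "int h" "?\<tau> N"]
      by (intro Bochner_Integration.integral_diff[symmetric] sq_int_mult_integrable sq sq')
    have "norm (\<integral>\<omega>. (X N (?\<tau> N) \<omega>)\<^sup>2 * (X N (?\<tau> N + int h) \<omega>)\<^sup>2
          - (X' u (?\<tau> N) \<omega>)\<^sup>2 * (X' u (?\<tau> N + int h) \<omega>)\<^sup>2 \<partial>M) \<le> (\<integral>\<omega>. \<bar>(X N (?\<tau> N) \<omega>)\<^sup>2 * (X N (?\<tau> N + int h) \<omega>)\<^sup>2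
          - (X' u (?\<tau> N) \<omega>)\<^sup>2 * (X' u (?\<tau> N + int h) \<omega>)\<^sup>2\<bar> \<partial>M)"
      unfolding real_norm_def by (rule integral_abs_bound)
    also have "\<dots> \<le> l2norm (\<lambda>\<omega>. (X N (?\<tau> N) \<omega>)\<^sup>2 - (X' u (?\<tau> N) \<omega>)\<^sup>2) * l2norm (\<lambda>\<omega>. (X N (?\<tau> N + int h) \<omega>)\<^sup>2)
        + l2norm (\<lambda>\<omega>. (X' u (?\<tau> N) \<omega>)\<^sup>2) * ?\<Delta> h N"
      by (rule product_l1_diff[OF sq sq'(1) sq'(1)])
    also have "\<dots> \<le> ?\<Delta> 0 N * l2bound + l2bound * ?\<Delta> h N"
      unfolding of_nat_0 add_0_right
      by (rule add_mono[OF mult_left_mono[OF n l2norm_nonneg] mult_right_mono[OF sq'(2) l2norm_nonneg]])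
    finally show ?case unfolding eq .
  qed
qed

lemma row_mean_bound:
  assumes "t \<in> {1..int N - int h}"
  shows "\<bar>\<integral>\<omega>. (X N t \<omega>)\<^sup>2 \<partial>M\<bar> \<le> l2bound"
    and "\<bar>\<integral>\<omega>. (X N t \<omega>)\<^sup>2 * (X N (t + int h) \<omega>)\<^sup>2 \<partial>M\<bar> \<le> l2bound * l2bound"
proof -
  have sq: "sq_int (\<lambda>\<omega>. (X N t \<omega>)\<^sup>2)" "sq_int (\<lambda>\<omega>. (X N (t + int h) \<omega>)\<^sup>2)"
    and n: "l2norm (\<lambda>\<omega>. (X N t \<omega>)\<^sup>2) \<le> l2bound" "l2norm (\<lambda>\<omega>. (X N (t + int h) \<omega>)\<^sup>2) \<le> l2bound"
    using assms by (auto intro!: row_l2[OF adm sol])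
  show "\<bar>\<integral>\<omega>. (X N t \<omega>)\<^sup>2 \<partial>M\<bar> \<le> l2bound"
    using order_trans[OF integral_abs_bound l1_le_l2norm[OF sq(1)]] n(1) by (rule order_trans)
  have "\<bar>\<integral>\<omega>. (X N t \<omega>)\<^sup>2 * (X N (t + int h) \<omega>)\<^sup>2 \<partial>M\<bar> \<le> l2norm (\<lambda>\<omega>. (X N t \<omega>)\<^sup>2) * l2norm (\<lambda>\<omega>. (X N (t + int h) \<omega>)\<^sup>2)"
    by (rule order_trans[OF integral_abs_bound l2_Cauchy_Schwarz_abs[OF sq]])
  also have "\<dots> \<le> l2bound * l2bound" using n l2bound_nonneg by (intro mult_mono) auto
  finally show "\<bar>\<integral>\<omega>. (X N t \<omega>)\<^sup>2 * (X N (t + int h) \<omega>)\<^sup>2 \<partial>M\<bar> \<le> l2bound * l2bound" .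
qed

text \<open>The limit is kept in raw moments, since these are what the averages of squares and of
  their products converge to. Integrability in u accompanies the limits and is needed later to split
  the integral of the covariance.\<close>

lemma sample_autocov_limit:
  shows "set_integrable lborel {0<..<1} (\<lambda>u. \<integral>\<omega>. (X' u s \<omega>)\<^sup>2 \<partial>M)"
    and "set_integrable lborel {0<..<1} (\<lambda>u. \<integral>\<omega>. (X' u s \<omega>)\<^sup>2 * (X' u (s + int h) \<omega>)\<^sup>2 \<partial>M)"
    and "converges_in_prob M (\<lambda>N \<omega>. sample_autocov_sq (\<lambda>t. X N t \<omega>) N h)
      ((LINT u:{0<..<1}|lborel. (\<integral>\<omega>. (X' u s \<omega>)\<^sup>2 * (X' u (s + int h) \<omega>)\<^sup>2 \<partial>M))
        - (LINT u:{0<..<1}|lborel. (\<integral>\<omega>. (X' u s \<omega>)\<^sup>2 \<partial>M))\<^sup>2)"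
proof -
  have m: "\<bar>\<integral>\<omega>. (X N t \<omega>)\<^sup>2 \<partial>M\<bar> \<le> l2bound"
    and q: "\<bar>\<integral>\<omega>. (X N t \<omega>)\<^sup>2 * (X N (t + int h) \<omega>)\<^sup>2 \<partial>M\<bar> \<le> l2bound * l2bound"
    if "1 \<le> t" "t \<le> int N - int h" for N t using row_mean_bound that by auto
  note L1 = step_average_limit[where f = "\<lambda>N t. \<integral>\<omega>. (X N t \<omega>)\<^sup>2 \<partial>M"
      and G = "\<lambda>u. \<integral>\<omega>. (X' u s \<omega>)\<^sup>2 \<partial>M", OF h_pos m mean_limit]
  note L2 = step_average_limit[where f = "\<lambda>N t. \<integral>\<omega>. (X N t \<omega>)\<^sup>2 * (X N (t + int h) \<omega>)\<^sup>2 \<partial>M"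
      and G = "\<lambda>u. \<integral>\<omega>. (X' u s \<omega>)\<^sup>2 * (X' u (s + int h) \<omega>)\<^sup>2 \<partial>M", OF h_pos q product_mean_limit]
  show "set_integrable lborel {0<..<1} (\<lambda>u. \<integral>\<omega>. (X' u s \<omega>)\<^sup>2 \<partial>M)" by (rule L1(1))
  show "set_integrable lborel {0<..<1} (\<lambda>u. \<integral>\<omega>. (X' u s \<omega>)\<^sup>2 * (X' u (s + int h) \<omega>)\<^sup>2 \<partial>M)" by (rule L2(1))
  let ?R = "\<lambda>N \<omega>. (\<Sum>t=1..int N - int h. (X N t \<omega>)\<^sup>2) / (real N - real h)"
  let ?S = "\<lambda>N \<omega>. (\<Sum>t=1..int N - int h. (X N t \<omega>)\<^sup>2 * (X N (t + int h) \<omega>)\<^sup>2) / (real N - real h)"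
  have Ri: "integrable M (?R N)" for N
    by (intro integrable_divide_zero Bochner_Integration.integrable_sum sq_int_integrable row_l2[OF adm sol]) auto
  have Si: "integrable M (?S N)" for N
    by (intro integrable_divide_zero Bochner_Integration.integrable_sum sq_int_mult_integrable row_l2[OF adm sol]) auto
  have "converges_in_prob M (\<lambda>N \<omega>. ?S N \<omega> - (?R N \<omega>)\<^sup>2)
      ((LINT u:{0<..<1}|lborel. (\<integral>\<omega>. (X' u s \<omega>)\<^sup>2 * (X' u (s + int h) \<omega>)\<^sup>2 \<partial>M))
        - (LINT u:{0<..<1}|lborel. (\<integral>\<omega>. (X' u s \<omega>)\<^sup>2 \<partial>M))\<^sup>2)"
  proof (rule converges_in_prob_diff_square)
    show "?S N \<in> borel_measurable M" "?R N \<in> borel_measurable M" for N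
      using Si Ri by auto
    show "converges_in_prob M ?S (LINT u:{0<..<1}|lborel. (\<integral>\<omega>. (X' u s \<omega>)\<^sup>2 * (X' u (s + int h) \<omega>)\<^sup>2 \<partial>M))"
      by (rule converges_in_prob_centered[OF Si sample_product_law[OF adm sol] L2(2)])
    show "converges_in_prob M ?R (LINT u:{0<..<1}|lborel. (\<integral>\<omega>. (X' u s \<omega>)\<^sup>2 \<partial>M))"
      by (rule converges_in_prob_centered[OF Ri sample_mean_law[OF adm sol] L1(2)])
  qed
  then show "converges_in_prob M (\<lambda>N \<omega>. sample_autocov_sq (\<lambda>t. X N t \<omega>) N h)
      ((LINT u:{0<..<1}|lborel. (\<integral>\<omega>. (X' u s \<omega>)\<^sup>2 * (X' u (s + int h) \<omega>)\<^sup>2 \<partial>M))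
        - (LINT u:{0<..<1}|lborel. (\<integral>\<omega>. (X' u s \<omega>)\<^sup>2 \<partial>M))\<^sup>2)"
    by (simp add: sample_autocov_sq_def sample_mean_sq_def)
qed

end

end

section \<open>Passage from the model assumptions to the theorem\<close>

lemma extended_coefficients_close:
  fixes a :: "real \<Rightarrow> real"
  assumes "0 < \<beta>" "0 < K" and hoelder: "\<And>u v. u \<in> {0<..1} \<Longrightarrow> v \<in> {0<..1} \<Longrightarrow> \<bar>a u - a v\<bar> \<le> K * \<bar>u - v\<bar> powr \<beta>"
    and e: "0 < e" "e \<le> (\<eta> / K) powr (1 / \<beta>)" "0 < \<eta>" and u: "u \<in> {0<..1}" and v: "v \<in> {0<..1}" "\<bar>v - u\<bar> \<le> e"
  shows "\<bar>extend_by_right_limit a v - a u\<bar> \<le> \<eta>"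
proof -
  have "\<bar>v - u\<bar> powr \<beta> \<le> ((\<eta> / K) powr (1 / \<beta>)) powr \<beta>"
    using v(2) e assms(1) by (intro powr_mono2) auto
  also have "\<dots> = \<eta> / K" using assms by (simp add: powr_powr)
  finally have "K * \<bar>v - u\<bar> powr \<beta> \<le> \<eta>" using assms(2) by (simp add: pos_le_divide_eq mult.commute)
  then show ?thesis using hoelder[OF v(1) u] v(1) by (simp add: extend_by_right_limit_def)
qed

theorem proposition2:
  fixes M :: "'w measure"
    and Z :: "int \<Rightarrow> 'w \<Rightarrow> real"
    and p h :: nat
    and a :: "nat \<Rightarrow> real \<Rightarrow> real"
    and X :: "nat \<Rightarrow> int \<Rightarrow> 'w \<Rightarrow> real"
    and Xt :: "real \<Rightarrow> int \<Rightarrow> 'w \<Rightarrow> real"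
    and \<rho>\<^sub>1 \<rho>\<^sub>2 \<delta>\<^sub>0 \<beta> K\<^sub>0 \<zeta> \<delta> :: real
    and \<mu> c :: "real \<Rightarrow> real"
    and s :: int
  assumes "prob_space M"
    and "iid_standardized M Z"
    and "p \<ge> 1"
    and "\<And>j u. j \<le> p \<Longrightarrow> u \<in> {0<..1} \<Longrightarrow> a j u \<ge> 0"
    and "tvarch M Z p a X"
    and "\<And>u. u \<in> {0<..1} \<Longrightarrow> stationary_arch M Z p (\<lambda>j. a j u) (Xt u)"
    and "0 < \<rho>\<^sub>1" and "\<rho>\<^sub>1 \<le> \<rho>\<^sub>2" and "0 < \<delta>\<^sub>0" and "\<delta>\<^sub>0 < 1"
    and "\<And>u. u \<in> {0<..1} \<Longrightarrow> \<rho>\<^sub>1 \<le> a 0 u \<and> a 0 u \<le> \<rho>\<^sub>2"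
    and "bdd_above ((\<lambda>u. \<Sum>j=1..p. a j u) ` {0<..1})"
    and "(SUP u\<in>{0<..1}. \<Sum>j=1..p. a j u) \<le> 1 - \<delta>\<^sub>0"
    and "0 < \<beta>" and "\<beta> \<le> 1" and "0 < K\<^sub>0"
    and "\<And>j u v. j \<le> p \<Longrightarrow> u \<in> {0<..1} \<Longrightarrow> v \<in> {0<..1} \<Longrightarrow>
           \<bar>a j u - a j v\<bar> \<le> K\<^sub>0 * \<bar>u - v\<bar> powr \<beta>"
    and "0 < \<zeta>" and "\<zeta> \<le> 2" and "0 < \<delta>" and "\<delta> < 1"
    and "\<And>t. integrable M (\<lambda>\<omega>. \<bar>Z t \<omega>\<bar> powr (2 * (2 + \<zeta>)))"
    and "\<And>t. (\<integral>\<omega>. \<bar>Z t \<omega>\<bar> powr (2 * (2 + \<zeta>)) \<partial>M) powr (1 / (2 + \<zeta>))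
           * (SUP u\<in>{0<..1}. \<Sum>j=1..p. a j u) \<le> 1 - \<delta>"
    and "h > 0"
    and "\<And>u. \<mu> u = (\<integral>\<omega>. (Xt u s \<omega>)\<^sup>2 \<partial>M)"
    and "\<And>u. c u = covariance M (\<lambda>\<omega>. (Xt u s \<omega>)\<^sup>2) (\<lambda>\<omega>. (Xt u (s + int h) \<omega>)\<^sup>2)"
  shows "converges_in_prob M (\<lambda>N \<omega>. sample_autocov_sq (\<lambda>t. X N t \<omega>) N h)
           ((LBINT u=0..1. c u)
            + (LINT (u, v):{(u, v). 0 \<le> u \<and> u < v \<and> v \<le> 1}|lborel. (\<mu> u - \<mu> v)\<^sup>2))"
proof -
  note iid = assms(2)[unfolded iid_standardized_def]
  note a_nonneg = assms(4) and a0_le = assms(11)[THEN conjunct2] and hoelder = assms(17)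
  interpret prob_space M by fact
  interpret innovations M Z
    by unfold_locales (use iid in auto)
  \<comment> \<open>With the supremum as \<open>A\<close> and the moment at time 0 as
    \<open>\<kappa>\<close>, the moment hypothesis is exactly the contraction condition.\<close>
  define A where "A = (SUP u\<in>{0<..1}. \<Sum>j=1..p. a j u)"
  define \<kappa> where "\<kappa> = (\<integral>\<omega>. \<bar>Z 0 \<omega>\<bar> powr (2 * (2 + \<zeta>)) \<partial>M) powr (1 / (2 + \<zeta>))"
  have A_upper: "(\<Sum>j=1..p. a j u) \<le> A" if "u \<in> {0<..1}" for u
    unfolding A_def by (rule cSUP_upper[OF that assms(12)])
  have A_nonneg: "0 \<le> A"
  proof -
    have "0 \<le> (\<Sum>j=1..p. a j 1)" by (intro sum_nonneg a_nonneg) auto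
    then show ?thesis using A_upper[of 1] by simp
  qed
  have ident: "distr M borel (Z i) = distr M borel (Z j)" for i j using iid by blast
  have W_l2: "sq_int (\<lambda>\<omega>. (Z t \<omega>)\<^sup>2) \<and> l2norm (\<lambda>\<omega>. (Z t \<omega>)\<^sup>2) \<le> \<kappa>" for t
  proof -
    \<comment> \<open>Since 4 q = 2 (2 + \<zeta>), this power raises the fourth power of an
      innovation to the assumed moment. The outer exponent 1/q = 2/(2 + \<zeta>) then produces the
      square of \<open>\<kappa>\<close>.\<close>
    define q where "q = (2 + \<zeta>) / 2"
    have q: "1 < q" using assms(18) by (simp add: q_def)
    have pw: "(((Z t \<omega>)\<^sup>2)\<^sup>2) powr q = \<bar>Z t \<omega>\<bar> powr (2 * (2 + \<zeta>))" for t \<omega>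
    proof -
      have "((Z t \<omega>)\<^sup>2)\<^sup>2 = \<bar>Z t \<omega>\<bar> powr 4"
        by (cases "Z t \<omega> = 0") (simp_all add: powr_numeral)
      then have "(((Z t \<omega>)\<^sup>2)\<^sup>2) powr q = \<bar>Z t \<omega>\<bar> powr (4 * q)" by (simp only: powr_powr)
      also have "4 * q = 2 * (2 + \<zeta>)" by (simp add: q_def field_simps)
      finally show ?thesis .
    qed
    have int: "integrable M (\<lambda>\<omega>. ((Z t \<omega>)\<^sup>2)\<^sup>2)" and le: "(\<integral>\<omega>. ((Z t \<omega>)\<^sup>2)\<^sup>2 \<partial>M) \<le>
        (\<integral>\<omega>. \<bar>Z t \<omega>\<bar> powr (2 * (2 + \<zeta>)) \<partial>M) powr (1 / q)" for t
      using Lyapunov_square[OF q, of "\<lambda>\<omega>. ((Z t \<omega>)\<^sup>2)\<^sup>2", unfolded pw, OF _ _ assms(22)] by simp_all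
    have eq: "(\<integral>\<omega>. f (Z t \<omega>) \<partial>M) = (\<integral>\<omega>. f (Z 0 \<omega>) \<partial>M)" if [measurable]: "f \<in> borel_measurable borel" for f :: "real \<Rightarrow> real"
    proof -
      have "(\<integral>\<omega>. f (Z i \<omega>) \<partial>M) = (\<integral>x. f x \<partial>distr M borel (Z i))" for i by (subst integral_distr) auto
      then show ?thesis using ident[of t 0] by simp
    qed
    have "(\<integral>\<omega>. ((Z t \<omega>)\<^sup>2)\<^sup>2 \<partial>M) \<le> \<kappa>\<^sup>2"
    proof -
      have "(\<integral>\<omega>. ((Z t \<omega>)\<^sup>2)\<^sup>2 \<partial>M) = (\<integral>\<omega>. ((Z 0 \<omega>)\<^sup>2)\<^sup>2 \<partial>M)" by (rule eq[of "\<lambda>x. (x\<^sup>2)\<^sup>2"]) simp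
      also note le[of 0]
      also have "(\<integral>\<omega>. \<bar>Z 0 \<omega>\<bar> powr (2 * (2 + \<zeta>)) \<partial>M) powr (1 / q) = \<kappa> powr 2"
        unfolding \<kappa>_def by (simp add: powr_powr q_def)
      also have "\<kappa> powr 2 = \<kappa>\<^sup>2" by (cases "\<kappa> = 0") (simp_all add: powr_numeral \<kappa>_def)
      finally show ?thesis .
    qed
    then have "(l2norm (\<lambda>\<omega>. (Z t \<omega>)\<^sup>2))\<^sup>2 \<le> \<kappa>\<^sup>2" by (simp add: l2norm_squared)
    then have "l2norm (\<lambda>\<omega>. (Z t \<omega>)\<^sup>2) \<le> \<kappa>" by (rule power2_le_imp_le) (simp add: \<kappa>_def)
    then show ?thesis using int by (simp add: sq_int_def)
  qed
  interpret arch_model M Z p \<kappa> A \<rho>\<^sub>2 \<delta>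
  proof unfold_locales
    show "\<kappa> * A \<le> 1 - \<delta>" using assms(23)[of 0] by (simp add: \<kappa>_def A_def)
  qed (use assms ident W_l2 A_nonneg iid in auto)
  define \<alpha> where "\<alpha> N j t = extend_by_right_limit (a j) (real_of_int t / real N)" for N j t
  have extend: "(\<forall>j\<le>p. 0 \<le> extend_by_right_limit (a j) v) \<and> extend_by_right_limit (a 0) v \<le> \<rho>\<^sub>2 \<and>
      (\<Sum>j=1..p. extend_by_right_limit (a j) v) \<le> A" if v: "v \<le> 1" for v
  proof (cases "0 < v")
    case True
    then show ?thesis using v a_nonneg a0_le A_upper by (simp add: extend_by_right_limit_def)
  next
    case False
    \<comment> \<open>At nonpositive times the coefficients are right limits at 0. These exist by
      Hoelder continuity, so the bounds valid on (0,1] pass to them.\<close>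
    have lim: "(a j \<longlongrightarrow> Lim (at_right 0) (a j)) (at_right 0)" if "j \<le> p" for j
      by (rule hoelder_right_limit[OF assms(14,16) hoelder[OF that]])
    have ev: "\<forall>\<^sub>F u in at_right 0. u \<in> {0<..1::real}"
      by (auto simp: eventually_at_right_field intro!: exI[of _ 1])
    have "0 \<le> Lim (at_right 0) (a j)" if "j \<le> p" for j
      by (rule tendsto_lowerbound[OF lim[OF that] eventually_mono[OF ev]]) (use a_nonneg that in auto)
    moreover have "Lim (at_right 0) (a 0) \<le> \<rho>\<^sub>2"
      by (rule tendsto_upperbound[OF lim eventually_mono[OF ev]]) (use a0_le in auto)
    moreover have "(\<Sum>j=1..p. Lim (at_right 0) (a j)) \<le> A"
    proof (rule tendsto_upperbound)
      show "((\<lambda>u. \<Sum>j=1..p. a j u) \<longlongrightarrow> (\<Sum>j=1..p. Lim (at_right 0) (a j))) (at_right 0)"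
        by (intro tendsto_sum lim) auto
      show "\<forall>\<^sub>F u in at_right 0. (\<Sum>j=1..p. a j u) \<le> A" using ev by eventually_elim (rule A_upper)
    qed simp
    ultimately show ?thesis using False by (simp add: extend_by_right_limit_def)
  qed
  have adm: "admissible (\<alpha> N) (int N)" if N: "1 \<le> N" for N
  proof -
    have "real_of_int t / real N \<le> 1" if "t \<le> int N" for t using that N by simp
    then show ?thesis using extend unfolding admissible_def \<alpha>_def by blast
  qed
  have tv: "arch_equations M Z p (\<alpha> N) {..int N} (X N)" "\<And>t. t \<le> int N \<Longrightarrow> causal_at M Z (X N) t"
    "\<exists>C. \<forall>t\<le>int N. integrable M (\<lambda>\<omega>. (X N t \<omega>)\<^sup>2) \<and> (\<integral>\<omega>. (X N t \<omega>)\<^sup>2 \<partial>M) \<le> C" if "1 \<le> N" for N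
    using assms(5) that unfolding tvarch_def \<alpha>_def[abs_def] by auto
  have sol: "square_solution (\<alpha> N) (int N) (X N)" if N: "1 \<le> N" for N
  proof (rule square_solutionI[OF tv(1)[OF N] order_refl tv(2)[OF N]])
    obtain C where "\<forall>t\<le>int N. integrable M (\<lambda>\<omega>. (X N t \<omega>)\<^sup>2) \<and> (\<integral>\<omega>. (X N t \<omega>)\<^sup>2 \<partial>M) \<le> C"
      using tv(3)[OF N] by blast
    then show "\<exists>K. \<forall>t\<le>int N. prob {\<omega> \<in> space M. (X N t \<omega>)\<^sup>2 > K} \<le> \<eta>" if "0 < \<eta>" for \<eta>
      using bounded_second_moment_tight[of "{..int N}" "X N" C \<eta>] that by auto
  qed
  have st: "arch_equations M Z p (\<lambda>j t. a j u) UNIV (Xt u)" "causal_at M Z (Xt u) t" "strictly_stationary M (Xt u)"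
    if "0 < u" "u < 1" for u t
    using assms(6)[of u] that by (auto simp: stationary_arch_def)
  have adm': "admissible (\<lambda>j t. a j u) T" if "0 < u" "u < 1" for u T
    unfolding admissible_def using that a_nonneg a0_le A_upper by auto
  have sol': "square_solution (\<lambda>j t. a j u) T (Xt u)" if u: "0 < u" "u < 1" for u T
  proof (rule square_solutionI[OF st(1)[OF u] subset_UNIV st(2)[OF u]])
    show "\<exists>K. \<forall>t\<le>T. prob {\<omega> \<in> space M. (Xt u t \<omega>)\<^sup>2 > K} \<le> \<eta>" if "0 < \<eta>" for \<eta>
      using stationary_square_tight[OF st(3)[OF u] that] by blast
  qed
  have close: "\<forall>\<^sub>F N in sequentially. \<forall>r j. \<bar>r - \<lceil>real N * u\<rceil>\<bar> \<le> int d \<longrightarrow> j \<le> p \<longrightarrow>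
      r \<le> int N \<and> \<bar>\<alpha> N j r - a j u\<bar> \<le> \<eta>" if u: "0 < u" "u < 1" and \<eta>: "0 < \<eta>" for u d \<eta>
  proof -
    \<comment> \<open>The three terms keep the rescaled time above 0, keep it at most 1, and bring
      the coefficient within \<eta> by Hoelder continuity.\<close>
    define e where "e = min (u / 2) (min (1 - u) ((\<eta> / K\<^sub>0) powr (1 / \<beta>)))"
    have e: "0 < e" "e < u" "e \<le> 1 - u" "e \<le> (\<eta> / K\<^sub>0) powr (1 / \<beta>)"
      using u \<eta> assms(16) by (auto simp: e_def)
    \<comment> \<open>The additional 1 accounts for rounding N u up to an integer.\<close>
    obtain N0 :: nat where N0: "(real d + 1) / e < real N0" using reals_Archimedean2 by blast
    have "r \<le> int N \<and> \<bar>\<alpha> N j r - a j u\<bar> \<le> \<eta>"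
      if N: "max N0 1 \<le> N" and r: "\<bar>r - \<lceil>real N * u\<rceil>\<bar> \<le> int d" and j: "j \<le> p" for N r j
    proof -
      have N1: "0 < real N" using N by simp
      have "real d + 1 < e * real N"
      proof -
        have "(real d + 1) / e < real N" using N0 N by linarith
        then show ?thesis using e(1) by (simp add: pos_divide_less_eq mult.commute)
      qed
      moreover have "\<bar>real_of_int r - real N * u\<bar> \<le> real d + 1"
        using r by linarith
      ultimately have "\<bar>real_of_int r - real N * u\<bar> \<le> e * real N" by linarith
      moreover have "real_of_int r - real N * u = (real_of_int r / real N - u) * real N"
        using N1 by (simp add: field_simps)
      ultimately have "\<bar>real_of_int r / real N - u\<bar> * real N \<le> e * real N" by (simp add: abs_mult)
      then have v: "\<bar>real_of_int r / real N - u\<bar> \<le> e" using N1 by (rule mult_right_le_imp_le)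
      then have v1: "real_of_int r / real N \<in> {0<..1}" using e by auto
      then have "real_of_int r \<le> real N" using N1 by (simp add: pos_divide_le_eq)
      then have "r \<le> int N" by linarith
      moreover have "\<bar>\<alpha> N j r - a j u\<bar> \<le> \<eta>"
        unfolding \<alpha>_def using u
        by (intro extended_coefficients_close[OF assms(14,16) hoelder[OF j] e(1,4) \<eta> _ v1 v]) auto
      ultimately show ?thesis ..
    qed
    then show ?thesis unfolding eventually_sequentially by blast
  qed
  define G where "G u = (\<integral>\<omega>. (Xt u s \<omega>)\<^sup>2 * (Xt u (s + int h) \<omega>)\<^sup>2 \<partial>M)" for u
  have \<mu>: "\<mu> = (\<lambda>u. \<integral>\<omega>. (Xt u s \<omega>)\<^sup>2 \<partial>M)" using assms(25) by (rule ext)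
  note lim = sample_autocov_limit[of \<alpha> X h "\<lambda>u j. a j u" Xt s, OF adm sol assms(24) adm' sol' st(3) close,
      folded G_def[abs_def] \<mu>]
  have \<mu>_int: "set_integrable lborel {0<..<1} \<mu>" and G_int: "set_integrable lborel {0<..<1} G"
    using lim(1,2) unfolding \<mu> G_def[abs_def] by auto
  have sq: "sq_int (\<lambda>\<omega>. (Xt u t \<omega>)\<^sup>2)" "l2norm (\<lambda>\<omega>. (Xt u t \<omega>)\<^sup>2) \<le> l2bound" if "0 < u" "u < 1" for u t
    using square_solution_l2[OF adm'[OF that] sol'[OF that] order_refl] by auto
  have \<mu>_bound: "\<bar>\<mu> u\<bar> \<le> l2bound" if u: "0 < u" "u < 1" for u
    unfolding \<mu> using order_trans[OF integral_abs_bound l1_le_l2norm[OF sq(1)[OF u]]] sq(2)[OF u] by (rule order_trans)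
  \<comment> \<open>The L^2 bound makes every term of the expanded covariance integrable, and
    stationarity gives both factors the mean \<open>\<mu> u\<close>.\<close>
  have c: "c u = G u - (\<mu> u)\<^sup>2" if u: "0 < u" "u < 1" for u
  proof -
    let ?V = "\<lambda>\<omega>. (Xt u s \<omega>)\<^sup>2" and ?V' = "\<lambda>\<omega>. (Xt u (s + int h) \<omega>)\<^sup>2"
    have EV: "(\<integral>\<omega>. ?V \<omega> \<partial>M) = \<mu> u" "(\<integral>\<omega>. ?V' \<omega> \<partial>M) = \<mu> u"
      using stationary_square_moments(1)[OF st(3)[OF u], of "s + int h" s] by (auto simp: \<mu>)
    note int = sq_int_mult_integrable[OF sq(1)[OF u, of s] sq(1)[OF u, of "s + int h"]]
      sq_int_integrable[OF sq(1)[OF u, of s]] sq_int_integrable[OF sq(1)[OF u, of "s + int h"]]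
    have "c u = (\<integral>\<omega>. ?V \<omega> * ?V' \<omega> - \<mu> u * ?V \<omega> - \<mu> u * ?V' \<omega> + \<mu> u * \<mu> u \<partial>M)"
      unfolding assms(26) covariance_def EV
      by (intro Bochner_Integration.integral_cong) (auto simp: algebra_simps)
    also have "\<dots> = G u - \<mu> u * \<mu> u - \<mu> u * \<mu> u + \<mu> u * \<mu> u"
      using int by (simp add: EV G_def prob_space)
    finally show ?thesis by (simp add: power2_eq_square)
  qed
  note tri = triangle_integral_eq_variance[OF \<mu>_int \<mu>_bound]
  \<comment> \<open>The interval integral is taken over the open interval, so the formula for the
    covariance on 0 < u < 1 is enough.\<close>
  have "(LBINT u=0..1. c u) = (LINT u:{0<..<1}|lborel. c u)"
    by (simp add: interval_lebesgue_integral_def einterval_eq zero_ereal_def one_ereal_def)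
  also have "\<dots> = (LINT u:{0<..<1}|lborel. G u - (\<mu> u)\<^sup>2)"
    by (rule set_lebesgue_integral_cong) (auto simp: c)
  also have "\<dots> = (LINT u:{0<..<1}|lborel. G u) - (LINT u:{0<..<1}|lborel. (\<mu> u)\<^sup>2)"
    by (rule set_integral_diff(2)[OF G_int tri(1)])
  finally have "(LBINT u=0..1. c u) + (LINT (u, v):{(u, v). 0 \<le> u \<and> u < v \<and> v \<le> 1}|lborel. (\<mu> u - \<mu> v)\<^sup>2)
      = (LINT u:{0<..<1}|lborel. G u) - (LINT u:{0<..<1}|lborel. \<mu> u)\<^sup>2"
    using tri(2) by simp
  then show ?thesis using lim(3) unfolding \<mu> G_def[abs_def] by simp
qed

end
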